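(* Let $d\ge0$ be an integer and let $G=C_2*\cdots*C_2$ be the free product, in the category of pro-$2$-groups, of $d+1$ copies of the cyclic group $C_2$ of order $2$. For $n\ge1$ define $$w_n(G)=\frac1n\sum_{m\mid n}\mu(n/m)\,\bigl(d^m-(-1)^m\bigr),$$ where $\mu$ is the Möbius function. If $n=2^k m$ with $k\ge0$, $m\geq 1$ and $(m,2)=1$, then $$c_n(G)=w_m(G)+w_{2m}(G)+\cdots+w_{2^k m}(G).$$
   Context: For a pro-$2$-group $G$, the Zassenhaus ($2$-)filtration $(G_{(n)})_{n\ge1}$ is defined by $G_{(1)}=G$ and, for $n\ge2$, $G_{(n)}=G_{(\lceil n/2\rceil)}^2\prod_{i+j=n}[G_{(i)},G_{(j)}]$ (with $i,j\ge1$), where for closed subgroups $H,K$, $[H,K]$ is the smallest closed subgroup containing all commutators $[x,y]=x^{-1}y^{-1}xy$ with $x\in H,y\in K$, and $H^2$ is the smallest closed subgroup containing all squares of elements of $H$. Put $c_n(G)=\dim_{\mathbb{F}_2}(G_{(n)}/G_{(n+1)})$, which is finite for finitely generated $G$. *)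

theory Defs
  imports
    "HOL-Analysis.Abstract_Topological_Spaces"
    "HOL-Algebra.Elementary_Groups"
    "HOL-Number_Theory.Residues"
    "HOL-Computational_Algebra.Squarefree"
    "Jordan_Normal_Form.Missing_VectorSpace"
begin

section \<open>Pro-2-groups\<close>

locale topological_group = group G
  for G :: "('a, 'm) monoid_scheme" (structure) +
  fixes T :: "'a topology"
  assumes topspace_eq: "topspace T = carrier G"
    and continuous_mult: "continuous_map (prod_topology T T) T (\<lambda>(x, y). x \<otimes> y)"
    and continuous_inv: "continuous_map T T (\<lambda>x. inv x)"

text \<open>
  Profinite groups are the compact, Hausdorff, totally disconnected topological groups; such a
  group is pro-2 if each quotient by an open normal subgroup is a finite 2-group. (A positive
  value of \<open>order\<close> entails finiteness.)
\<close>

locale pro2_group = topological_group +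
  assumes compact: "compact_space T"
    and Hausdorff: "Hausdorff_space T"
    and totally_disconnected: "\<And>S x y. connectedin T S \<Longrightarrow> x \<in> S \<Longrightarrow> y \<in> S \<Longrightarrow> x = y"
    and open_normal_index: "\<And>N. N \<lhd> G \<Longrightarrow> openin T N \<Longrightarrow> \<exists>k. order (G Mod N) = 2 ^ k"

definition continuous_hom ::
  "('a, 'm) monoid_scheme \<Rightarrow> 'a topology \<Rightarrow> ('b, 'n) monoid_scheme \<Rightarrow> 'b topology \<Rightarrow> ('a \<Rightarrow> 'b) set"
  where "continuous_hom G T H U = {f. f \<in> hom G H \<and> continuous_map T U f}"

text \<open>
  \<open>(G, T)\<close> with the maps \<open>\<phi> i\<close> is the free product (coproduct) of the family
  \<open>(A i, TA i)\<close>, \<open>i \<in> I\<close>, in the category of pro-2-groups. HOL cannot quantify over all types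
  inside a definition, so the pro-2-groups \<open>(H, U)\<close> of the universal property are those whose
  elements are taken from the type \<open>'h\<close>. For a finite family of finite groups, \<open>'h = nat set\<close>
  loses nothing. Existence: the maps \<open>\<psi> i\<close> take values in a finitely generated closed subgroup,
  which has at most continuum many elements. Uniqueness: homomorphisms into a pro-2-group are
  separated by its finite quotients, which are isomorphic to groups on that type.
\<close>

definition is_pro2_free_product ::
  "'h itself \<Rightarrow> 'i set \<Rightarrow> ('i \<Rightarrow> ('c, 'n) monoid_scheme) \<Rightarrow> ('i \<Rightarrow> 'c topology) \<Rightarrow>
   ('a, 'm) monoid_scheme \<Rightarrow> 'a topology \<Rightarrow> ('i \<Rightarrow> 'c \<Rightarrow> 'a) \<Rightarrow> bool"
  where "is_pro2_free_product _ I A TA G T \<phi> \<longleftrightarrow>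
    (\<forall>i\<in>I. pro2_group (A i) (TA i)) \<and>
    pro2_group G T \<and>
    (\<forall>i\<in>I. \<phi> i \<in> continuous_hom (A i) (TA i) G T) \<and>
    (\<forall>(H :: 'h monoid) U \<psi>.
      pro2_group H U \<and> (\<forall>i\<in>I. \<psi> i \<in> continuous_hom (A i) (TA i) H U) \<longrightarrow>
      (\<exists>f. f \<in> continuous_hom G T H U \<and> (\<forall>i\<in>I. \<forall>a\<in>carrier (A i). f (\<phi> i a) = \<psi> i a) \<and>
        (\<forall>g. g \<in> continuous_hom G T H U \<and> (\<forall>i\<in>I. \<forall>a\<in>carrier (A i). g (\<phi> i a) = \<psi> i a) \<longrightarrow>
          (\<forall>x\<in>carrier G. g x = f x))))"

abbreviation C2 :: "int monoid"
  where "C2 \<equiv> integer_mod_group 2"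

abbreviation C2_top :: "int topology"
  where "C2_top \<equiv> discrete_topology (carrier C2)"


section \<open>The Zassenhaus filtration\<close>

definition closed_generate :: "('a, 'm) monoid_scheme \<Rightarrow> 'a topology \<Rightarrow> 'a set \<Rightarrow> 'a set"
  where "closed_generate G T S = \<Inter> {K. subgroup K G \<and> closedin T K \<and> S \<subseteq> K}"

definition closed_commutator ::
  "('a, 'm) monoid_scheme \<Rightarrow> 'a topology \<Rightarrow> 'a set \<Rightarrow> 'a set \<Rightarrow> 'a set"
  where "closed_commutator G T H K = closed_generate G T
    {inv\<^bsub>G\<^esub> x \<otimes>\<^bsub>G\<^esub> inv\<^bsub>G\<^esub> y \<otimes>\<^bsub>G\<^esub> x \<otimes>\<^bsub>G\<^esub> y | x y. x \<in> H \<and> y \<in> K}"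

definition closed_squares :: "('a, 'm) monoid_scheme \<Rightarrow> 'a topology \<Rightarrow> 'a set \<Rightarrow> 'a set"
  where "closed_squares G T H = closed_generate G T {x \<otimes>\<^bsub>G\<^esub> x | x. x \<in> H}"

text \<open>
  The value at index 0 is a dummy. For \<open>n \<ge> 2\<close>, \<open>\<lceil>n/2\<rceil> = (n + 1) div 2\<close>, and the product over
  \<open>i + j = n\<close> is the product of subsets over \<open>i = 1, \<dots>, n - 1\<close> with \<open>j = n - i\<close> (the
  factors are normal, so their order is immaterial).
\<close>

fun zassenhaus :: "('a, 'm) monoid_scheme \<Rightarrow> 'a topology \<Rightarrow> nat \<Rightarrow> 'a set"
  where "zassenhaus G T n =
    (if n \<le> 1 then carrier G
     else closed_squares G T (zassenhaus G T ((n + 1) div 2)) <#>\<^bsub>G\<^esub>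
       foldr (\<lambda>i P. closed_commutator G T (zassenhaus G T i) (zassenhaus G T (n - i)) <#>\<^bsub>G\<^esub> P)
         [1..<n] {\<one>\<^bsub>G\<^esub>})"

declare zassenhaus.simps [simp del]

text \<open>
  The vector space over the field \<open>residue_ring 2\<close> attached to a group of
  exponent dividing 2, written additively. The fields \<open>mult\<close> and \<open>one\<close> are not used by modules.
\<close>

definition F2_space :: "('a, 'm) monoid_scheme \<Rightarrow> (int, 'a) module"
  where "F2_space V = \<lparr>carrier = carrier V, monoid.mult = monoid.mult V, one = one V,
    zero = one V, add = monoid.mult V, smult = (\<lambda>k v. v [^]\<^bsub>V\<^esub> k)\<rparr>"

definition zassenhaus_dim :: "('a, 'm) monoid_scheme \<Rightarrow> 'a topology \<Rightarrow> nat \<Rightarrow> nat"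
  where "zassenhaus_dim G T n = vectorspace.dim (residue_ring 2)
    (F2_space (G\<lparr>carrier := zassenhaus G T n\<rparr> Mod zassenhaus G T (n + 1)))"


section \<open>The numbers $w_n$\<close>

definition moebius_mu :: "nat \<Rightarrow> int"
  where "moebius_mu n = (if squarefree n then (-1) ^ card (prime_factors n) else 0)"

definition w :: "nat \<Rightarrow> nat \<Rightarrow> real"
  where "w d n = (1 / real n) *
    (\<Sum>m | m dvd n. of_int (moebius_mu (n div m)) * (real d ^ m - (-1) ^ m))"

end

theory Submission
  imports Defs
    "HOL-Library.Z2"
    "HOL-Library.Function_Algebras"
    "HOL-Library.Sublist"
    "HOL-Algebra.SndIsomorphismGrp"
    "HOL-Algebra.Weak_Morphisms"
    "HOL-Computational_Algebra.Formal_Power_Series"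
begin

text \<open>
  The proof counts a quotient of a group algebra in two ways. Let \<open>x\<^sub>0, \<dots>, x\<^sub>d\<close> be the canonical
  generators, \<open>P = G / G\<^sub>(\<^sub>N\<^sub>)\<close> and \<open>I\<close> the augmentation ideal of the group algebra of the finite
  2-group \<open>P\<close> over the field of two elements. By the argument of Jennings, the products of the
  elements \<open>b - 1\<close>, where \<open>b\<close> runs through representatives of bases of the quotients
  \<open>G\<^sub>(\<^sub>n\<^sub>) / G\<^sub>(\<^sub>n\<^sub>+\<^sub>1\<^sub>)\<close>, form a basis adapted to the powers of \<open>I\<close>. On the other hand, modulo
  \<open>I\<^sup>N\<close> a basis is given by the words of length less than \<open>N\<close> in the \<open>x\<^sub>i - 1\<close> without equal
  neighbours: they generate because \<open>(x\<^sub>i - 1)\<^sup>2 = 0\<close>, and they are independent because \<open>G\<close> maps to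
  the units of the truncated algebra on such words by \<open>x\<^sub>i \<mapsto> 1 + X\<^sub>i\<close>. There are
  \<open>(d + 1) d\<^sup>n\<^sup>-\<^sup>1\<close> such words of length \<open>n \<ge> 1\<close>, so
  \<open>\<Prod>\<^sub>n (1 + t\<^sup>n)\<^bsup>c(n)\<^esup> = (1 + t) / (1 - d t)\<close>; the logarithmic derivative and Moebius
  inversion give the formula for \<open>c(n) = c\<^sub>n(G)\<close>.
\<close>

section \<open>Jennings bases\<close>

text \<open>The group algebra is not built as such. \<open>char2_rep\<close> takes its ring as a
  type, and a type cannot depend on \<open>G\<close>, \<open>d\<close> or \<open>N\<close>; so both
  algebras are realised inside rings of additive operators on functions with values in the field of
  two elements, and independence is checked by evaluating operators on indicator functions.

  Both counts concern the sets \<open>J (carrier G) u\<close>, spanned by products of elements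
  \<open>R z - 1\<close> of total weight at least \<open>u\<close>. Moving factors into a fixed
  order bounds their size from above only. At \<open>u = 0\<close> the bound is attained, because
  the group algebra of \<open>P\<close> has \<open>2 ^ |P|\<close> elements, and this forces
  equality for every \<open>u\<close>.

  Finiteness of \<open>P\<close> is itself to be proved: each term of the filtration is open because
  open subgroups of \<open>G\<close> are topologically finitely generated.

  The sum over \<open>j\<close> in the result comes from
  \<open>1 + t^n = (1 - t^(2n)) / (1 - t^n)\<close>: the product over \<open>n\<close> becomes that
  of \<open>(1 - t^n)^(-v(n))\<close> with \<open>v(n) = c(n) - c(n/2)\<close> for even
  \<open>n\<close> and \<open>v(n) = c(n)\<close> for odd \<open>n\<close>. Inversion yields
  \<open>v(n) = w_n\<close>, and the sum telescopes along \<open>m, 2m, 4m, ...\<close>.\<close>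

locale filtered_group = group G for G (structure) +
  fixes Z :: "nat \<Rightarrow> 'a set"
  assumes Z_subgroup: "subgroup (Z n) G"
    and Z_one: "Z (Suc 0) = carrier G"
    and Z_Suc_subset: "Z (Suc n) \<subseteq> Z n"
    and Z_commutator: "\<lbrakk>i \<ge> 1; j \<ge> 1; x \<in> Z i; y \<in> Z j\<rbrakk> \<Longrightarrow> inv x \<otimes> inv y \<otimes> x \<otimes> y \<in> Z (i + j)"
    and Z_square: "\<lbrakk>i \<ge> 1; x \<in> Z i\<rbrakk> \<Longrightarrow> x \<otimes> x \<in> Z (2 * i)"
begin

lemma Z_antimono: "i \<le> j \<Longrightarrow> Z j \<subseteq> Z i"
  using lift_Suc_antimono_le[of Z, OF Z_Suc_subset] by blast

lemma Z_carrier: "x \<in> Z n \<Longrightarrow> x \<in> carrier G"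
  using subgroup.subset[OF Z_subgroup] by blast

lemma conj_eq_mult_commutator:
  assumes "x \<in> carrier G" "b \<in> carrier G"
  shows "inv b \<otimes> x \<otimes> b = x \<otimes> (inv x \<otimes> inv b \<otimes> x \<otimes> b)"
  using assms by (simp add: m_assoc[symmetric])

lemma Z_conj:
  assumes "n \<ge> 1" "z \<in> Z n" "g \<in> carrier G"
  shows "inv g \<otimes> z \<otimes> g \<in> Z n"
proof -
  have "inv z \<otimes> inv g \<otimes> z \<otimes> g \<in> Z (n + Suc 0)"
    using Z_commutator[of n "Suc 0" z g] Z_one assms by auto
  then have "inv z \<otimes> inv g \<otimes> z \<otimes> g \<in> Z n" using Z_Suc_subset by auto
  then show ?thesis
    using conj_eq_mult_commutator[OF Z_carrier] assms subgroup.m_closed[OF Z_subgroup] by metis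
qed

lemma Z_normal: "n \<ge> 1 \<Longrightarrow> Z n \<lhd> G"
  by (metis Z_conj Z_subgroup inv_closed inv_inv normal_inv_iff)

section \<open>Refining the filtration to a chain of subgroups of index 2\<close>

definition step :: "nat \<Rightarrow> 'a set \<Rightarrow> 'a \<Rightarrow> 'a set \<Rightarrow> bool"
  where "step n L b L' \<longleftrightarrow> n \<ge> 1 \<and> subgroup L G \<and> Z (Suc n) \<subseteq> L \<and> L \<subseteq> Z n \<and> b \<in> Z n \<and> b \<notin> L
    \<and> L' = L \<union> (\<lambda>l. b \<otimes> l) ` L"

abbreviation cosets_in :: "'a set \<Rightarrow> 'a set \<Rightarrow> 'a set set"
  where "cosets_in K L \<equiv> (\<lambda>g. K #> g) ` L"

text \<open>Squares and commutators of elements of weight \<open>n\<close> have weight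
  \<open>2 * n\<close>, which is at least \<open>Suc n\<close>, so they fall into \<open>L\<close>.
  Modulo \<open>L\<close> the element \<open>b\<close> is therefore an involution that commutes with
  everything, and one new coset suffices.\<close>

lemma step_subgroup:
  assumes st: "step n L b L'"
  shows "subgroup L' G"
proof -
  from st have n: "n \<ge> 1" and L: "subgroup L G" and ZL: "Z (Suc n) \<subseteq> L" and LZ: "L \<subseteq> Z n"
    and b: "b \<in> Z n" and L': "L' = L \<union> (\<lambda>l. b \<otimes> l) ` L" by (auto simp: step_def)
  have Lc: "L \<subseteq> carrier G" using subgroup.subset[OF L] .
  have bc: "b \<in> carrier G" using b Z_carrier by auto
  have bb: "b \<otimes> b \<in> L"
    using Z_square[OF n b] ZL Z_antimono[of "Suc n" "2*n"] n by auto
  have cj: "inv b \<otimes> l \<otimes> b \<in> L" if "l \<in> L" for l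
  proof -
    have "inv l \<otimes> inv b \<otimes> l \<otimes> b \<in> Z (n + n)" using Z_commutator[OF n n _ b] that LZ by auto
    then have "inv l \<otimes> inv b \<otimes> l \<otimes> b \<in> L" using ZL Z_antimono[of "Suc n" "n+n"] n by auto
    then show ?thesis using conj_eq_mult_commutator[OF _ bc] that Lc subgroup.m_closed[OF L] by auto
  qed
  have bL: "x \<in> L' " if "x = b \<otimes> l" "l \<in> L" for x l using that L' by auto
  show ?thesis
  proof (rule subgroupI)
    show "L' \<subseteq> carrier G" using L' Lc bc by auto
    show "L' \<noteq> {}" using L' subgroup.one_closed[OF L] by auto
  next
    fix a assume "a \<in> L'"
    then consider "a \<in> L" | l where "l \<in> L" "a = b \<otimes> l" using L' by auto
    then show "inv a \<in> L'"
    proof cases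
      case 1 then show ?thesis using L' subgroup.m_inv_closed[OF L] by auto
    next
      case (2 l)
      have lc: "l \<in> carrier G" using 2 Lc by auto
      have "(inv b \<otimes> inv l \<otimes> b) \<otimes> inv (b \<otimes> b) \<in> L"
        using cj[of "inv l"] bb 2 L subgroup.m_closed[OF L] subgroup.m_inv_closed[OF L] by auto
      moreover have "inv a = b \<otimes> ((inv b \<otimes> inv l \<otimes> b) \<otimes> inv (b \<otimes> b))"
      proof -
        have "b \<otimes> ((inv b \<otimes> inv l \<otimes> b) \<otimes> (inv b \<otimes> inv b))
            = (b \<otimes> inv b) \<otimes> inv l \<otimes> (b \<otimes> inv b) \<otimes> inv b"
          using bc lc by (simp only: m_assoc m_closed inv_closed)
        then show ?thesis using bc lc 2 by (simp add: inv_mult_group)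
      qed
      ultimately show ?thesis using bL by blast
    qed
  next
    fix a c assume "a \<in> L'" "c \<in> L'"
    then consider "a \<in> L" "c \<in> L" | l where "a \<in> L" "l \<in> L" "c = b \<otimes> l"
      | l where "c \<in> L" "l \<in> L" "a = b \<otimes> l"
      | l k where "l \<in> L" "k \<in> L" "a = b \<otimes> l" "c = b \<otimes> k" using L' by auto
    then show "a \<otimes> c \<in> L'"
    proof cases
      case 1 then show ?thesis using L' subgroup.m_closed[OF L] by auto
    next
      case (2 l)
      have "a \<otimes> c = b \<otimes> ((inv b \<otimes> a \<otimes> b) \<otimes> l)"
        using 2 Lc bc by (simp add: m_assoc[symmetric] subset_iff)
      then show ?thesis using bL cj[OF 2(1)] 2 subgroup.m_closed[OF L] by blast
    next
      case (3 l)
      then show ?thesis using bL[of "a \<otimes> c" "l \<otimes> c"] Lc bc subgroup.m_closed[OF L]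
        by (auto simp: m_assoc subset_iff)
    next
      case (4 l k)
      have "a \<otimes> c = (b \<otimes> b) \<otimes> ((inv b \<otimes> l \<otimes> b) \<otimes> k)"
      proof -
        have "(b \<otimes> b) \<otimes> ((inv b \<otimes> l \<otimes> b) \<otimes> k) = b \<otimes> (b \<otimes> inv b) \<otimes> l \<otimes> b \<otimes> k"
          using 4 Lc bc by (simp only: m_assoc m_closed inv_closed subset_iff)
        then show ?thesis using 4 Lc bc by (simp add: m_assoc subset_iff)
      qed
      then show ?thesis using bb cj[OF 4(1)] 4 subgroup.m_closed[OF L] L' by auto
    qed
  qed
qed

text \<open>Left translation by \<open>b\<close> carries the \<open>K\<close>-cosets in
  \<open>L\<close> bijectively to the new ones; this is where normality of \<open>K\<close> enters.
  Applied with \<open>K = Z N\<close> it counts a whole chain, with \<open>K = Z (Suc n)\<close> it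
  measures progress inside one layer.\<close>

lemma card_cosets_step:
  assumes st: "step n L b L'" and K: "K \<lhd> G" "K \<subseteq> L" and fin: "finite (cosets_in K L)"
  shows "finite (cosets_in K L')" "card (cosets_in K L') = 2 * card (cosets_in K L)"
proof -
  from st have L: "subgroup L G" and b: "b \<in> Z n" and bL: "b \<notin> L"
    and L': "L' = L \<union> (\<lambda>l. b \<otimes> l) ` L" by (auto simp: step_def)
  have Lc: "L \<subseteq> carrier G" using subgroup.subset[OF L] .
  have bc: "b \<in> carrier G" using b Z_carrier by auto
  have Ks: "subgroup K G" and Kc: "K \<subseteq> carrier G"
    using K normal_imp_subgroup subgroup.subset by blast+
  define B where "B = cosets_in K ((\<lambda>l. b \<otimes> l) ` L)"
  have un: "cosets_in K L' = cosets_in K L \<union> B" unfolding L' B_def by (simp add: image_Un)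
  have bl: "K #> (b \<otimes> l) = b <# (K #> l)" if "l \<in> L" for l
  proof -
    have lc: "l \<in> carrier G" using that Lc by auto
    have "K #> (b \<otimes> l) = (K #> b) #> l" using coset_mult_assoc[OF Kc bc lc] by simp
    also have "\<dots> = (b <# K) #> l" using K(1) bc normal.coset_eq by fastforce
    finally show ?thesis by (simp add: coset_assoc[OF bc lc Kc])
  qed
  have B: "B = (\<lambda>C. b <# C) ` cosets_in K L"
    unfolding B_def image_image using bl by (intro image_cong) auto
  have inj: "inj_on (\<lambda>C. b <# C) (cosets_in K L)"
  proof (rule inj_onI)
    fix C D assume "C \<in> cosets_in K L" "D \<in> cosets_in K L" and e: "b <# C = b <# D"
    then have CD: "C \<subseteq> carrier G" "D \<subseteq> carrier G" using r_coset_subset_G[OF Kc] Lc by auto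
    have "inv b <# (b <# C) = inv b <# (b <# D)" using e by simp
    then show "C = D" using CD bc by (simp add: lcos_m_assoc lcos_mult_one)
  qed
  have disj: "cosets_in K L \<inter> B = {}"
  proof (rule ccontr)
    assume "cosets_in K L \<inter> B \<noteq> {}"
    then obtain l l' where l: "l \<in> L" "l' \<in> L" "K #> l = K #> (b \<otimes> l')" unfolding B_def by blast
    have "b \<otimes> l' \<in> K #> (b \<otimes> l')"
      using rcos_self[OF _ Ks] l Lc bc by blast
    then have "b \<otimes> l' \<in> K #> l" using l by simp
    then obtain k where k: "k \<in> K" "b \<otimes> l' = k \<otimes> l" unfolding r_coset_def by auto
    have "b \<otimes> l' \<in> L" using k K l subgroup.m_closed[OF L] by auto
    then have "(b \<otimes> l') \<otimes> inv l' \<in> L" using l subgroup.m_closed[OF L] subgroup.m_inv_closed[OF L] by auto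
    then show False using bL l Lc bc by (simp add: m_assoc subset_iff)
  qed
  show "finite (cosets_in K L')" unfolding un B using fin by auto
  show "card (cosets_in K L') = 2 * card (cosets_in K L)"
    unfolding un using card_Un_disjoint[OF fin _ disj] card_image[OF inj] fin B by auto
qed

text \<open>Weights are prepended, so the head of the list belongs to the generator adjoined last.
  The recursion of \<open>num_ge\<close> follows the same order.\<close>

inductive chain :: "nat \<Rightarrow> 'a set \<Rightarrow> nat list \<Rightarrow> bool" for N where
  chain_Nil: "chain N (Z N) []"
| chain_Cons: "chain N L ns \<Longrightarrow> step n L b L' \<Longrightarrow> chain N L' (n # ns)"

lemma chain_subgroup: "chain N L ns \<Longrightarrow> subgroup L G"
  by (induction rule: chain.induct) (auto intro: Z_subgroup step_subgroup)

lemma chain_card: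
  assumes "chain N L ns" "N \<ge> 1"
  shows "Z N \<subseteq> L \<and> finite (cosets_in (Z N) L) \<and> card (cosets_in (Z N) L) = 2 ^ length ns"
  using assms
proof (induction rule: chain.induct)
  case chain_Nil
  have "cosets_in (Z N) (Z N) = {Z N}"
    using coset_join2[OF Z_carrier Z_subgroup] subgroup.one_closed[OF Z_subgroup] by force
  then show ?case by auto
next
  case (chain_Cons L ns n b L')
  then show ?case using card_cosets_step[OF chain_Cons.hyps(2) Z_normal[of N]]
    by (auto simp: step_def)
qed

text \<open>As long as \<open>L\<close> is smaller than \<open>Z n\<close>, any \<open>b\<close>
  outside it gives a step that doubles the number of cosets of \<open>Z (Suc n)\<close> in
  \<open>L\<close>; finiteness of that number for \<open>Z n\<close> ends the process.\<close>

lemma chain_extend: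
  assumes "chain N (Z (Suc n)) ns" "n \<ge> 1" "finite (cosets_in (Z (Suc n)) (Z n))"
  shows "\<exists>c. chain N (Z n) (replicate c n @ ns) \<and> card (cosets_in (Z (Suc n)) (Z n)) = 2 ^ c"
proof -
  let ?K = "Z (Suc n)"
  have fin: "finite (cosets_in ?K L)" if "L \<subseteq> Z n" for L
    using finite_subset[OF image_mono[OF that] assms(3)] .
  have *: "\<exists>c. chain N (Z n) (replicate c n @ ns) \<and> card (cosets_in ?K (Z n)) = 2 ^ c"
    if "chain N L (replicate c n @ ns)" "?K \<subseteq> L" "L \<subseteq> Z n" "card (cosets_in ?K L) = 2 ^ c" for L c
    using that
  proof (induction "card (cosets_in ?K (Z n)) - card (cosets_in ?K L)" arbitrary: L c rule: less_induct)
    case less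
    show ?case
    proof (cases "L = Z n")
      case True
      then show ?thesis using less.prems by auto
    next
      case False
      then obtain b where b: "b \<in> Z n" "b \<notin> L" using less.prems by auto
      define L' where "L' = L \<union> (\<lambda>l. b \<otimes> l) ` L"
      have st: "step n L b L'" using less.prems b assms(2) chain_subgroup[OF less.prems(1)]
        by (auto simp: step_def L'_def)
      have L'Z: "L' \<subseteq> Z n" using less.prems b subgroup.m_closed[OF Z_subgroup] by (auto simp: L'_def)
      have c: "card (cosets_in ?K L') = 2 ^ Suc c"
        using card_cosets_step[OF st Z_normal less.prems(2) fin[OF less.prems(3)]] less.prems(4) by auto
      have le: "card (cosets_in ?K L') \<le> card (cosets_in ?K (Z n))"
        by (rule card_mono[OF assms(3) image_mono[OF L'Z]])
      have ch: "chain N L' (replicate (Suc c) n @ ns)"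
        using chain_Cons[OF less.prems(1) st] by simp
      have lt: "card (cosets_in ?K (Z n)) - card (cosets_in ?K L')
          < card (cosets_in ?K (Z n)) - card (cosets_in ?K L)"
      proof (rule diff_less_mono2)
        show "card (cosets_in ?K L) < card (cosets_in ?K L')" unfolding less.prems(4) c by simp
        then show "card (cosets_in ?K L) < card (cosets_in ?K (Z n))" using le by simp
      qed
      have "?K \<subseteq> L'" using less.prems(2) by (auto simp: L'_def)
      from less.hyps[OF lt ch this L'Z c] show ?thesis .
    qed
  qed
  show ?thesis
  proof -
    have "cosets_in ?K ?K = {?K}"
      using coset_join2[OF Z_carrier Z_subgroup] subgroup.one_closed[OF Z_subgroup] by force
    then show ?thesis using *[of ?K 0] assms(1) Z_Suc_subset by auto
  qed
qed

text \<open>The layers are treated from the bottom \<open>Z N\<close> upwards to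
  \<open>Z (Suc 0)\<close>, the whole group. The multiplicity of \<open>i\<close> in
  \<open>ns\<close> becomes the rank of the \<open>i\<close>-th layer.\<close>

lemma ex_chain:
  assumes "\<And>i. i \<ge> 1 \<Longrightarrow> i < N \<Longrightarrow> finite (cosets_in (Z (Suc i)) (Z i))" and "N \<ge> 1"
  shows "\<exists>ns. chain N (carrier G) ns \<and> set ns \<subseteq> {1..<N} \<and>
    (\<forall>i\<in>{1..<N}. card (cosets_in (Z (Suc i)) (Z i)) = 2 ^ count_list ns i)"
proof -
  have "\<exists>ns. chain N (Z (N - k)) ns \<and> set ns \<subseteq> {N - k..<N} \<and>
    (\<forall>i\<in>{N - k..<N}. card (cosets_in (Z (Suc i)) (Z i)) = 2 ^ count_list ns i)" if "k < N" for k
    using that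
  proof (induction k)
    case 0
    then show ?case using chain_Nil by auto
  next
    case (Suc k)
    define n where "n = N - Suc k"
    have n: "N - k = Suc n" "n \<ge> 1" "n < N" using Suc.prems by (auto simp: n_def)
    from Suc obtain ns where ns: "chain N (Z (Suc n)) ns" "set ns \<subseteq> {Suc n..<N}"
      "\<forall>i\<in>{Suc n..<N}. card (cosets_in (Z (Suc i)) (Z i)) = 2 ^ count_list ns i"
      unfolding n by auto
    obtain c where c: "chain N (Z n) (replicate c n @ ns)" "card (cosets_in (Z (Suc n)) (Z n)) = 2 ^ c"
      using chain_extend[OF ns(1) n(2)] assms(1)[of n] n by auto
    have rep: "count_list (replicate c n) i = (if i = n then c else 0)" for i by (induction c) auto
    have "n \<notin> set ns" using ns by auto
    then have "count_list (replicate c n @ ns) i = (if i = n then c else count_list ns i)" for i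
      by (simp add: rep)
    moreover have "{n..<N} = insert n {Suc n..<N}" using n by auto
    ultimately show ?case using c ns n unfolding n_def[symmetric]
      by (intro exI[of _ "replicate c n @ ns"]) auto
  qed
  from this[of "N - 1"] show ?thesis using assms(2) Z_one by auto
qed

end

text \<open>
  The number of sublists of \<open>ns\<close> of sum at least \<open>u\<close>. The truncation of \<open>u - n\<close> at 0 is intended,
  here and in \<open>J_step\<close>.
\<close>

fun num_ge :: "nat list \<Rightarrow> nat \<Rightarrow> nat" where
  "num_ge [] u = (if u = 0 then 1 else 0)"
| "num_ge (n # ns) u = num_ge ns u + num_ge ns (u - n)"

lemma num_ge_0: "num_ge ns 0 = 2 ^ length ns"
  by (induction ns) auto

section \<open>The weight filtration of a group algebra in characteristic 2\<close>

locale char2_rep = filtered_group +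
  fixes R :: "'a \<Rightarrow> 'r::ring_1"
  assumes char2: "(r::'r) + r = 0"
    and R_mult: "\<lbrakk>x \<in> carrier G; y \<in> carrier G\<rbrakk> \<Longrightarrow> R (x \<otimes> y) = R x * R y"
    and R_one: "R \<one> = 1"
begin

lemma minus_eq_plus: "x - y = x + (y::'r)"
  by (metis add_diff_cancel_right' add.assoc add_0_right char2)

text \<open>For \<open>L = carrier G\<close> this turns out to be the \<open>u\<close>-th power of the augmentation ideal.\<close>

inductive J :: "'a set \<Rightarrow> nat \<Rightarrow> 'r \<Rightarrow> bool" for L where
  J_zero: "J L u 0"
| J_one: "J L 0 1"
| J_add: "J L u x \<Longrightarrow> J L u y \<Longrightarrow> J L u (x + y)"
| J_mult: "J L v x \<Longrightarrow> z \<in> L \<Longrightarrow> z \<in> Z k \<Longrightarrow> k \<ge> 1 \<Longrightarrow> u \<le> k + v \<Longrightarrow> J L u ((R z - 1) * x)"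

lemma J_antimono: "J L v x \<Longrightarrow> u \<le> v \<Longrightarrow> J L u x"
proof (induction arbitrary: u rule: J.induct)
  case (J_mult v x z k u')
  then show ?case by (meson J.J_mult le_trans)
qed (auto intro: J.intros)

lemma J_mono: "J L u x \<Longrightarrow> L \<subseteq> L' \<Longrightarrow> J L' u x"
  by (induction rule: J.induct) (auto intro: J.intros)

lemma J_R_mult:
  assumes "J L u x" "z \<in> L" "L \<subseteq> carrier G"
  shows "J L u (R z * x)"
proof -
  have "z \<in> Z (Suc 0)" using assms Z_one by auto
  then have "J L u ((R z - 1) * x)" using J_mult[OF assms(1,2)] by simp
  from J_add[OF this assms(1)] show ?thesis by (simp add: algebra_simps)
qed

lemma J_R: "z \<in> L \<Longrightarrow> L \<subseteq> carrier G \<Longrightarrow> J L 0 (R z)"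
  using J_R_mult[OF J_one] by simp

lemma J_sum: "finite A \<Longrightarrow> (\<And>a. a \<in> A \<Longrightarrow> J L u (f a)) \<Longrightarrow> J L u (sum f A)"
  by (induction A rule: finite_induct) (auto intro: J.intros)

text \<open>
  The identities \<open>(z - 1)(b - 1) = (b - 1)(c - 1) + z([z, b] - 1)\<close> with \<open>c = z\<^sup>b\<close> and
  \<open>(b - 1)\<^sup>2 = b\<^sup>2 - 1\<close> move the new factor \<open>b - 1\<close> to the front without loss of weight.
\<close>

lemma J_step:
  assumes st: "step n L b L'"
  shows "J L' u x \<longleftrightarrow> (\<exists>e f. J L u e \<and> J L (u - n) f \<and> x = e + (R b - 1) * f)"
proof -
  from st have n: "n \<ge> 1" and L: "subgroup L G" and ZL: "Z (Suc n) \<subseteq> L" and LZ: "L \<subseteq> Z n"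
    and b: "b \<in> Z n" and L': "L' = L \<union> (\<lambda>l. b \<otimes> l) ` L" by (auto simp: step_def)
  have Lc: "L \<subseteq> carrier G" using subgroup.subset[OF L] .
  have bc: "b \<in> carrier G" using b Z_carrier by auto
  have L'c: "L' \<subseteq> carrier G" using L' Lc bc by auto
  have bL': "b \<in> L'" using L' subgroup.one_closed[OF L] bc by force
  \<comment> \<open>\<open>K u\<close> is the right-hand side of the claim. The hard inclusion
    amounts to \<open>K\<close> being closed under the rules that generate
    \<open>J L'\<close>.\<close>
  define K where "K u x \<longleftrightarrow> (\<exists>e f. J L u e \<and> J L (u - n) f \<and> x = e + (R b - 1) * f)" for u x
  have Kadd: "K u (x + y)" if "K u x" "K u y" for u x y
  proof -
    from that obtain e f e' f' where "J L u e" "J L (u - n) f" "x = e + (R b - 1) * f"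
      "J L u e'" "J L (u - n) f'" "y = e' + (R b - 1) * f'" unfolding K_def by blast
    then show ?thesis unfolding K_def
      by (intro exI[of _ "e + e'"] exI[of _ "f + f'"]) (auto simp: distrib_left add_ac intro: J_add)
  qed
  have KJ: "K u e" if "J L u e" for u e
    unfolding K_def using that J_zero by (intro exI[of _ e] exI[of _ 0]) auto
  have KbJ: "K u ((R b - 1) * f)" if "J L (u - n) f" for u f
    unfolding K_def using that J_zero by (intro exI[of _ 0] exI[of _ f]) auto
  have Kanti: "K u x" if "K v x" "u \<le> v" for v u x
  proof -
    from that obtain e f where "J L v e" "J L (v - n) f" "x = e + (R b - 1) * f"
      unfolding K_def by blast
    then show ?thesis unfolding K_def using that J_antimono[of L v e u]
      J_antimono[of L "v - n" f "u - n"] by (metis diff_le_mono)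
  qed
  have KL: "K (k + v) ((R z - 1) * x)" if x: "K v x" and z: "z \<in> L" "z \<in> Z k" "k \<ge> 1" for k v z x
  proof -
    from x obtain e f where e: "J L v e" and f: "J L (v - n) f" and xe: "x = e + (R b - 1) * f"
      unfolding K_def by blast
    define c where "c = inv b \<otimes> z \<otimes> b"
    define d where "d = inv z \<otimes> inv b \<otimes> z \<otimes> b"
    have zc: "z \<in> carrier G" using z Lc by auto
    have cd: "c = z \<otimes> d" using conj_eq_mult_commutator[OF zc bc] by (simp add: c_def d_def)
    \<comment> \<open>The commutator has weight at least \<open>Suc n\<close> and so lies in
      \<open>L\<close>: the correction term involves \<open>L\<close> alone and no further factor
      \<open>R b - 1\<close>.\<close>
    have dZ: "d \<in> Z (k + n)" unfolding d_def using Z_commutator[OF z(3) n z(2) b] .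
    moreover have "k + n \<ge> Suc n" using z(3) by auto
    ultimately have dL: "d \<in> L" using ZL Z_antimono by blast
    have dc: "d \<in> carrier G" using dL Lc by auto
    have cL: "c \<in> L" using cd dL z L by (simp add: subgroup.m_closed)
    have cZ: "c \<in> Z k" unfolding c_def using Z_conj z bc by auto
    have cc: "c \<in> carrier G" using cL Lc by auto
    have zb: "R z * R b = R b * R c"
    proof -
      have "b \<otimes> c = z \<otimes> b" unfolding c_def using bc zc by (simp add: m_assoc[symmetric])
      then show ?thesis using R_mult[OF bc cc] R_mult[OF zc bc] by simp
    qed
    have Rc: "R c = R z * R d" using R_mult[OF zc dc] cd by simp
    have eq: "(R z - 1) * (R b - 1) = (R b - 1) * (R c - 1) + R z * (R d - 1)"
      using zb Rc by (simp add: algebra_simps)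
    have 1: "K (k + v) ((R z - 1) * e)" by (intro KJ J_mult[OF e z]) simp
    have "J L (k + v - n) ((R c - 1) * f)" by (rule J_mult[OF f cL cZ z(3)]) simp
    then have 2: "K (k + v) ((R b - 1) * ((R c - 1) * f))" by (rule KbJ)
    \<comment> \<open>The weight \<open>k + n\<close> of \<open>d\<close> makes up for the
      \<open>n\<close> that \<open>f\<close> lacks: \<open>k + v\<close> is at most
      \<open>(k + n) + (v - n)\<close>, also when the difference is truncated.\<close>
    have "J L (k + v) ((R d - 1) * f)" by (rule J_mult[OF f dL dZ]) (use z in auto)
    then have 3: "K (k + v) (R z * ((R d - 1) * f))" by (intro KJ J_R_mult z Lc)
    have "(R z - 1) * x = (R z - 1) * e + (((R z - 1) * (R b - 1)) * f)"
      by (simp add: xe algebra_simps)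
    also have "\<dots> = (R z - 1) * e + ((R b - 1) * ((R c - 1) * f) + R z * ((R d - 1) * f))"
      unfolding eq by (simp only: distrib_right mult.assoc)
    finally show ?thesis using 1 2 3 by (auto intro!: Kadd)
  qed
  have Kb: "K (n + v) ((R b - 1) * x)" if "K v x" for v x
  proof -
    from that obtain e f where e: "J L v e" and f: "J L (v - n) f" and xe: "x = e + (R b - 1) * f"
      unfolding K_def by blast
    have bb: "b \<otimes> b \<in> Z (2 * n)" using Z_square[OF n b] .
    then have bbL: "b \<otimes> b \<in> L" using ZL Z_antimono[of "Suc n" "2*n"] n by auto
    have "(R b - 1) * (R b - 1) = R b * R b - 1 - ((R b - 1) + (R b - 1))"
      by (simp add: algebra_simps)
    also have "\<dots> = R (b \<otimes> b) - 1"
      by (simp only: char2 diff_zero R_mult[OF bc bc])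
    finally have sq: "(R b - 1) * (R b - 1) = R (b \<otimes> b) - 1" .
    have "J L (n + v) ((R (b \<otimes> b) - 1) * f)" by (rule J_mult[OF f bbL bb]) (use n in auto)
    moreover have "(R b - 1) * x = (R b - 1) * e + (R (b \<otimes> b) - 1) * f"
      unfolding sq[symmetric] by (simp add: xe algebra_simps)
    moreover have "J L (n + v - n) e" using e by simp
    ultimately show ?thesis using KJ KbJ Kadd by metis
  qed
  have KL': "K u ((R z - 1) * x)"
    if x: "K v x" and z: "z \<in> L'" "z \<in> Z k" "k \<ge> 1" and u: "u \<le> k + v" for k v u z x
  proof (cases "z \<in> L")
    case True
    then show ?thesis using KL[OF x True z(2,3)] Kanti u by blast
  next
    case False
    then obtain l where l: "l \<in> L" "z = b \<otimes> l" using z L' by auto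
    \<comment> \<open>Elements of weight above \<open>n\<close> already lie in \<open>L\<close>. For
      \<open>z\<close> outside \<open>L\<close> it therefore suffices to gain weight
      \<open>n\<close>.\<close>
    have kn: "k \<le> n"
    proof (rule ccontr)
      assume "\<not> k \<le> n"
      then have "z \<in> L" using z ZL Z_antimono[of "Suc n" k] by auto
      then show False using False by simp
    qed
    have lc: "l \<in> carrier G" using l Lc by auto
    have lx: "K (n + v) ((R l - 1) * x)" using KL[OF x l(1) _ n] l LZ by auto
    then have "K v (R l * x)"
      using Kadd[OF Kanti[OF lx, of v] x] by (simp add: algebra_simps)
    from Kb[OF this] have "K (n + v) ((R b - 1) * (R l * x) + (R l - 1) * x)"
      using lx by (rule Kadd)
    moreover have "(R z - 1) * x = (R b - 1) * (R l * x) + (R l - 1) * x"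
      using R_mult[OF bc lc] l by (simp add: algebra_simps)
    ultimately show ?thesis using Kanti[of "n + v" _ u] kn u by auto
  qed
  have "K u x" if "J L' u x"
    using that by (induction rule: J.induct) (auto intro: KJ J_zero J_one Kadd KL')
  moreover have "J L' u x" if "K u x"
  proof -
    from that obtain e f where e: "J L u e" and f: "J L (u - n) f" and xe: "x = e + (R b - 1) * f"
      unfolding K_def by blast
    have LL': "L \<subseteq> L'" using L' by auto
    have "J L' u ((R b - 1) * f)" by (rule J_mult[OF J_mono[OF f LL'] bL' b n]) simp
    then show ?thesis using J_add J_mono[OF e LL'] xe by auto
  qed
  ultimately show ?thesis unfolding K_def by blast
qed

lemma J_base:
  assumes "\<And>z. z \<in> Z N \<Longrightarrow> R z = 1"
  shows "J (Z N) u x \<longleftrightarrow> x = 0 \<or> (u = 0 \<and> x = 1)"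
proof
  assume "J (Z N) u x"
  then show "x = 0 \<or> (u = 0 \<and> x = 1)"
    by (induction rule: J.induct) (use assms char2 in auto)
qed (auto intro: J.intros)

text \<open>By \<open>J_step\<close> the elements for \<open>L'\<close> are images of pairs
  \<open>(e, f)\<close>, so the sizes at most multiply; in exponents of 2 this is the recursion of
  \<open>num_ge\<close>.\<close>

lemma J_card_le:
  assumes "chain N L ns" and "\<And>z. z \<in> Z N \<Longrightarrow> R z = 1"
  shows "finite {x. J L u x} \<and> card {x. J L u x} \<le> 2 ^ num_ge ns u"
  using assms(1)
proof (induction arbitrary: u rule: chain.induct)
  case chain_Nil
  have "{x. J (Z N) u x} = (if u = 0 then {0,1} else {0})" using J_base[OF assms(2)] by auto
  then show ?case by auto
next
  case (chain_Cons L ns n b L')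
  let ?f = "\<lambda>(e,f). e + (R b - 1) * f"
  have eq: "{x. J L' u x} = ?f ` ({x. J L u x} \<times> {x. J L (u - n) x})"
    using J_step[OF chain_Cons.hyps(2)] by (auto simp: image_iff)
  have "card {x. J L' u x} \<le> card ({x. J L u x} \<times> {x. J L (u - n) x})"
    unfolding eq by (rule card_image_le) (use chain_Cons.IH in auto)
  also have "\<dots> \<le> 2 ^ num_ge ns u * 2 ^ num_ge ns (u - n)"
    unfolding card_cartesian_product using chain_Cons.IH by (intro mult_mono) auto
  finally show ?case unfolding eq using chain_Cons.IH by (auto simp: power_add)
qed

text \<open>At \<open>u = 0\<close> the bound of \<open>J_card_le\<close> is
  \<open>2 ^ 2 ^ length ns\<close>. If it is attained at the end of the chain, it is attained at
  every stage, and each map from \<open>(e, f)\<close> to \<open>e + (R b - 1) * f\<close> is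
  injective. The maps for larger \<open>u\<close> are restrictions of these, so no size is lost
  there either.\<close>

lemma J_card:
  assumes "chain N L ns" and "\<And>z. z \<in> Z N \<Longrightarrow> R z = 1" and "card {x. J L 0 x} \<ge> 2 ^ 2 ^ length ns"
  shows "card {x. J L u x} = 2 ^ num_ge ns u"
  using assms(1,3)
proof (induction arbitrary: u rule: chain.induct)
  case chain_Nil
  have "{x. J (Z N) u x} = (if u = 0 then {0,1} else {0})" using J_base[OF assms(2)] by auto
  moreover have "card {0,1::'r} = 2" by simp
  ultimately show ?case by auto
next
  case (chain_Cons L ns n b L')
  let ?f = "\<lambda>(e,f). e + (R b - 1) * f"
  let ?J = "\<lambda>u. {x. J L u x}"
  have eq: "{x. J L' u x} = ?f ` (?J u \<times> ?J (u - n))" for u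
    using J_step[OF chain_Cons.hyps(2)] by (auto simp: image_iff)
  have fin: "finite (?J u)" for u using J_card_le[OF chain_Cons.hyps(1) assms(2)] by auto
  have le: "card (?J 0) \<le> 2 ^ 2 ^ length ns"
    using J_card_le[OF chain_Cons.hyps(1) assms(2)] num_ge_0 by metis
  have sq: "(2::nat) ^ 2 ^ length (n # ns) = 2 ^ 2 ^ length ns * 2 ^ 2 ^ length ns"
    by (simp flip: power_add power_mult)
  have im: "card (?f ` (?J 0 \<times> ?J 0)) \<ge> 2 ^ 2 ^ length ns * 2 ^ 2 ^ length ns"
    using chain_Cons.prems unfolding eq[of 0] sq by simp
  have im': "card (?f ` (?J 0 \<times> ?J 0)) \<le> card (?J 0) * card (?J 0)"
    using card_image_le[of "?J 0 \<times> ?J 0" ?f] fin by (simp add: card_cartesian_product)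
  have ge: "card (?J 0) \<ge> 2 ^ 2 ^ length ns"
  proof (rule ccontr)
    assume "\<not> ?thesis"
    then have "card (?J 0) * card (?J 0) < 2 ^ 2 ^ length ns * 2 ^ 2 ^ length ns"
      by (intro mult_strict_mono) auto
    then show False using im im' by linarith
  qed
  then have "card (?f ` (?J 0 \<times> ?J 0)) = card (?J 0 \<times> ?J 0)"
    using antisym[OF le ge] im im' by (simp add: card_cartesian_product)
  then have inj: "inj_on ?f (?J 0 \<times> ?J 0)" using fin by (intro eq_card_imp_inj_on) auto
  have "inj_on ?f (?J u \<times> ?J (u - n))"
    by (rule inj_on_subset[OF inj]) (auto intro: J_antimono)
  then have "card {x. J L' u x} = card (?J u) * card (?J (u - n))"
    unfolding eq by (simp add: card_image card_cartesian_product)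
  then show ?case using chain_Cons.IH[OF ge] by (simp add: power_add)
qed

end

section \<open>Subset sums in characteristic two\<close>

text \<open>In characteristic 2 this is the linear span over the field of two elements. Subsets of
  \<open>B\<close> serve as coefficient vectors, which makes counting by \<open>Pow B\<close>
  immediate.\<close>

definition subset_sums :: "('b \<Rightarrow> 'r::ab_group_add) \<Rightarrow> 'b set \<Rightarrow> 'r set"
  where "subset_sums f B = sum f ` Pow B"

lemma zero_in_subset_sums: "0 \<in> subset_sums f B"
  unfolding subset_sums_def by (rule image_eqI[of _ _ "{}"]) auto

lemma base_in_subset_sums: "b \<in> B \<Longrightarrow> f b \<in> subset_sums f B"
  unfolding subset_sums_def by (rule image_eqI[of _ _ "{b}"]) auto

text \<open>The two sums combine to the sum over the symmetric difference, since common terms occur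
  twice and cancel.\<close>

lemma subset_sums_add:
  fixes f :: "'b \<Rightarrow> 'r::ab_group_add"
  assumes "finite B" and char2: "\<And>r::'r. r + r = 0"
    and "x \<in> subset_sums f B" "y \<in> subset_sums f B"
  shows "x + y \<in> subset_sums f B"
proof -
  from assms obtain A C where A: "A \<subseteq> B" "x = sum f A" and C: "C \<subseteq> B" "y = sum f C"
    by (auto simp: subset_sums_def)
  have fin: "finite A" "finite C" using A C assms(1) finite_subset by auto
  have "x = sum f (A - C) + sum f (A \<inter> C)" "y = sum f (C - A) + sum f (A \<inter> C)"
    using A C fin by (metis sum.Int_Diff add.commute, metis sum.Int_Diff add.commute inf_commute)
  then have "x + y = sum f (A - C) + sum f (C - A) + (sum f (A \<inter> C) + sum f (A \<inter> C))"
    by (simp add: add_ac)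
  also have "\<dots> = sum f ((A - C) \<union> (C - A))"
    using fin by (subst sum.union_disjoint) (auto simp: char2)
  finally show ?thesis using A C unfolding subset_sums_def by blast
qed

lemma subset_sums_map:
  fixes h :: "'r::ab_group_add \<Rightarrow> 's::ab_group_add"
  assumes "finite B" "finite B'" and "\<And>r::'s. r + r = 0" and "x \<in> subset_sums f B"
    and "h 0 = 0" "\<And>x y. h (x + y) = h x + h y"
    and "\<And>b. b \<in> B \<Longrightarrow> h (f b) \<in> subset_sums f' B'"
  shows "h x \<in> subset_sums f' B'"
proof -
  from assms obtain A where A: "A \<subseteq> B" "x = sum f A" by (auto simp: subset_sums_def)
  have "finite A" using A assms finite_subset by auto
  then have "h (sum f A) \<in> subset_sums f' B'" using A(1)
    by (induction A rule: finite_induct)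
      (auto simp: assms(5,6) zero_in_subset_sums intro!: subset_sums_add assms)
  then show ?thesis using A by simp
qed

section \<open>Additive operators on functions with values in the field of two elements\<close>

text \<open>Additivity is linearity over the field of two elements. The index type \<open>'x\<close>
  is instantiated by sets of group elements, to be read as cosets, for the group algebra and by
  lists of letters for the algebra of words.\<close>

typedef 'x endo = "{f :: ('x \<Rightarrow> bit) \<Rightarrow> ('x \<Rightarrow> bit). \<forall>u v. f (u + v) = f u + f v}"
  morphisms app Endo
  by (rule exI[of _ id]) simp

lemma app_add: "app T (u + v) = app T u + app T v"
  using app[of T] by simp

lemma app_Endo: "(\<And>u v. f (u + v) = f u + f v) \<Longrightarrow> app (Endo f) = f"
  by (simp add: Endo_inverse)

lemma endo_eqI: "(\<And>u x. app S u x = app T u x) \<Longrightarrow> S = T"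
  by (metis app_inject ext)

lemma bit_add_self: "(b::bit) + b = 0"
  by (cases b) simp_all

lemma app_zero_right: "app T 0 = 0"
  using app_add[of T 0 0] by simp

lemma app_diff: "app T (u - v) = app T u - app T v"
  using app_add[of T "u - v" v] by (metis add_diff_cancel_right' diff_add_cancel)

instantiation endo :: (type) ring_1
begin

definition "0 = Endo (\<lambda>u. 0)"
definition "1 = Endo (\<lambda>u. u)"
definition "S + T = Endo (\<lambda>u. app S u + app T u)"
definition "S - T = Endo (\<lambda>u. app S u - app T u)"
definition "- T = Endo (\<lambda>u. - app T u)"
definition "S * T = Endo (\<lambda>u. app S (app T u))"

lemma app_0: "app 0 u = 0" and app_1: "app 1 u = u"
  and app_plus: "app (S + T) u = app S u + app T u"
  and app_minus: "app (S - T) u = app S u - app T u"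
  and app_uminus: "app (- T) u = - app T u"
  and app_times: "app (S * T) u = app S (app T u)"
  by (simp_all add: zero_endo_def one_endo_def plus_endo_def minus_endo_def uminus_endo_def
      times_endo_def app_Endo app_add algebra_simps)

instance
proof
  fix S T U :: "'a endo"
  show "(0::'a endo) \<noteq> 1"
  proof
    assume "(0::'a endo) = 1"
    then have "app (0::'a endo) (\<lambda>_. 1) undefined = app 1 (\<lambda>_. 1) undefined" by simp
    then show False by (simp add: app_0 app_1)
  qed
  show "S * T * U = S * (T * U)" by (rule endo_eqI) (simp add: app_times)
  show "S + T + U = S + (T + U)" by (rule endo_eqI) (simp add: app_plus add.assoc)
  show "S + T = T + S" by (rule endo_eqI) (simp add: app_plus add.commute)
  show "0 + S = S" by (rule endo_eqI) (simp add: app_plus app_0)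
  show "- S + S = 0" by (rule endo_eqI) (simp add: app_plus app_0 app_uminus)
  show "S - T = S + - T" by (rule endo_eqI) (simp add: app_plus app_minus app_uminus)
  show "1 * S = S" "S * 1 = S" by (rule endo_eqI; simp add: app_times app_1)+
  show "(S + T) * U = S * U + T * U" by (rule endo_eqI) (simp add: app_times app_plus)
  show "S * (T + U) = S * T + S * U" by (rule endo_eqI) (simp add: app_times app_plus app_add)
qed

end

lemma fun_bit_add_self: "(u::'x \<Rightarrow> bit) + u = 0"
  by (simp add: fun_eq_iff bit_add_self)

lemma endo_add_self: "(T::'x endo) + T = 0"
  by (rule endo_eqI) (simp add: app_plus app_0 fun_bit_add_self)

section \<open>The truncated algebra of reduced words\<close>

definition words :: "nat \<Rightarrow> nat \<Rightarrow> nat \<Rightarrow> nat list set"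
  where "words d k N = {v. distinct_adj v \<and> set v \<subseteq> {0..d} \<and> k \<le> length v \<and> length v < N}"

lemma finite_words: "finite (words d k N)"
  by (rule finite_subset[OF _ finite_lists_length_le[of "{0..d}" N]]) (auto simp: words_def)

text \<open>A nonempty reduced word can be extended at the front by every letter except its head,
  hence \<open>d\<close> choices each time, after \<open>d + 1\<close> for the first letter.\<close>

lemma card_words_length:
  "card {v. distinct_adj v \<and> set v \<subseteq> {0..d} \<and> length v = Suc n} = (d + 1) * d ^ n"
proof -
  let ?W = "\<lambda>n. {v. distinct_adj v \<and> set v \<subseteq> {0..d} \<and> length v = Suc n}"
  have fin: "finite (?W n)" for n
    by (rule finite_subset[OF _ finite_words[of d 0 "Suc (Suc n)"]]) (auto simp: words_def)
  show ?thesis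
  proof (induction n)
    case 0
    have "?W 0 = (\<lambda>i. [i]) ` {0..d}" by (auto simp: length_Suc_conv)
    then show ?case by (simp add: card_image inj_on_def)
  next
    case (Suc n)
    have "?W (Suc n) = (\<lambda>(v, i). i # v) ` (SIGMA v:?W n. {0..d} - {hd v})"
    proof (intro Set.set_eqI iffI)
      fix v assume v: "v \<in> ?W (Suc n)"
      then obtain i j u where "v = i # j # u" by (auto simp: length_Suc_conv)
      then show "v \<in> (\<lambda>(v, i). i # v) ` (SIGMA v:?W n. {0..d} - {hd v})"
        using v by (intro image_eqI[of _ _ "(j # u, i)"]) (auto simp: distinct_adj_Cons)
    next
      fix v assume "v \<in> (\<lambda>(v, i). i # v) ` (SIGMA v:?W n. {0..d} - {hd v})"
      then show "v \<in> ?W (Suc n)" by (auto simp: distinct_adj_Cons)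
    qed
    moreover have "inj_on (\<lambda>(v, i). i # v) (SIGMA v:?W n. {0..d} - {hd v})"
      by (auto simp: inj_on_def)
    ultimately have "card (?W (Suc n)) = (\<Sum>v\<in>?W n. card ({0..d} - {hd v}))"
      using fin by (simp add: card_image card_SigmaI)
    also have "\<dots> = (\<Sum>v\<in>?W n. d)"
    proof (rule sum.cong[OF refl])
      fix v assume "v \<in> ?W n"
      then have "hd v \<in> {0..d}" by (cases v) auto
      then show "card ({0..d} - {hd v}) = d" by simp
    qed
    finally show ?case using Suc by (simp add: algebra_simps)
  qed
qed

lemma card_words:
  "card (words d 0 N) = (\<Sum>i<N. if i = 0 then 1 else (d + 1) * d ^ (i - 1))"
proof (induction N)
  case 0
  then show ?case by (simp add: words_def)
next
  case (Suc N)
  let ?W = "{v. distinct_adj v \<and> set v \<subseteq> {0..d} \<and> length v = N}"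
  have "words d 0 (Suc N) = words d 0 N \<union> ?W" by (auto simp: words_def)
  moreover have "words d 0 N \<inter> ?W = {}" by (auto simp: words_def)
  moreover have "finite ?W"
    by (rule finite_subset[OF _ finite_words[of d 0 "Suc N"]]) (auto simp: words_def)
  ultimately have "card (words d 0 (Suc N)) = card (words d 0 N) + card ?W"
    using finite_words by (simp add: card_Un_disjoint)
  moreover have "card ?W = (if N = 0 then 1 else (d + 1) * d ^ (N - 1))"
  proof (cases N)
    case 0
    then have "?W = {[]}" by auto
    then show ?thesis using 0 by simp
  next
    case (Suc n)
    then show ?thesis using card_words_length[of d n] by simp
  qed
  ultimately show ?case using Suc by simp
qed

text \<open>Left multiplication by the variable \<open>X_i\<close>, written on coefficients: the
  indicator of \<open>v'\<close> goes to that of \<open>i # v'\<close>, or to 0 if this word is too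
  long or not reduced. Testing the result \<open>v\<close> builds in both the relation
  \<open>X_i^2 = 0\<close> and the truncation at \<open>N\<close>.\<close>

definition letter :: "nat \<Rightarrow> nat \<Rightarrow> nat list endo"
  where "letter N i = Endo (\<lambda>u v. case v of [] \<Rightarrow> 0
    | j # v' \<Rightarrow> if j = i \<and> distinct_adj v \<and> length v < N then u v' else 0)"

definition word_op :: "nat \<Rightarrow> nat list \<Rightarrow> nat list endo"
  where "word_op N v = prod_list (map (letter N) v)"

lemma app_letter: "app (letter N i) u v = (case v of [] \<Rightarrow> 0
    | j # v' \<Rightarrow> if j = i \<and> distinct_adj v \<and> length v < N then u v' else 0)"
  unfolding letter_def by (subst app_Endo) (auto split: list.splits)

text \<open>The empty word is an exception because it acts as the identity on all functions,
  including those supported on long or non-reduced words. For nonempty \<open>x\<close> one test of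
  \<open>v\<close> is enough, as suffixes of reduced words are reduced and shorter.\<close>

lemma app_word_op: "app (word_op N x) u v =
    (if prefix x v \<and> (x = [] \<or> distinct_adj v \<and> length v < N) then u (drop (length x) v) else 0)"
proof (induction x arbitrary: v)
  case Nil
  then show ?case by (simp add: word_op_def app_1)
next
  case (Cons i x)
  have "app (word_op N (i # x)) u v = app (letter N i) (app (word_op N x) u) v"
    by (simp add: word_op_def app_times)
  then show ?case using Cons
    by (cases v) (auto simp: app_letter dest: distinct_adj_ConsD)
qed

lemma word_op_append: "word_op N x * word_op N y = word_op N (x @ y)"
  by (simp add: word_op_def)

lemma word_op_eq_0: "x \<noteq> [] \<Longrightarrow> \<not> (distinct_adj x \<and> length x < N) \<Longrightarrow> word_op N x = 0"
  by (rule endo_eqI) (auto simp: app_word_op app_0 prefix_def distinct_adj_append_iff)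

text \<open>For \<open>N \<ge> 1\<close> this is the \<open>k\<close>-th power of the augmentation
  ideal of the truncated algebra.\<close>

definition aug :: "nat \<Rightarrow> nat \<Rightarrow> nat \<Rightarrow> nat list endo set"
  where "aug d N k = subset_sums (word_op N) (words d k N)"

lemma zero_in_aug: "0 \<in> aug d N k"
  unfolding aug_def by (rule zero_in_subset_sums)

lemma aug_add: "a \<in> aug d N k \<Longrightarrow> b \<in> aug d N k \<Longrightarrow> a + b \<in> aug d N k"
  unfolding aug_def by (rule subset_sums_add[OF finite_words endo_add_self])

lemma word_op_in_aug:
  "set x \<subseteq> {0..d} \<Longrightarrow> k \<le> length x \<Longrightarrow> x \<noteq> [] \<Longrightarrow> word_op N x \<in> aug d N k"
  using word_op_eq_0[of x N] unfolding aug_def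
  by (cases "distinct_adj x \<and> length x < N")
    (auto simp: words_def zero_in_subset_sums intro: base_in_subset_sums)

lemma aug_antimono: "k \<le> l \<Longrightarrow> aug d N l \<subseteq> aug d N k"
  unfolding aug_def subset_sums_def by (intro image_mono Pow_mono) (auto simp: words_def)

lemma aug_mult:
  assumes "a \<in> aug d N k" "b \<in> aug d N l" "k + l \<ge> 1"
  shows "a * b \<in> aug d N (k + l)"
proof -
  have 1: "word_op N x * b \<in> aug d N (k + l)" if x: "x \<in> words d k N" for x
    using assms(2) unfolding aug_def
  proof (rule subset_sums_map[OF finite_words finite_words endo_add_self, where h = "\<lambda>b. word_op N x * b"])
    fix y assume "y \<in> words d l N"
    then show "word_op N x * word_op N y \<in> subset_sums (word_op N) (words d (k + l) N)"
      unfolding word_op_append aug_def[symmetric] using x assms(3)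
      by (intro word_op_in_aug) (auto simp: words_def)
  qed (auto simp: algebra_simps)
  show ?thesis using assms(1) unfolding aug_def
    by (rule subset_sums_map[OF finite_words finite_words endo_add_self, where h = "\<lambda>a. a * b"])
      (use 1 in \<open>auto simp: algebra_simps aug_def\<close>)
qed

lemma aug_top: "aug d N N = {0}"
proof -
  have "words d N N = {}" by (auto simp: words_def)
  then show ?thesis by (simp add: aug_def subset_sums_def)
qed

text \<open>Words of length at least \<open>k\<close> move coefficients to words longer by at least
  \<open>k\<close>. In \<open>word_count\<close> this turns the weight of a group element into the
  vanishing of low coefficients.\<close>

lemma aug_raises_degree:
  assumes "a \<in> aug d N k" and u: "\<And>v. length v < l \<Longrightarrow> u v = 0" and "length v < k + l"
  shows "app a u v = 0"
proof -
  have sum: "app (\<Sum>x\<in>A. word_op N x) u v = (\<Sum>x\<in>A. app (word_op N x) u v)" if "finite A" for A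
    using that by (induction A rule: finite_induct) (auto simp: app_0 app_plus)
  from assms obtain A where A: "A \<subseteq> words d k N" "a = (\<Sum>x\<in>A. word_op N x)"
    by (auto simp: aug_def subset_sums_def)
  have "app (word_op N x) u v = 0" if "x \<in> A" for x
  proof -
    have "k \<le> length x" using that A by (auto simp: words_def)
    moreover have "u (drop (length x) v) = 0" if "prefix x v"
    proof (rule u)
      show "length (drop (length x) v) < l"
        using assms(3) \<open>k \<le> length x\<close> prefix_length_le[OF that] by auto
    qed
    ultimately show ?thesis by (simp add: app_word_op)
  qed
  moreover have "finite A" using A finite_words finite_subset by blast
  ultimately show ?thesis using sum A by simp
qed

definition delta :: "'x \<Rightarrow> 'x \<Rightarrow> bit"
  where "delta x y = (if x = y then 1 else 0)"

lemma app_word_op_delta: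
  assumes "x \<in> words d 0 N"
  shows "app (word_op N x) (delta []) = delta x"
  using assms by (auto simp: fun_eq_iff app_word_op delta_def words_def prefix_def)

text \<open>Applied to the indicator of the empty word, an operator returns its own
  coefficients.\<close>

lemma inj_on_sum_word_op: "inj_on (sum (word_op N)) (Pow (words d k N))"
proof (rule inj_onI)
  fix A B assume AB: "A \<in> Pow (words d k N)" "B \<in> Pow (words d k N)"
    and eq: "sum (word_op N) A = sum (word_op N) B"
  have val: "app (sum (word_op N) A) (delta []) v = (if v \<in> A then 1 else 0)"
    if "A \<subseteq> words d k N" for A v
  proof -
    have "finite A" using that finite_words finite_subset by blast
    then show ?thesis using that
    proof (induction A rule: finite_induct)
      case (insert x A)
      have "x \<in> words d 0 N" using insert.prems by (auto simp: words_def)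
      from app_word_op_delta[OF this] have "app (word_op N x) (delta []) v = (if x = v then 1 else 0)"
        by (simp add: delta_def)
      then show ?case using insert by (auto simp: app_plus)
    qed (simp add: app_0)
  qed
  have "(v \<in> A) = (v \<in> B)" for v using val[of A v] val[of B v] AB eq by (auto split: if_splits)
  then show "A = B" by blast
qed

definition unit_group :: "nat \<Rightarrow> nat \<Rightarrow> nat list endo monoid"
  where "unit_group d N = \<lparr>carrier = (\<lambda>a. 1 + a) ` aug d N 1, monoid.mult = (*), one = 1\<rparr>"

lemma aug_pow: "a \<in> aug d N 1 \<Longrightarrow> k \<ge> 1 \<Longrightarrow> a ^ k \<in> aug d N k"
proof (induction k)
  case (Suc k)
  then show ?case
    by (cases "k = 0") (use aug_mult[of a d N 1 "a ^ k" k] in auto)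
qed simp

text \<open>Elements of \<open>aug d N 1\<close> are nilpotent, so geometric series are finite. In
  characteristic 2 the element \<open>1 + a\<close> equals \<open>1 - a\<close>, whose inverse such
  a series is.\<close>

lemma group_unit_group:
  assumes "N \<ge> 1"
  shows "group (unit_group d N)"
proof (rule groupI)
  let ?G = "unit_group d N"
  have car: "carrier ?G = (\<lambda>a. 1 + a) ` aug d N 1" and mul: "x \<otimes>\<^bsub>?G\<^esub> y = x * y" and one: "\<one>\<^bsub>?G\<^esub> = 1"
    for x y by (simp_all add: unit_group_def)
  show "x \<otimes>\<^bsub>?G\<^esub> y \<in> carrier ?G" if "x \<in> carrier ?G" "y \<in> carrier ?G" for x y
  proof -
    from that obtain a b where a: "a \<in> aug d N 1" "x = 1 + a" and b: "b \<in> aug d N 1" "y = 1 + b"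
      unfolding car by blast
    have "a * b \<in> aug d N 1" using aug_mult[OF a(1) b(1)] aug_antimono[of 1 "1 + 1" d N] by auto
    then have "a + b + a * b \<in> aug d N 1" using a b by (intro aug_add)
    moreover have "x * y = 1 + (a + b + a * b)" using a b by (simp add: algebra_simps)
    ultimately show ?thesis unfolding car mul by blast
  qed
  show "\<one>\<^bsub>?G\<^esub> \<in> carrier ?G"
    using image_eqI[of 1 "\<lambda>a. 1 + a" 0, OF _ zero_in_aug] by (simp add: car one)
  show "x \<otimes>\<^bsub>?G\<^esub> y \<otimes>\<^bsub>?G\<^esub> z = x \<otimes>\<^bsub>?G\<^esub> (y \<otimes>\<^bsub>?G\<^esub> z)" for x y z by (simp add: mul mult.assoc)
  show "\<one>\<^bsub>?G\<^esub> \<otimes>\<^bsub>?G\<^esub> x = x" for x by (simp add: mul one)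
  show "\<exists>y\<in>carrier ?G. y \<otimes>\<^bsub>?G\<^esub> x = \<one>\<^bsub>?G\<^esub>" if "x \<in> carrier ?G" for x
  proof -
    from that obtain a where a: "a \<in> aug d N 1" "x = 1 + a" unfolding car by blast
    have "- a = a" using endo_add_self[of a] by (rule minus_unique)
    then have x: "x = 1 - a" using a(2) by (metis diff_conv_add_uminus)
    define b where "b = (\<Sum>k\<in>{1..<N}. a ^ k)"
    have b: "b \<in> aug d N 1"
    proof -
      have "(\<Sum>k\<in>A. a ^ k) \<in> aug d N 1" if "finite A" "\<And>k. k \<in> A \<Longrightarrow> 1 \<le> k" for A
        using that
      proof (induction A rule: finite_induct)
        case empty
        then show ?case using zero_in_aug by simp
      next
        case (insert k A)
        have "a ^ k \<in> aug d N 1" using aug_pow[OF a(1), of k] aug_antimono[of 1 k] insert by auto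
        then show ?case using insert by (auto intro: aug_add)
      qed
      from this[of "{1..<N}"] show ?thesis unfolding b_def by simp
    qed
    have "(\<Sum>k<n. a ^ k) * (1 - a) = 1 - a ^ n" for n
    proof (induction n)
      case (Suc n)
      have "(\<Sum>k<Suc n. a ^ k) * (1 - a) = (\<Sum>k<n. a ^ k) * (1 - a) + a ^ n * (1 - a)"
        by (simp add: distrib_right)
      also have "\<dots> = 1 - a ^ Suc n"
        unfolding Suc by (simp add: algebra_simps power_commutes)
      finally show ?case .
    qed simp
    moreover have "a ^ N = 0" using aug_pow[OF a(1) assms] aug_top by auto
    moreover have "1 + b = (\<Sum>k<N. a ^ k)"
    proof -
      have "{..<N} = insert 0 {1..<N}" using assms by auto
      then show ?thesis by (simp add: b_def)
    qed
    ultimately have "(1 + b) * x = 1" using x by simp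
    moreover have "1 + b \<in> carrier ?G" unfolding car using b by (rule imageI)
    ultimately show ?thesis by (intro bexI[of _ "1 + b"]) (simp_all only: mul one)
  qed
qed

lemma order_unit_group: "order (unit_group d N) = 2 ^ card (words d 1 N)"
proof -
  have "card (aug d N 1) = 2 ^ card (words d 1 N)"
    unfolding aug_def subset_sums_def
    by (simp add: card_image[OF inj_on_sum_word_op] card_Pow finite_words)
  moreover have "inj_on (\<lambda>a. 1 + a) (aug d N 1)" by (auto simp: inj_on_def)
  ultimately show ?thesis by (simp add: order_def unit_group_def card_image)
qed

section \<open>Reduced words and the regular representation\<close>

context char2_rep
begin

text \<open>The whole algebra is the direct sum of the span of the words shorter than
  \<open>M\<close> and of \<open>J (carrier G) M\<close>. Spanning uses
  \<open>(R (x i) - 1)^2 = 0\<close> and the fact that the \<open>x i\<close> generate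
  \<open>G\<close> modulo \<open>Z N\<close>. Independence is left to the additive map
  \<open>\<Theta>\<close>, which reads off the coefficients of short words and does not see
  \<open>J (carrier G) M\<close> there.\<close>

lemma card_J_words:
  fixes \<Theta> :: "'r \<Rightarrow> nat list \<Rightarrow> bit" and x :: "nat \<Rightarrow> 'a"
  defines "xw \<equiv> \<lambda>v. prod_list (map (\<lambda>i. R (x i) - 1) v)"
  assumes x: "\<And>i. i \<le> d \<Longrightarrow> x i \<in> carrier G" "\<And>i. i \<le> d \<Longrightarrow> x i \<otimes> x i = \<one>"
    and gen: "\<And>M. subgroup M G \<Longrightarrow> Z N \<subseteq> M \<Longrightarrow> (\<And>i. i \<le> d \<Longrightarrow> x i \<in> M) \<Longrightarrow> M = carrier G"
    and RN: "\<And>z. z \<in> Z N \<Longrightarrow> R z = 1"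
    and fin: "finite {T. J (carrier G) 0 T}"
    and \<Theta>_add: "\<And>S T. \<Theta> (S + T) = \<Theta> S + \<Theta> T"
    and \<Theta>_word: "\<And>v. v \<in> words d 0 M \<Longrightarrow> \<Theta> (xw v) = delta v"
    and \<Theta>_J: "\<And>T v. J (carrier G) M T \<Longrightarrow> length v < M \<Longrightarrow> \<Theta> T v = 0"
  shows "card {T. J (carrier G) 0 T} = 2 ^ card (words d 0 M) * card {T. J (carrier G) M T}"
proof -
  let ?G = "carrier G" and ?W = "words d 0 M"
  define y where "y i = R (x i) - 1" for i
  have xw: "xw [] = 1" "xw (i # v) = y i * xw v" for i v by (simp_all add: xw_def y_def)
  have Rx: "R (x i) * R (x i) = 1" if "i \<le> d" for i
    using R_mult[OF x(1)[OF that] x(1)[OF that]] x(2)[OF that] R_one by simp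
  have yy: "y i * y i = 0" if "i \<le> d" for i
  proof -
    have "y i * y i = R (x i) * R (x i) + 1 - (R (x i) + R (x i))"
      by (simp add: y_def algebra_simps)
    then show ?thesis by (simp add: Rx[OF that] char2)
  qed
  have xw0: "xw v = 0" if "\<not> distinct_adj v" "set v \<subseteq> {0..d}" for v
    using that
  proof (induction v rule: induct_list012)
    case (3 i j v)
    show ?case
    proof (cases "i = j")
      case True
      then have "xw (i # j # v) = (y i * y i) * xw v" by (simp add: xw mult.assoc)
      then show ?thesis using yy[of i] 3 by simp
    next
      case False
      then have "xw (j # v) = 0" using 3 by auto
      then show ?thesis by (simp add: xw(2)[of i])
    qed
  qed auto
  have y_J: "J ?G (Suc w) (y i * T)" if "J ?G w T" "i \<le> d" for w T i
    unfolding y_def by (rule J_mult[OF that(1), where k = 1]) (use x Z_one that in auto)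
  have xwJ: "J ?G (length v) (xw v)" if "set v \<subseteq> {0..d}" for v
    using that
  proof (induction v)
    case (Cons i v)
    then show ?case using y_J[of "length v" "xw v" i] by (simp add: xw(2))
  qed (simp add: xw J_one)
  \<comment> \<open>\<open>T + s\<close> stands for \<open>T - s\<close>, so \<open>S T\<close> says
    that \<open>T\<close> lies in the sum of the two subspaces.\<close>
  define S where "S T \<longleftrightarrow> (\<exists>s\<in>subset_sums xw ?W. J ?G M (T + s))" for T
  have S_add: "S (T + T')" if "S T" "S T'" for T T'
  proof -
    from that obtain s s' where s: "s \<in> subset_sums xw ?W" "J ?G M (T + s)"
      "s' \<in> subset_sums xw ?W" "J ?G M (T' + s')" unfolding S_def by blast
    have "s + s' \<in> subset_sums xw ?W"
      using subset_sums_add[OF finite_words char2 s(1,3)] .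
    moreover have "J ?G M ((T + T') + (s + s'))"
      using J_add[OF s(2,4)] by (simp add: add_ac)
    ultimately show ?thesis unfolding S_def by blast
  qed
  have S_J: "S T" if "J ?G M T" for T
    unfolding S_def using that by (intro bexI[of _ 0]) (auto simp: zero_in_subset_sums)
  have S_word: "S (xw v)" if v: "set v \<subseteq> {0..d}" for v
  proof (cases "v \<in> ?W")
    case True
    then show ?thesis unfolding S_def
      by (intro bexI[of _ "xw v"] base_in_subset_sums) (auto simp: char2 J_zero)
  next
    case False
    then consider "\<not> distinct_adj v" | "length v \<ge> M" using v by (auto simp: words_def)
    then show ?thesis
    proof cases
      case 1
      then show ?thesis using xw0 v S_J[OF J_zero] by simp
    next
      case 2
      then show ?thesis using J_antimono[OF xwJ[OF v]] S_J by blast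
    qed
  qed
  have S_y: "S (y i * T)" if T: "S T" and i: "i \<le> d" for T i
  proof -
    from T obtain A where A: "A \<subseteq> ?W" "J ?G M (T + sum xw A)"
      unfolding S_def subset_sums_def by blast
    have "finite A" using A finite_words finite_subset by blast
    then have "S (y i * sum xw A)" using A(1)
    proof (induction A rule: finite_induct)
      case empty
      then show ?case using S_J[OF J_zero] by simp
    next
      case (insert v A)
      have "S (xw (i # v))" using insert.prems i by (intro S_word) (auto simp: words_def)
      then show ?case using insert S_add by (simp add: distrib_left xw(2))
    qed
    moreover have "S (y i * (T + sum xw A))"
      using J_antimono[OF y_J[OF A(2) i]] by (intro S_J) simp
    moreover have "y i * T = y i * (T + sum xw A) + y i * sum xw A"
      by (simp add: distrib_left add.assoc char2)
    ultimately show ?thesis using S_add by metis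
  qed
  have S_x: "S (R (x i) * T)" if "S T" "i \<le> d" for T i
    using S_add[OF S_y[OF that] that(1)] by (simp add: y_def algebra_simps)
  \<comment> \<open>The equivalence, in place of an implication, makes \<open>H\<close> closed under
    inverses. Stability of \<open>S\<close> under all of \<open>G\<close> then follows from
    \<open>gen\<close> without writing group elements as products of generators.\<close>
  define H where "H = {g \<in> ?G. \<forall>T. S T \<longleftrightarrow> S (R g * T)}"
  have "H = ?G"
  proof (rule gen)
    show "subgroup H G"
    proof (rule subgroupI)
      show "H \<subseteq> ?G" by (auto simp: H_def)
      show "H \<noteq> {}" using R_one by (auto simp: H_def intro!: exI[of _ \<one>])
      show "inv g \<in> H" if "g \<in> H" for g
      proof -
        have g: "g \<in> ?G" using that by (simp add: H_def)
        have "S T \<longleftrightarrow> S (R (inv g) * T)" for T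
        proof -
          have "R g * (R (inv g) * T) = T"
            using R_mult[OF g inv_closed[OF g]] g R_one by (simp add: mult.assoc[symmetric])
          moreover have "S (R (inv g) * T) \<longleftrightarrow> S (R g * (R (inv g) * T))"
            using that unfolding H_def by blast
          ultimately show ?thesis by simp
        qed
        then show ?thesis using g by (simp add: H_def)
      qed
      show "g \<otimes> h \<in> H" if "g \<in> H" "h \<in> H" for g h
        using that by (auto simp: H_def R_mult mult.assoc)
    qed
    show "Z N \<subseteq> H" using RN Z_carrier by (auto simp: H_def)
    show "x i \<in> H" if "i \<le> d" for i
    proof -
      have "S T \<longleftrightarrow> S (R (x i) * T)" for T
      proof
        show "S (R (x i) * T)" if "S T" using S_x[OF that \<open>i \<le> d\<close>] .
        assume "S (R (x i) * T)"
        from S_x[OF this \<open>i \<le> d\<close>] show "S T"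
          by (simp add: mult.assoc[symmetric] Rx[OF \<open>i \<le> d\<close>])
      qed
      then show ?thesis using x(1)[OF that] by (simp add: H_def)
    qed
  qed
  then have S_R: "S (R g * T)" if "g \<in> ?G" "S T" for g T using that by (auto simp: H_def)
  have S: "S T" if "J ?G w T" for w T
    using that
  proof (induction rule: J.induct)
    case (J_zero w)
    then show ?case by (rule S_J[OF J.J_zero])
  next
    case J_one
    then show ?case using S_word[of "[]"] by (simp add: xw)
  next
    case (J_mult v T z k w)
    then show ?case using S_add[OF S_R[of z T] J_mult.IH]
      by (simp add: minus_eq_plus distrib_right)
  qed (auto intro: S_add)
  let ?f = "\<lambda>(A, T). sum xw A + T"
  have \<Theta>0: "\<Theta> 0 = 0" using \<Theta>_add[of 0 0] by simp
  have \<Theta>_sum: "\<Theta> (sum xw A) v = (if v \<in> A then 1 else 0)" if "A \<subseteq> ?W" for A v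
  proof -
    have "finite A" using that finite_words finite_subset by blast
    then show ?thesis using that
      by (induction A rule: finite_induct) (auto simp: \<Theta>0 \<Theta>_add \<Theta>_word delta_def)
  qed
  have val: "\<Theta> (sum xw A + T) v = (if v \<in> A then 1 else 0)"
    if "A \<subseteq> ?W" "J ?G M T" "v \<in> ?W" for A T v
    using \<Theta>_sum[OF that(1)] \<Theta>_J[OF that(2), of v] that(3) by (auto simp: \<Theta>_add words_def)
  have "inj_on ?f (Pow ?W \<times> {T. J ?G M T})"
  proof (rule inj_onI, clarify)
    fix A T A' T'
    assume h: "A \<subseteq> ?W" "A' \<subseteq> ?W" "J ?G M T" "J ?G M T'" and e: "sum xw A + T = sum xw A' + T'"
    have "v \<in> A \<longleftrightarrow> v \<in> A'" if "v \<in> ?W" for v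
      using val[OF h(1,3) that] val[OF h(2,4) that] e by (auto split: if_splits)
    then have "A = A'" using h by blast
    then show "A = A' \<and> T = T'" using e by simp
  qed
  moreover have "?f ` (Pow ?W \<times> {T. J ?G M T}) = {T. J ?G 0 T}"
  proof (intro equalityI subsetI)
    fix T assume "T \<in> ?f ` (Pow ?W \<times> {T. J ?G M T})"
    then obtain A T' where A: "A \<subseteq> ?W" "J ?G M T'" "T = sum xw A + T'" by auto
    have "J ?G 0 (sum xw A)"
    proof (rule J_sum)
      show "finite A" using A finite_words finite_subset by blast
      show "J ?G 0 (xw v)" if "v \<in> A" for v
        using that A by (intro J_antimono[OF xwJ]) (auto simp: words_def)
    qed
    then show "T \<in> {T. J ?G 0 T}" using A J_antimono[OF A(2), of 0] by (auto intro: J_add)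
  next
    fix T assume "T \<in> {T. J ?G 0 T}"
    then obtain A where A: "A \<subseteq> ?W" "J ?G M (T + sum xw A)"
      using S unfolding S_def subset_sums_def by blast
    have "T = sum xw A + (T + sum xw A)" using char2 by (metis add.assoc add.commute add_0_right)
    then show "T \<in> ?f ` (Pow ?W \<times> {T. J ?G M T})" using A by (intro image_eqI[of _ _ "(A, T + sum xw A)"]) auto
  qed
  ultimately have "card {T. J ?G 0 T} = card (Pow ?W \<times> {T. J ?G M T})"
    by (metis card_image)
  then show ?thesis by (simp add: card_cartesian_product card_Pow finite_words)
qed

end

section \<open>The regular representation modulo \<open>Z N\<close> and the count of words\<close>

context filtered_group
begin

text \<open>Translation of functions on the cosets of \<open>Z N\<close>. Away from cosets it is the
  identity, because the unit of the ring \<open>endo\<close> acts on all functions and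
  \<open>\<one>\<close> has to be sent to it.\<close>

definition regular :: "nat \<Rightarrow> 'a \<Rightarrow> 'a set endo"
  where "regular N g = Endo (\<lambda>f C. if C \<in> rcosets (Z N) then f (C #> g) else f C)"

lemma app_regular: "app (regular N g) f C = (if C \<in> rcosets (Z N) then f (C #> g) else f C)"
  unfolding regular_def by (subst app_Endo) (auto simp: fun_eq_iff)

lemma rcoset_mult:
  "C \<in> rcosets (Z N) \<Longrightarrow> g \<in> carrier G \<Longrightarrow> C #> g \<in> rcosets (Z N)"
  using coset_mult_assoc[OF subgroup.subset[OF Z_subgroup]] by (auto simp: RCOSETS_def)

lemma rcoset_subset: "C \<in> rcosets (Z N) \<Longrightarrow> C \<subseteq> carrier G"
  using rcosets_part_G[OF Z_subgroup] by blast

lemma regular_char2_rep: "char2_rep G Z (regular N)"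
proof
  show "r + r = 0" for r :: "'a set endo" by (rule endo_add_self)
  show "regular N (x \<otimes> y) = regular N x * regular N y" if "x \<in> carrier G" "y \<in> carrier G" for x y
    by (rule endo_eqI)
      (auto simp: app_times app_regular rcoset_mult that coset_mult_assoc[OF rcoset_subset])
  show "regular N \<one> = 1"
    by (rule endo_eqI) (auto simp: app_1 app_regular coset_mult_one[OF rcoset_subset])
qed

text \<open>Translation is on the right and so are the cosets, so normality is what makes this work:
  \<open>g \<otimes> z\<close> is a conjugate of \<open>z\<close> times \<open>g\<close>.\<close>

lemma regular_trivial:
  assumes "z \<in> Z N" "N \<ge> 1"
  shows "regular N z = 1"
proof (rule endo_eqI)
  fix f :: "'a set \<Rightarrow> bit" and C
  have "C #> z = C" if C: "C \<in> rcosets (Z N)"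
  proof -
    from C obtain g where g: "g \<in> carrier G" "C = Z N #> g" by (auto simp: RCOSETS_def)
    have z: "z \<in> carrier G" using assms Z_carrier by auto
    have Zc: "Z N \<subseteq> carrier G" using subgroup.subset[OF Z_subgroup] .
    have "g \<otimes> z \<otimes> inv g \<in> Z N" using Z_conj[OF assms(2,1), of "inv g"] g by simp
    moreover have "g \<otimes> z = (g \<otimes> z \<otimes> inv g) \<otimes> g" using g z by (simp add: m_assoc)
    moreover have "C #> z = Z N #> (g \<otimes> z)" using g z coset_mult_assoc[OF Zc] by simp
    moreover have "Z N #> ((g \<otimes> z \<otimes> inv g) \<otimes> g) = (Z N #> (g \<otimes> z \<otimes> inv g)) #> g"
      using g z by (intro coset_mult_assoc[OF Zc, symmetric]) auto
    ultimately show ?thesis using g z coset_join2[OF _ Z_subgroup, of "g \<otimes> z \<otimes> inv g"] by simp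
  qed
  then show "app (regular N z) f C = app 1 f C" by (simp add: app_regular app_1)
qed

text \<open>An equation between exponents of 2. By \<open>J_card\<close> the sets
  \<open>J (carrier G) 0\<close> and \<open>J (carrier G) M\<close> have sizes
  \<open>2 ^ 2 ^ length ns\<close> and \<open>2 ^ num_ge ns M\<close>, and by
  \<open>card_J_words\<close> their quotient is \<open>2 ^ card (words d 0 M)\<close>. The map
  \<open>\<rho>\<close> into the algebra of words supplies the \<open>\<Theta>\<close> required
  there.\<close>

lemma word_count:
  assumes N: "N \<ge> 1" and M: "M \<le> N" and ch: "chain N (carrier G) ns"
    and x: "\<And>i. i \<le> d \<Longrightarrow> x i \<in> carrier G" "\<And>i. i \<le> d \<Longrightarrow> x i \<otimes> x i = \<one>"
    and gen: "\<And>M. subgroup M G \<Longrightarrow> Z N \<subseteq> M \<Longrightarrow> (\<And>i. i \<le> d \<Longrightarrow> x i \<in> M) \<Longrightarrow> M = carrier G"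
    and \<rho>_mult: "\<And>g h. g \<in> carrier G \<Longrightarrow> h \<in> carrier G \<Longrightarrow> \<rho> (g \<otimes> h) = \<rho> g * \<rho> h"
    and \<rho>_x: "\<And>i. i \<le> d \<Longrightarrow> \<rho> (x i) = 1 + letter N i"
    and \<rho>_aug: "\<And>k z. k \<ge> 1 \<Longrightarrow> k \<le> N \<Longrightarrow> z \<in> Z k \<Longrightarrow> \<rho> z - 1 \<in> aug d N k"
  shows "card (words d 0 M) + num_ge ns M = 2 ^ length ns"
proof -
  let ?G = "carrier G"
  interpret char2_rep G Z "regular N" by (rule regular_char2_rep)
  have RN: "regular N z = 1" if "z \<in> Z N" for z using regular_trivial[OF that N] .
  have \<rho>N: "\<rho> z = 1" if "z \<in> Z N" for z
    using \<rho>_aug[OF N order_refl that] by (simp add: aug_top)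
  have \<rho>1: "\<rho> \<one> = 1" using \<rho>N subgroup.one_closed[OF Z_subgroup] by auto
  have card_chain: "finite (cosets_in (Z N) ?G)" "card (cosets_in (Z N) ?G) = 2 ^ length ns"
    using chain_card[OF ch N] by auto
  have ZNr: "Z N \<in> rcosets (Z N)"
    using coset_mult_one[OF subgroup.subset[OF Z_subgroup]] by (force simp: RCOSETS_def)
  have fin: "finite {T. J ?G w T}" for w using J_card_le[OF ch RN] by auto
  have "2 ^ 2 ^ length ns \<le> card {T. J ?G 0 T}"
  proof -
    let ?C = "cosets_in (Z N) ?G"
    \<comment> \<open>Applying an operator to the indicator of \<open>C\<close> and evaluating at
      the trivial coset recovers the coefficient of \<open>C\<close>. Different sets of cosets thus
      give different sums, which is faithfulness of the regular representation of the group
      algebra.\<close>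
    define ev where "ev T = {C \<in> ?C. app T (delta C) (Z N) = 1}" for T :: "'a set endo"
    have "Pow ?C \<subseteq> ev ` {T. J ?G 0 T}"
    proof
      fix A assume "A \<in> Pow ?C"
      then have "A \<subseteq> ?C" by simp
      then obtain B where B: "B \<subseteq> ?G" "inj_on (\<lambda>g. Z N #> g) B" "A = cosets_in (Z N) B"
        unfolding subset_image_inj by blast
      have "finite A" using \<open>A \<subseteq> ?C\<close> card_chain(1) by (rule finite_subset)
      then have fB: "finite B" unfolding B(3) using B(2) by (rule finite_imageD)
      define T where "T = sum (regular N) B"
      have "J ?G 0 T" unfolding T_def using B by (intro J_sum fB J_R) auto
      moreover have "app T (delta C) (Z N) = (if C \<in> A then 1 else 0)" for C
        unfolding T_def B(3) using fB B(1,2)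
      proof (induction B rule: finite_induct)
        case (insert g B)
        have "app (regular N g) (delta C) (Z N) = (if C = Z N #> g then 1 else 0)"
          using ZNr by (simp add: app_regular delta_def)
        then show ?case using insert by (auto simp: app_plus inj_on_def)
      qed (simp add: app_0)
      then have "ev T = A" using \<open>A \<subseteq> ?C\<close> unfolding ev_def by (simp add: Collect_conj_eq inf.absorb2)
      ultimately show "A \<in> ev ` {T. J ?G 0 T}" by blast
    qed
    then have "card (Pow ?C) \<le> card (ev ` {T. J ?G 0 T})" by (intro card_mono finite_imageI fin)
    also have "\<dots> \<le> card {T. J ?G 0 T}" by (rule card_image_le[OF fin])
    finally show ?thesis using card_chain by (simp add: card_Pow)
  qed
  then have cJ: "card {T. J ?G w T} = 2 ^ num_ge ns w" for w
    using J_card[OF ch RN] by blast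
  \<comment> \<open>The choice of a representative is harmless, because \<open>\<rho>\<close> is
    trivial on \<open>Z N\<close>.\<close>
  define f where "f v C = app (\<rho> (SOME g. g \<in> C)) (delta []) v" for v C
  have f: "f v (Z N #> g) = app (\<rho> g) (delta []) v" if g: "g \<in> ?G" for v g
  proof -
    have "g \<in> Z N #> g" using rcos_self[OF g Z_subgroup] .
    then have "(SOME h. h \<in> Z N #> g) \<in> Z N #> g" by (rule someI)
    then obtain z where z: "z \<in> Z N" "(SOME h. h \<in> Z N #> g) = z \<otimes> g" by (auto simp: r_coset_def)
    then have "\<rho> (SOME h. h \<in> Z N #> g) = \<rho> g" using \<rho>_mult g Z_carrier \<rho>N by simp
    then show ?thesis by (simp add: f_def)
  qed
  \<comment> \<open>The linear extension of \<open>g \<mapsto> app (\<rho> g) (delta [])\<close> to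
    the group algebra: \<open>regular N g\<close> applied to \<open>f v\<close> takes at the trivial
    coset the value of \<open>f v\<close> at the coset of \<open>g\<close>.\<close>
  define \<Theta> where "\<Theta> T v = app T (f v) (Z N)" for T v
  have \<Theta>_add: "\<Theta> (S + T) = \<Theta> S + \<Theta> T" for S T by (auto simp: \<Theta>_def app_plus fun_eq_iff)
  have \<Theta>_minus: "\<Theta> (S - T) = \<Theta> S - \<Theta> T" for S T by (auto simp: \<Theta>_def app_minus fun_eq_iff)
  \<comment> \<open>\<open>\<Theta>\<close> is compatible with \<open>\<rho>\<close> on operators
    from the group algebra, not on arbitrary ones; hence the induction along \<open>J\<close>. It is
    general in \<open>h\<close> because the rule \<open>J_mult\<close> turns \<open>h\<close> into
    \<open>h \<otimes> z\<close>.\<close>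
  have \<Theta>_R: "\<Theta> (regular N h * T) = app (\<rho> h) (\<Theta> T)" if "J ?G w T" "h \<in> ?G" for h w T
    using that
  proof (induction arbitrary: h rule: J.induct)
    case (J_zero w)
    have "\<Theta> 0 = 0" by (auto simp: \<Theta>_def app_0 fun_eq_iff)
    then show ?case by (simp only: mult_zero_right app_zero_right)
  next
    case J_one
    have *: "\<Theta> (regular N g) = app (\<rho> g) (delta [])" if "g \<in> ?G" for g
    proof
      show "\<Theta> (regular N g) v = app (\<rho> g) (delta []) v" for v
        unfolding \<Theta>_def app_regular f[OF that] using ZNr by simp
    qed
    have "\<Theta> 1 = delta []" using *[OF one_closed] unfolding R_one \<rho>1 app_1 .
    then show ?case using *[OF J_one] by (simp only: mult_1_right)
  next
    case (J_add w S T)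
    then show ?case by (simp only: distrib_left \<Theta>_add app_add)
  next
    case (J_mult v T z k w)
    have z: "z \<in> ?G" using J_mult by auto
    have "regular N h * ((regular N z - 1) * T) = regular N (h \<otimes> z) * T - regular N h * T"
      using R_mult[OF J_mult.prems z] by (simp add: algebra_simps)
    then have "\<Theta> (regular N h * ((regular N z - 1) * T))
        = app (\<rho> h) (app (\<rho> z) (\<Theta> T) - \<Theta> T)"
      using J_mult.IH[OF J_mult.prems] J_mult.IH[OF m_closed[OF J_mult.prems z]]
        \<rho>_mult[OF J_mult.prems z]
      by (simp only: \<Theta>_minus app_times app_diff)
    moreover have "\<Theta> ((regular N z - 1) * T) = app (\<rho> z) (\<Theta> T) - \<Theta> T"
      using J_mult.IH[OF z] by (simp only: left_diff_distrib \<Theta>_minus mult_1_left)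
    ultimately show ?case by (simp only:)
  qed
  have \<Theta>_R1: "\<Theta> ((regular N z - 1) * T) = app (\<rho> z - 1) (\<Theta> T)" if "J ?G w T" "z \<in> ?G" for w T z
    using \<Theta>_R[OF that] by (simp only: left_diff_distrib \<Theta>_minus app_minus app_1 mult_1_left)
  have \<Theta>_J: "\<Theta> T v = 0" if "J ?G w T" "length v < w" "length v < N" for T v w
    using that
  proof (induction arbitrary: v rule: J.induct)
    case (J_zero w)
    show ?case by (simp add: \<Theta>_def app_0)
  next
    case (J_add w S T)
    then have "\<Theta> S v = 0" "\<Theta> T v = 0" by blast+
    then show ?case by (simp only: \<Theta>_add plus_fun_apply add_0_left)
  next
    case J_one
    then show ?case by simp
  next
    case (J_mult u T z k w)
    have z: "z \<in> ?G" using J_mult by auto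
    \<comment> \<open>The hypothesis on \<open>\<rho>\<close> is restricted to weights up to
      \<open>N\<close>. Capping the weight loses nothing, as the word \<open>v\<close> is shorter
      than \<open>N\<close>.\<close>
    define k' where "k' = min k N"
    have z': "z \<in> Z k'" "k' \<ge> 1" "k' \<le> N" using J_mult N Z_antimono[of k' k] by (auto simp: k'_def)
    have aug: "\<rho> z - 1 \<in> aug d N k'" using \<rho>_aug z' by auto
    \<comment> \<open>The induction hypothesis speaks of words shorter than \<open>N\<close> only.
      The other part \<open>u2\<close> begins in degree \<open>N\<close>, and operators in
      \<open>aug\<close> push it further up, beyond \<open>v\<close>.\<close>
    define u1 where "u1 v = (if length v < N then \<Theta> T v else 0)" for v
    define u2 where "u2 v = (if length v < N then 0 else \<Theta> T v)" for v
    have u: "\<Theta> T = u1 + u2" by (rule ext) (simp add: u1_def u2_def)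
    have "app (\<rho> z - 1) u1 v = 0"
    proof (rule aug_raises_degree[OF aug, where l = "min u N"])
      show "u1 v = 0" if "length v < min u N" for v using J_mult.IH[of v] that by (simp add: u1_def)
      show "length v < k' + min u N" using J_mult.hyps J_mult.prems by (simp add: k'_def)
    qed
    moreover have "app (\<rho> z - 1) u2 v = 0"
    proof (rule aug_raises_degree[OF aug, where l = N])
      show "u2 v = 0" if "length v < N" for v using that by (simp add: u2_def)
      show "length v < k' + N" using J_mult.prems by simp
    qed
    moreover have "\<Theta> ((regular N z - 1) * T) v = app (\<rho> z - 1) u1 v + app (\<rho> z - 1) u2 v"
      by (simp only: \<Theta>_R1[OF J_mult.hyps(1) z] u app_add plus_fun_apply)
    ultimately show ?case by simp
  qed
  have \<Theta>_word: "\<Theta> (prod_list (map (\<lambda>i. regular N (x i) - 1) v)) = delta v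
      \<and> J ?G 0 (prod_list (map (\<lambda>i. regular N (x i) - 1) v))"
    if "v \<in> words d 0 M" for v
    using that
  proof (induction v)
    case Nil
    have "\<Theta> 1 = delta []"
      using \<Theta>_R[OF J_one one_closed] f[OF one_closed] coset_mult_one[OF subgroup.subset[OF Z_subgroup]]
      by (auto simp: \<Theta>_def app_1 fun_eq_iff \<rho>1)
    then show ?case using J_one by simp
  next
    case (Cons i v)
    have v: "v \<in> words d 0 M" and i: "i \<le> d" using Cons.prems by (auto simp: words_def dest: distinct_adj_ConsD)
    let ?p = "prod_list (map (\<lambda>i. regular N (x i) - 1) v)"
    have IH: "\<Theta> ?p = delta v" "J ?G 0 ?p" using Cons.IH[OF v] by auto
    have "\<Theta> ((regular N (x i) - 1) * ?p) = app (letter N i) (delta v)"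
      using \<Theta>_R1[OF IH(2) x(1)[OF i]] IH(1) \<rho>_x[OF i] by simp
    also have "\<dots> = delta (i # v)"
      using Cons.prems M by (auto simp: fun_eq_iff app_letter delta_def words_def split: list.splits)
    finally have "\<Theta> ((regular N (x i) - 1) * ?p) = delta (i # v)" .
    moreover have "J ?G 0 ((regular N (x i) - 1) * ?p)"
      by (rule J_mult[OF IH(2) x(1)[OF i], of 1]) (use x i Z_one in auto)
    ultimately show ?case by simp
  qed
  have "card {T. J ?G 0 T} = 2 ^ card (words d 0 M) * card {T. J ?G M T}"
    by (rule card_J_words[where \<Theta> = \<Theta> and x = x and N = N])
      (use x gen RN fin \<Theta>_add \<Theta>_word \<Theta>_J M in auto)
  then have "(2::nat) ^ 2 ^ length ns = 2 ^ (card (words d 0 M) + num_ge ns M)"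
    by (simp add: cJ num_ge_0 power_add)
  then show ?thesis by simp
qed

end

section \<open>Moebius inversion\<close>

lemma moebius_mu_prime_mult:
  assumes "prime p" "\<not> p dvd e"
  shows "moebius_mu (p * e) = - moebius_mu e"
proof (cases "squarefree e")
  case True
  have cop: "coprime p e" using assms by (simp add: prime_imp_coprime)
  have e0: "e \<noteq> 0" using True by (metis not_squarefree_0)
  have "squarefree (p * e)"
    using squarefree_mult_coprime[OF cop squarefree_prime[OF assms(1)] True] .
  moreover have "prime_factors (p * e) = insert p (prime_factors e)"
    using assms(1) e0 by (simp add: prime_factors_product prime_factorization_prime prime_gt_0_nat)
  moreover have "p \<notin> prime_factors e" using assms by auto
  ultimately show ?thesis using True by (simp add: moebius_mu_def)
next
  case False
  then have "\<not> squarefree (p * e)" using squarefree_multD by blast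
  then show ?thesis using False by (simp add: moebius_mu_def)
qed

text \<open>For a prime \<open>p\<close> dividing \<open>k\<close>, the divisors \<open>e\<close>
  not divisible by \<open>p\<close> cancel against their multiples \<open>p * e\<close>; divisors
  that are multiples of \<open>p^2\<close> contribute 0.\<close>

lemma sum_moebius_mu:
  assumes "k > 0"
  shows "(\<Sum>e | e dvd k. moebius_mu e) = (if k = 1 then 1 else 0)"
proof (cases "k = 1")
  case True
  then show ?thesis by (simp add: moebius_mu_def)
next
  case False
  then obtain p where p: "prime p" "p dvd k" using prime_factor_nat by blast
  let ?D = "{e. e dvd k}"
  let ?A = "{e \<in> ?D. \<not> p dvd e}" and ?B = "{e \<in> ?D. p dvd e \<and> \<not> p dvd e div p}"
    and ?C = "{e \<in> ?D. p dvd e \<and> p dvd e div p}"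
  have fin: "finite ?D" using assms by simp
  have p0: "p > 0" using p by (simp add: prime_gt_0_nat)
  have C: "moebius_mu e = 0" if "e \<in> ?C" for e
  proof -
    from that obtain f where "e = p * (p * f)" using p0 by (auto simp: dvd_def)
    then have "p ^ 2 dvd e" by (simp add: power2_eq_square)
    moreover have "\<not> p dvd 1" using p(1) by (metis not_prime_unit)
    ultimately have "\<not> squarefree e" by (rule not_squarefreeI)
    then show ?thesis by (simp add: moebius_mu_def)
  qed
  have "?D = ?A \<union> (?B \<union> ?C)" by auto
  then have "sum moebius_mu ?D = sum moebius_mu (?A \<union> (?B \<union> ?C))" by metis
  also have "\<dots> = sum moebius_mu ?A + (sum moebius_mu ?B + sum moebius_mu ?C)"
    using fin by (subst sum.union_disjoint; (subst sum.union_disjoint)?) auto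
  also have "sum moebius_mu ?C = 0" using C by (rule sum.neutral[OF ballI])
  also have "sum moebius_mu ?B = (\<Sum>e\<in>?A. - moebius_mu e)"
  proof (rule sum.reindex_bij_witness[of _ "\<lambda>e. p * e" "\<lambda>e. e div p"])
    fix e assume e: "e \<in> ?B"
    then obtain f where f: "e = p * f" by auto
    then show "p * (e div p) = e" "e div p \<in> ?A" "- moebius_mu (e div p) = moebius_mu e"
      using e p0 moebius_mu_prime_mult[OF p(1), of f] by (auto intro: dvd_trans)
  next
    fix e assume e: "e \<in> ?A"
    then have "coprime p e" using p by (simp add: prime_imp_coprime)
    then have "p * e dvd k" using e p by (simp add: divides_mult)
    then show "p * e div p = e" "p * e \<in> ?B" using e p0 by auto
  qed
  finally show ?thesis using False by (simp add: sum_negf)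
qed

lemma moebius_inversion:
  fixes a b :: "nat \<Rightarrow> real"
  assumes ab: "\<And>n. n \<ge> 1 \<Longrightarrow> a n = (\<Sum>l | l dvd n. b l)" and n: "n \<ge> 1"
  shows "(\<Sum>m | m dvd n. of_int (moebius_mu (n div m)) * a m) = b n"
proof -
  let ?D = "{m. m dvd n}"
  have fin: "finite ?D" using n by simp
  have "(\<Sum>m\<in>?D. of_int (moebius_mu (n div m)) * a m)
      = (\<Sum>m\<in>?D. \<Sum>l\<in>{l \<in> ?D. l dvd m}. of_int (moebius_mu (n div m)) * b l)"
  proof (rule sum.cong[OF refl])
    fix m assume m: "m \<in> ?D"
    then have "m \<ge> 1" using n by (auto intro: Suc_leI dvd_pos_nat)
    moreover have "{l \<in> ?D. l dvd m} = {l. l dvd m}" using m by (auto intro: dvd_trans)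
    ultimately show "of_int (moebius_mu (n div m)) * a m
        = (\<Sum>l\<in>{l \<in> ?D. l dvd m}. of_int (moebius_mu (n div m)) * b l)"
      by (simp add: ab sum_distrib_left)
  qed
  also have "\<dots> = (\<Sum>l\<in>?D. \<Sum>m\<in>{m \<in> ?D. l dvd m}. of_int (moebius_mu (n div m)) * b l)"
    by (rule sum.swap_restrict[OF fin fin])
  also have "\<dots> = (\<Sum>l\<in>?D. if l = n then b l else 0)"
  proof (rule sum.cong[OF refl])
    fix l assume l: "l \<in> ?D"
    then have l0: "l > 0" using n by (auto intro: dvd_pos_nat)
    have nl: "n div l > 0" using l n l0 by (auto elim!: dvdE)
    have "(\<Sum>m\<in>{m \<in> ?D. l dvd m}. moebius_mu (n div m)) = (\<Sum>e | e dvd n div l. moebius_mu e)"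
    proof (rule sum.reindex_bij_witness[of _ "\<lambda>e. n div e" "\<lambda>m. n div m"])
      fix m assume m: "m \<in> {m \<in> ?D. l dvd m}"
      then obtain f g where fg: "m = l * f" "n = m * g" unfolding dvd_def by blast
      then have "f > 0" "g > 0" using n by auto
      then show "n div (n div m) = m" "n div m \<in> {e. e dvd n div l}" using fg l0 by auto
    next
      fix e assume "e \<in> {e. e dvd n div l}"
      then obtain f where f: "n div l = e * f" by auto
      then have nf: "n = l * (e * f)" using l by (metis dvd_mult_div_cancel mem_Collect_eq)
      then have "f > 0" "e > 0" using n by auto
      then show "n div (n div e) = e" "n div e \<in> {m \<in> ?D. l dvd m}" using nf l0 by auto
    qed simp
    also have "\<dots> = (if l = n then 1 else 0)"
      unfolding sum_moebius_mu[OF nl] using l l0 n by (auto elim!: dvdE)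
    finally have "(\<Sum>m\<in>{m \<in> ?D. l dvd m}. of_int (moebius_mu (n div m))) = (if l = n then 1 else 0 :: real)"
      by (metis (mono_tags, lifting) of_int_0 of_int_1 of_int_sum sum.cong)
    then show "(\<Sum>m\<in>{m \<in> ?D. l dvd m}. of_int (moebius_mu (n div m)) * b l) = (if l = n then b l else 0)"
      by (simp flip: sum_distrib_right)
  qed
  also have "\<dots> = b n" using fin by simp
  finally show ?thesis .
qed

text \<open>Passing from \<open>c\<close> to the differences \<open>v\<close> removes the signs: a
  term with even \<open>M div n\<close> changes sign when twice its value is subtracted. The sums of
  \<open>n * v n\<close> are then plain divisor sums, inversion gives \<open>v = w d\<close>, and
  adding up the differences along powers of 2 returns \<open>c\<close>.\<close>

lemma w_sum_of_signed_divisor_sums: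
  fixes c :: "nat \<Rightarrow> nat"
  assumes c: "\<And>M. M \<ge> 1 \<Longrightarrow>
      (\<Sum>n | n dvd M. real (n * c n) * (-1) ^ (M div n - 1)) = real d ^ M - (-1) ^ M"
    and m: "odd m"
  shows "real (c (2 ^ k * m)) = (\<Sum>j=0..k. w d (2 ^ j * m))"
proof -
  define v where "v n = real (c n) - (if even n then real (c (n div 2)) else 0)" for n
  have v: "real d ^ M - (-1) ^ M = (\<Sum>n | n dvd M. real n * v n)" if M: "M \<ge> 1" for M
  proof -
    let ?D = "{n. n dvd M}"
    have fin: "finite ?D" using M by simp
    have "(\<Sum>n\<in>?D. real n * v n)
        = (\<Sum>n\<in>?D. real (n * c n)) - (\<Sum>n\<in>?D. if even n then real n * real (c (n div 2)) else 0)"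
      unfolding sum_subtractf[symmetric] by (rule sum.cong[OF refl]) (simp add: v_def algebra_simps)
    also have "(\<Sum>n\<in>?D. if even n then real n * real (c (n div 2)) else 0)
        = (\<Sum>n\<in>{n \<in> ?D. even n}. real n * real (c (n div 2)))"
      by (rule sum.inter_filter[OF fin, symmetric])
    \<comment> \<open>Even divisors are written as \<open>2 * n\<close>; such a number divides
      \<open>M\<close> exactly if \<open>n\<close> does with even quotient.\<close>
    also have "\<dots> = (\<Sum>n\<in>{n \<in> ?D. even (M div n)}. 2 * real (n * c n))"
    proof (rule sum.reindex_bij_witness[of _ "\<lambda>n. 2 * n" "\<lambda>n. n div 2"])
      fix n assume "n \<in> {n \<in> ?D. even n}"
      then obtain i j where ij: "M = 2 * i * j" "n = 2 * i" by (auto elim!: dvdE)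
      then have "i > 0" using M by auto
      then show "2 * (n div 2) = n" "n div 2 \<in> {n \<in> ?D. even (M div n)}"
        "2 * real (n div 2 * c (n div 2)) = real n * real (c (n div 2))"
        using ij by (auto simp: mult_ac)
    next
      fix n assume "n \<in> {n \<in> ?D. even (M div n)}"
      then have n: "n dvd M" "even (M div n)" by auto
      then obtain i where i: "M div n = 2 * i" by blast
      then have "M = n * (2 * i)" using n(1) by (metis dvd_mult_div_cancel)
      then show "2 * n div 2 = n" "2 * n \<in> {n \<in> ?D. even n}" by auto
    qed
    also have "\<dots> = (\<Sum>n\<in>?D. if even (M div n) then 2 * real (n * c n) else 0)"
      by (rule sum.inter_filter[OF fin])
    also have "(\<Sum>n\<in>?D. real (n * c n)) - \<dots> = (\<Sum>n\<in>?D. real (n * c n) * (-1) ^ (M div n - 1))"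
      unfolding sum_subtractf[symmetric]
    proof (rule sum.cong[OF refl])
      fix n assume "n \<in> ?D"
      then have "M div n > 0" using M by (auto elim!: dvdE)
      then show "real (n * c n) - (if even (M div n) then 2 * real (n * c n) else 0)
          = real (n * c n) * (-1) ^ (M div n - 1)"
        by (cases "even (M div n)") (auto simp: algebra_simps)
    qed
    also have "\<dots> = real d ^ M - (-1) ^ M" by (rule c[OF M])
    finally show ?thesis by simp
  qed
  have wv: "w d n = v n" if "n \<ge> 1" for n
    using moebius_inversion[of "\<lambda>M. real d ^ M - (-1) ^ M" "\<lambda>n. real n * v n", OF v that] that
    by (simp add: w_def)
  have m1: "m \<ge> 1" using m by (cases m) auto
  show ?thesis
  proof (induction k)
    case 0
    then show ?case using wv[OF m1] m by (simp add: v_def)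
  next
    case (Suc k)
    have "w d (2 ^ Suc k * m) = real (c (2 ^ Suc k * m)) - real (c (2 ^ k * m))"
      using wv[of "2 ^ Suc k * m"] m1 by (simp add: v_def mult.assoc)
    then show ?case using Suc by simp
  qed
qed

section \<open>Subset sums of a list of weights\<close>

text \<open>The coefficient at \<open>i\<close> counts the sublists of \<open>ns\<close> with sum
  \<open>i\<close>. In the application it is the dimension of the \<open>i\<close>-th graded piece
  of the group algebra.\<close>

definition weight_fps :: "nat list \<Rightarrow> real fps"
  where "weight_fps ns = (\<Prod>n\<leftarrow>ns. 1 + fps_X ^ n)"

lemma sum_weight_fps:
  "(\<Sum>i<M. fps_nth (weight_fps ns) i) + real (num_ge ns M) = 2 ^ length ns"
proof (induction ns arbitrary: M)
  case Nil
  show ?case by (cases M) (auto simp: weight_fps_def sum.lessThan_Suc_shift simp del: sum.lessThan_Suc)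
next
  case (Cons n ns)
  have "(\<Sum>i<M. fps_nth (fps_X ^ n * weight_fps ns) i) = (\<Sum>i\<in>{n..<M}. fps_nth (weight_fps ns) (i - n))"
  proof (rule sum.mono_neutral_cong_right)
    show "\<forall>i\<in>{..<M} - {n..<M}. fps_nth (fps_X ^ n * weight_fps ns) i = 0"
      by (auto simp: fps_X_power_mult_nth)
  qed (auto simp: fps_X_power_mult_nth)
  also have "\<dots> = (\<Sum>i<M - n. fps_nth (weight_fps ns) i)"
    by (rule sum.reindex_bij_witness[of _ "\<lambda>i. i + n" "\<lambda>i. i - n"]) auto
  finally have "(\<Sum>i<M. fps_nth (weight_fps (n # ns)) i)
      = (\<Sum>i<M. fps_nth (weight_fps ns) i) + (\<Sum>i<M - n. fps_nth (weight_fps ns) i)"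
    by (simp add: weight_fps_def distrib_right sum.distrib)
  then show ?case using Cons[of M] Cons[of "M - n"] by simp
qed

text \<open>The expansion of \<open>X^n / (1 + X^n)\<close>. Multiplied by \<open>n\<close> it is
  \<open>X\<close> times the logarithmic derivative of \<open>1 + X^n\<close>.\<close>

definition log_fps :: "nat \<Rightarrow> real fps"
  where "log_fps n = Abs_fps (\<lambda>M. if M > 0 \<and> n dvd M then (-1) ^ (M div n - 1) else 0)"

lemma log_fps:
  assumes "n \<ge> 1"
  shows "log_fps n * (1 + fps_X ^ n) = fps_X ^ n"
proof (rule fps_ext)
  fix M
  have "fps_nth (log_fps n * (1 + fps_X ^ n)) M
      = fps_nth (log_fps n) M + (if M < n then 0 else fps_nth (log_fps n) (M - n))"
    by (simp add: distrib_left fps_X_power_mult_right_nth)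
  also have "\<dots> = (if M = n then 1 else 0)"
  proof (cases "n dvd M")
    case True
    then obtain q where q: "M = n * q" by auto
    show ?thesis
    proof (cases "q \<le> 1")
      case True
      then have "q = 0 \<or> q = 1" by auto
      then show ?thesis using q assms by (auto simp: log_fps_def)
    next
      case False
      then obtain r where r: "q = Suc (Suc r)" by (cases q; cases "q - 1") auto
      have "M div n = Suc (Suc r)" "(M - n) div n = Suc r" "n < M" "n dvd M - n"
        using q r assms by (auto simp: diff_mult_distrib2[symmetric] algebra_simps)
      then show ?thesis using q by (simp add: log_fps_def)
    qed
  next
    case False
    then show ?thesis using assms by (auto simp: log_fps_def dvd_minus_self)
  qed
  also have "\<dots> = fps_nth (fps_X ^ n) M" by simp
  finally show "fps_nth (log_fps n * (1 + fps_X ^ n)) M = fps_nth (fps_X ^ n) M" .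
qed

lemma fps_deriv_weight:
  assumes "\<And>n. n \<in> set ns \<Longrightarrow> n \<ge> 1"
  shows "fps_X * fps_deriv (weight_fps ns) = weight_fps ns * (\<Sum>n\<leftarrow>ns. of_nat n * log_fps n)"
  using assms
proof (induction ns)
  case Nil
  then show ?case by (simp add: weight_fps_def)
next
  case (Cons n ns)
  have n: "n \<ge> 1" using Cons by auto
  have "fps_X * fps_deriv (1 + fps_X ^ n) = of_nat n * (fps_X ^ n :: real fps)"
  proof -
    have "fps_X * fps_deriv (fps_X ^ n :: real fps) = of_nat n * (fps_X * fps_X ^ (n - 1))"
      by (simp add: fps_deriv_power fps_of_nat mult_ac)
    also have "fps_X * fps_X ^ (n - 1) = (fps_X ^ n :: real fps)" using n by (simp flip: power_Suc)
    finally show ?thesis by simp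
  qed
  then have X: "fps_X * fps_deriv (1 + fps_X ^ n) = (1 + fps_X ^ n) * (of_nat n * log_fps n)"
    using log_fps[OF n] by (simp add: mult_ac)
  have "fps_X * fps_deriv (weight_fps (n # ns))
      = (fps_X * fps_deriv (1 + fps_X ^ n)) * weight_fps ns
        + (1 + fps_X ^ n) * (fps_X * fps_deriv (weight_fps ns))"
    by (simp add: weight_fps_def algebra_simps)
  also have "fps_X * fps_deriv (weight_fps ns) = weight_fps ns * (\<Sum>n\<leftarrow>ns. of_nat n * log_fps n)"
    using Cons by auto
  finally show ?case unfolding X by (simp add: weight_fps_def algebra_simps)
qed

lemma sum_list_log_fps:
  assumes ns: "set ns \<subseteq> {1..<N}" and M: "1 \<le> M" "M < N"
  shows "fps_nth (\<Sum>n\<leftarrow>ns. of_nat n * log_fps n) M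
    = (\<Sum>n | n dvd M. real (n * count_list ns n) * (-1) ^ (M div n - 1))"
proof -
  let ?t = "\<lambda>n. real n * (if n dvd M then (-1) ^ (M div n - 1) else 0)"
  have "fps_nth (\<Sum>n\<leftarrow>ns. of_nat n * log_fps n) M = (\<Sum>n\<leftarrow>ns. ?t n)"
    using M by (induction ns) (auto simp: log_fps_def simp flip: fps_of_nat)
  also have "\<dots> = (\<Sum>n\<in>{1..<N}. real (count_list ns n) * ?t n)"
    using ns
  proof (induction ns)
    case (Cons m ns)
    have "(\<Sum>n\<in>{1..<N}. real (count_list (m # ns) n) * ?t n)
        = (\<Sum>n\<in>{1..<N}. real (count_list ns n) * ?t n + (if n = m then ?t n else 0))"
      by (rule sum.cong) (auto simp: algebra_simps)
    also have "\<dots> = (\<Sum>n\<in>{1..<N}. real (count_list ns n) * ?t n) + ?t m"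
      using Cons.prems by (simp add: sum.distrib)
    finally show ?case using Cons by simp
  qed simp
  also have "\<dots> = (\<Sum>n | n dvd M. real (n * count_list ns n) * (-1) ^ (M div n - 1))"
  proof (rule sum.mono_neutral_cong_right)
    show "{n. n dvd M} \<subseteq> {1..<N}" 
    proof
      fix n assume "n \<in> {n. n dvd M}"
      then have "n dvd M" by simp
      then show "n \<in> {1..<N}" using dvd_imp_le[of n M] dvd_pos_nat[of M n] M by auto
    qed
  qed auto
  finally show ?thesis .
qed

section \<open>The logarithmic derivative of (1 + X) / (1 - d X)\<close>

text \<open>A finite level \<open>N\<close> determines the product of the \<open>1 + X^n\<close>
  only below degree \<open>N\<close>. Logarithmic derivatives are therefore compared coefficient by
  coefficient, not as series.\<close>

lemma signed_divisor_sums: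
  assumes ns: "set ns \<subseteq> {1..<N}"
    and cnt: "\<And>M. M \<le> N \<Longrightarrow>
      (\<Sum>i<M. if i = 0 then 1 else (d + 1) * d ^ (i - 1)) + num_ge ns M = 2 ^ length ns"
    and M: "1 \<le> M" "M < N"
  shows "(\<Sum>n | n dvd M. real (n * count_list ns n) * (-1) ^ (M div n - 1)) = real d ^ M - (-1) ^ M"
proof -
  \<comment> \<open>\<open>A\<close> expands \<open>(1 + X) / (1 - d X)\<close>, and
    \<open>B\<close> expands \<open>X / (1 + X) + d X / (1 - d X)\<close>, which is \<open>X\<close>
    times its logarithmic derivative.\<close>
  define A :: "real fps" where "A = Abs_fps (\<lambda>i. if i = 0 then 1 else (real d + 1) * real d ^ (i - 1))"
  define B :: "real fps" where "B = Abs_fps (\<lambda>i. real d ^ i - (-1) ^ i)"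
  define L where "L = (\<Sum>n\<leftarrow>ns. of_nat n * log_fps n)"
  define D :: "real fps" where "D = 1 - fps_const (real d) * fps_X"
  have PA: "fps_nth (weight_fps ns) i = fps_nth A i" if "i < N" for i
  proof -
    \<comment> \<open>The hypothesis gives partial sums of coefficients; those up to
      \<open>i\<close> and up to \<open>Suc i\<close> differ by the coefficient at
      \<open>i\<close>.\<close>
    have "real (\<Sum>i<M. if i = 0 then 1 else (d + 1) * d ^ (i - 1)) = (\<Sum>i<M. fps_nth (weight_fps ns) i)"
      if "M \<le> N" for M
      using sum_weight_fps[of ns M] cnt[OF that] of_nat_add of_nat_numeral of_nat_power
      by (metis add_right_cancel)
    from this[of "Suc i"] this[of i] that show ?thesis by (auto simp: A_def algebra_simps split: if_splits)
  qed
  have AD: "A * D = 1 + fps_X"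
  proof (rule fps_ext)
    fix i
    have "fps_nth (A * D) i = fps_nth A i - real d * (if i = 0 then 0 else fps_nth A (i - 1))"
      by (simp add: D_def right_diff_distrib mult.left_commute[of A] fps_X_mult_right_nth)
    then show "fps_nth (A * D) i = fps_nth (1 + fps_X) i"
      by (cases i; cases "i - 1") (auto simp: A_def algebra_simps fps_X_def)
  qed
  have BD: "B * (D * (1 + fps_X)) = fps_const (real d + 1) * fps_X"
  proof -
    define g :: "real \<Rightarrow> real fps" where "g c = Abs_fps (\<lambda>i. c ^ i)" for c
    have g: "g c * (1 - fps_const c * fps_X) = 1" for c
    proof (rule fps_ext)
      fix i
      have "fps_nth (g c * (1 - fps_const c * fps_X)) i
          = fps_nth (g c) i - c * (if i = 0 then 0 else fps_nth (g c) (i - 1))"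
        by (simp add: right_diff_distrib mult.left_commute[of "g c"] fps_X_mult_right_nth)
      then show "fps_nth (g c * (1 - fps_const c * fps_X)) i = fps_nth 1 i"
        by (cases i) (auto simp: g_def)
    qed
    have "B = g (real d) - g (-1)" by (rule fps_ext) (simp add: B_def g_def)
    then have "B * (D * (1 + fps_X)) = (g (real d) * D) * (1 + fps_X) - (g (-1) * (1 + fps_X)) * D"
      by (simp only: left_diff_distrib right_diff_distrib mult_ac)
    also have "g (real d) * D = 1" unfolding D_def by (rule g)
    also have "g (-1) * (1 + fps_X) = 1" using g[of "-1"] by (simp flip: fps_const_neg)
    finally show ?thesis by (simp add: D_def algebra_simps flip: fps_const_add)
  qed
  have XA: "fps_X * fps_deriv A = A * B"
  proof -
    have "fps_deriv (A * D) = 1" unfolding AD by simp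
    then have dA: "fps_deriv A * D = 1 + fps_const (real d) * A"
      by (simp add: D_def algebra_simps)
    have "(fps_X * fps_deriv A) * (D * (1 + fps_X)) = fps_X * (1 + fps_X) * (fps_deriv A * D)"
      by (simp add: mult_ac)
    also have "\<dots> = fps_X * ((1 + fps_X) + fps_const (real d) * A * (1 + fps_X))"
      unfolding dA by (simp add: algebra_simps)
    also have "\<dots> = fps_X * (A * D + fps_const (real d) * A * (1 + fps_X))" unfolding AD ..
    also have "\<dots> = A * (fps_const (real d + 1) * fps_X)"
      by (simp add: D_def algebra_simps flip: fps_const_add)
    also have "\<dots> = (A * B) * (D * (1 + fps_X))" unfolding BD[symmetric] by (simp add: mult_ac)
    finally have "(fps_X * fps_deriv A) * (D * (1 + fps_X)) = (A * B) * (D * (1 + fps_X))" .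
    moreover have "D * (1 + fps_X) \<noteq> 0"
    proof
      assume "D * (1 + fps_X) = 0"
      from arg_cong[OF this, of "\<lambda>F. fps_nth F 0"] show False by (simp add: D_def)
    qed
    ultimately show ?thesis by simp
  qed
  \<comment> \<open>The products \<open>weight_fps ns * L\<close> and \<open>A * B\<close> agree
    below degree \<open>N\<close>. Their first factors agree there too and have constant coefficient
    1, so the second factors are determined degree by degree.\<close>
  have LB: "fps_nth L i = fps_nth B i" if "i < N" for i
    using that
  proof (induction i rule: less_induct)
    case (less i)
    have nth: "fps_nth (F * H) i = fps_nth F 0 * fps_nth H i + (\<Sum>j\<in>{1..i}. fps_nth F j * fps_nth H (i - j))"
      for F H :: "real fps"
      by (simp add: fps_mult_nth sum.atLeast_Suc_atMost)
    have "fps_nth (fps_X * fps_deriv (weight_fps ns)) i = fps_nth (fps_X * fps_deriv A) i"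
      using PA[OF less.prems] by (cases i) auto
    then have "fps_nth (weight_fps ns * L) i = fps_nth (A * B) i"
      unfolding XA[symmetric] L_def using fps_deriv_weight[of ns] ns by fastforce
    moreover have "(\<Sum>j\<in>{1..i}. fps_nth (weight_fps ns) j * fps_nth L (i - j))
        = (\<Sum>j\<in>{1..i}. fps_nth A j * fps_nth B (i - j))"
      using less PA by (intro sum.cong) auto
    ultimately have "fps_nth (weight_fps ns) 0 * fps_nth L i = fps_nth A 0 * fps_nth B i"
      unfolding nth by simp
    moreover have "fps_nth (weight_fps ns) 0 = 1" "fps_nth A 0 = 1"
      using PA[of 0] less.prems by (auto simp: A_def)
    ultimately show ?case by simp
  qed
  show ?thesis using sum_list_log_fps[OF ns M] LB[OF M(2)] by (simp add: L_def B_def)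
qed

section \<open>Dimension and cardinality of the quotients\<close>

lemma F2_space_simps:
  "carrier (F2_space V) = carrier V" "\<zero>\<^bsub>F2_space V\<^esub> = \<one>\<^bsub>V\<^esub>"
  "x \<oplus>\<^bsub>F2_space V\<^esub> y = x \<otimes>\<^bsub>V\<^esub> y" "k \<odot>\<^bsub>F2_space V\<^esub> v = v [^]\<^bsub>V\<^esub> k"
  by (simp_all add: F2_space_def)

text \<open>Coordinates with respect to a basis identify the carrier with functions from the basis
  to a field of two elements. Finiteness of the group ensures a finite basis.\<close>

lemma card_F2_space:
  assumes V: "comm_group V" and sq: "\<And>x. x \<in> carrier V \<Longrightarrow> x \<otimes>\<^bsub>V\<^esub> x = \<one>\<^bsub>V\<^esub>" and finV: "finite (carrier V)"
  shows "card (carrier V) = 2 ^ vectorspace.dim (residue_ring 2) (F2_space V)"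
proof -
  interpret V: comm_group V by (rule V)
  interpret K: residues_prime 2 "residue_ring (int 2)" by unfold_locales simp
  let ?K = "residue_ring 2" and ?M = "F2_space V"
  have K: "field ?K" using K.field_axioms by (simp only: of_nat_numeral)
  have carK: "carrier ?K = {0, 1}" by (auto simp: residue_ring_def)
  have pow: "v [^]\<^bsub>V\<^esub> (0::int) = \<one>\<^bsub>V\<^esub>" "v \<in> carrier V \<Longrightarrow> v [^]\<^bsub>V\<^esub> (1::int) = v" for v
    by (simp_all add: V.int_pow_1)
  have mod: "module ?K ?M"
  proof (rule moduleI)
    show "cring ?K" using K by (simp add: field_def domain_def)
    show "abelian_group ?M"
      by (rule abelian_groupI) (auto simp: F2_space_simps V.m_assoc intro: V.m_comm V.l_inv_ex)
    fix a b x y assume a: "a \<in> carrier ?K" and b: "b \<in> carrier ?K"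
      and x: "x \<in> carrier ?M" and y: "y \<in> carrier ?M"
    show "a \<odot>\<^bsub>?M\<^esub> x \<in> carrier ?M" using x by (simp add: F2_space_simps)
    show "(a \<oplus>\<^bsub>?K\<^esub> b) \<odot>\<^bsub>?M\<^esub> x = a \<odot>\<^bsub>?M\<^esub> x \<oplus>\<^bsub>?M\<^esub> b \<odot>\<^bsub>?M\<^esub> x"
      using a b x sq unfolding carK by (auto simp: F2_space_simps residue_ring_def pow)
    show "a \<odot>\<^bsub>?M\<^esub> (x \<oplus>\<^bsub>?M\<^esub> y) = a \<odot>\<^bsub>?M\<^esub> x \<oplus>\<^bsub>?M\<^esub> a \<odot>\<^bsub>?M\<^esub> y"
      using a x y unfolding carK by (auto simp: F2_space_simps pow)
    show "(a \<otimes>\<^bsub>?K\<^esub> b) \<odot>\<^bsub>?M\<^esub> x = a \<odot>\<^bsub>?M\<^esub> (b \<odot>\<^bsub>?M\<^esub> x)"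
      using a b x unfolding carK by (auto simp: F2_space_simps residue_ring_def pow)
  next
    fix x assume x: "x \<in> carrier ?M"
    show "\<one>\<^bsub>?K\<^esub> \<odot>\<^bsub>?M\<^esub> x = x" using x by (simp add: F2_space_simps residue_ring_def pow)
  qed
  interpret vectorspace ?K ?M by (rule vectorspace.intro[OF mod K])
  have "gen_set (carrier ?M)" using in_own_span[of "carrier ?M"] span_is_subset2[of "carrier ?M"] by auto
  moreover have "finite (carrier ?M)" using finV by (simp add: F2_space_simps)
  ultimately have "fin_dim" unfolding fin_dim_def by blast
  then obtain B where B: "finite B" "basis B" using finite_basis_exists by blast
  have BM: "B \<subseteq> carrier ?M" using B by (simp add: basis_def)
  let ?F = "B \<rightarrow>\<^sub>E carrier ?K"
  have ex1: "\<exists>!a. a \<in> ?F \<and> lincomb a B = v" if "v \<in> carrier ?M" for v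
    using basis_criterion[OF B(1) BM] B(2) that by blast
  have cl: "lincomb a B \<in> carrier ?M" if "a \<in> ?F" for a
    using that BM by (intro lincomb_closed) auto
  have "bij_betw (\<lambda>a. lincomb a B) ?F (carrier ?M)"
    unfolding bij_betw_def
  proof
    show "inj_on (\<lambda>a. lincomb a B) ?F"
      using ex1[OF cl] by (intro inj_onI) metis
    show "(\<lambda>a. lincomb a B) ` ?F = carrier ?M" using ex1 cl by (auto simp: image_iff) metis
  qed
  then have "card (carrier ?M) = card ?F" by (simp add: bij_betw_same_card)
  also have "\<dots> = 2 ^ card B" using B(1) by (simp add: card_PiE carK numeral_2_eq_2)
  also have "card B = dim" using dim_basis[OF B] by simp
  finally show ?thesis by (simp add: F2_space_simps)
qed

context filtered_group
begin

text \<open>The layer is abelian of exponent dividing 2, since commutators and squares from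
  \<open>Z n\<close> have weight \<open>2 * n\<close>.\<close>

lemma Z_quotient_dim:
  assumes n: "n \<ge> 1" and fin: "finite (cosets_in (Z (Suc n)) (Z n))"
  shows "card (cosets_in (Z (Suc n)) (Z n))
    = 2 ^ vectorspace.dim (residue_ring 2) (F2_space (G\<lparr>carrier := Z n\<rparr> Mod Z (Suc n)))"
proof -
  let ?H = "G\<lparr>carrier := Z n\<rparr>" and ?K = "Z (Suc n)"
  have H: "group ?H" using subgroup.subgroup_is_group[OF Z_subgroup group_axioms] .
  have KH: "?K \<lhd> ?H"
    by (rule normal_restrict_supergroup[OF Z_subgroup Z_normal Z_Suc_subset]) simp
  interpret N: normal ?K ?H by (rule KH)
  have car: "carrier (?H Mod ?K) = cosets_in ?K (Z n)"
    by (auto simp: FactGroup_def RCOSETS_def r_coset_def)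
  have mult: "(?K #> a) \<otimes>\<^bsub>?H Mod ?K\<^esub> (?K #> b) = ?K #> (a \<otimes> b)" if "a \<in> Z n" "b \<in> Z n" for a b
    using N.rcos_sum[of a b] that by (simp add: FactGroup_def set_mult_def r_coset_def)
  have one: "\<one>\<^bsub>?H Mod ?K\<^esub> = ?K" by (simp add: FactGroup_def)
  have Kc: "?K \<subseteq> carrier G" using subgroup.subset[OF Z_subgroup] .
  have eq: "?K #> a = ?K #> b" if "a \<in> carrier G" "b \<in> carrier G" "inv b \<otimes> a \<in> ?K" for a b
  proof -
    have "b \<otimes> (inv b \<otimes> a) \<otimes> inv b \<in> ?K" using Z_conj[of "Suc n" "inv b \<otimes> a" "inv b"] that by simp
    moreover have "a = (b \<otimes> (inv b \<otimes> a) \<otimes> inv b) \<otimes> b"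
    proof -
      have "(b \<otimes> (inv b \<otimes> a) \<otimes> inv b) \<otimes> b = (b \<otimes> inv b) \<otimes> a \<otimes> (inv b \<otimes> b)"
        using that by (simp only: m_assoc m_closed inv_closed)
      then show ?thesis using that by simp
    qed
    ultimately show ?thesis
      using coset_mult_assoc[OF Kc _ that(2), of "b \<otimes> (inv b \<otimes> a) \<otimes> inv b"] that
        coset_join2[OF _ Z_subgroup, of "b \<otimes> (inv b \<otimes> a) \<otimes> inv b" "Suc n"] by simp
  qed
  have "comm_group (?H Mod ?K)"
  proof (rule group.group_comm_groupI[OF N.factorgroup_is_group])
    fix x y assume "x \<in> carrier (?H Mod ?K)" "y \<in> carrier (?H Mod ?K)"
    then obtain a b where ab: "a \<in> Z n" "b \<in> Z n" "x = ?K #> a" "y = ?K #> b" unfolding car by auto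
    have abc: "a \<in> carrier G" "b \<in> carrier G" using ab Z_carrier by auto
    have "inv a \<otimes> inv b \<otimes> a \<otimes> b \<in> Z (n + n)" using Z_commutator n ab by simp
    then have "inv a \<otimes> inv b \<otimes> a \<otimes> b \<in> ?K" using Z_antimono[of "Suc n" "n + n"] n by auto
    moreover have "inv (b \<otimes> a) \<otimes> (a \<otimes> b) = inv a \<otimes> inv b \<otimes> a \<otimes> b"
      using abc by (simp add: inv_mult_group m_assoc)
    ultimately have "?K #> (a \<otimes> b) = ?K #> (b \<otimes> a)" using abc by (intro eq) auto
    then show "x \<otimes>\<^bsub>?H Mod ?K\<^esub> y = y \<otimes>\<^bsub>?H Mod ?K\<^esub> x" using ab(1,2) by (simp only: ab(3,4) mult)
  qed
  moreover have "x \<otimes>\<^bsub>?H Mod ?K\<^esub> x = \<one>\<^bsub>?H Mod ?K\<^esub>" if "x \<in> carrier (?H Mod ?K)" for x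
  proof -
    from that obtain a where a: "a \<in> Z n" "x = ?K #> a" unfolding car by auto
    have "a \<otimes> a \<in> Z (2 * n)" using Z_square[OF n a(1)] .
    then have "a \<otimes> a \<in> ?K" using Z_antimono[of "Suc n" "2 * n"] n by auto
    then have "?K #> (a \<otimes> a) = ?K" using coset_join2[OF Z_carrier Z_subgroup] by blast
    then show ?thesis by (simp only: a(2) mult[OF a(1) a(1)] one)
  qed
  ultimately show ?thesis using card_F2_space[of "?H Mod ?K"] fin unfolding car by blast
qed

end

section \<open>Compact topological groups\<close>

context group
begin

lemma conj_mult:
  assumes "a \<in> carrier G" "b \<in> carrier G" "g \<in> carrier G"
  shows "inv g \<otimes> (a \<otimes> b) \<otimes> g = (inv g \<otimes> a \<otimes> g) \<otimes> (inv g \<otimes> b \<otimes> g)"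
proof -
  have "(inv g \<otimes> a \<otimes> g) \<otimes> (inv g \<otimes> b \<otimes> g) = inv g \<otimes> a \<otimes> (g \<otimes> inv g) \<otimes> b \<otimes> g"
    using assms by (simp only: m_assoc m_closed inv_closed)
  then show ?thesis using assms by (simp add: m_assoc)
qed

lemma conj_inv:
  assumes "a \<in> carrier G" "g \<in> carrier G"
  shows "inv g \<otimes> inv a \<otimes> g = inv (inv g \<otimes> a \<otimes> g)"
  using assms by (simp add: inv_mult_group m_assoc)

lemma normal_conj: "N \<lhd> G \<Longrightarrow> n \<in> N \<Longrightarrow> g \<in> carrier G \<Longrightarrow> inv g \<otimes> n \<otimes> g \<in> N"
  by (rule normal.inv_op_closed1)

lemma subset_set_mult_left:
  assumes "A \<subseteq> carrier G" "\<one> \<in> B"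
  shows "A \<subseteq> A <#> B"
proof
  fix a assume a: "a \<in> A"
  then have "a \<otimes> \<one> \<in> A <#> B" using assms(2) unfolding set_mult_def by blast
  then show "a \<in> A <#> B" using subsetD[OF assms(1) a] by simp
qed

lemma subset_set_mult_right:
  assumes "B \<subseteq> carrier G" "\<one> \<in> A"
  shows "B \<subseteq> A <#> B"
proof
  fix b assume b: "b \<in> B"
  then have "\<one> \<otimes> b \<in> A <#> B" using assms(2) unfolding set_mult_def by blast
  then show "b \<in> A <#> B" using subsetD[OF assms(1) b] by simp
qed

lemma set_mult_subset_subgroup: "subgroup D G \<Longrightarrow> A \<subseteq> D \<Longrightarrow> B \<subseteq> D \<Longrightarrow> A <#> B \<subseteq> D"
  using subgroup.m_closed[of D G] by (auto simp: set_mult_def)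

end

section \<open>Translations, the tube lemma and closed generation\<close>

context topological_group
begin

lemma continuous_translate_right: "g \<in> carrier G \<Longrightarrow> continuous_map T T (\<lambda>x. x \<otimes> g)"
  using continuous_map_compose[OF continuous_map_pairedI[OF continuous_map_id[unfolded id_def] continuous_map_const[THEN iffD2]] continuous_mult, of g]
  by (simp add: o_def topspace_eq)

lemma continuous_translate_left: "g \<in> carrier G \<Longrightarrow> continuous_map T T (\<lambda>x. g \<otimes> x)"
  using continuous_map_compose[OF continuous_map_pairedI[OF continuous_map_const[THEN iffD2] continuous_map_id[unfolded id_def]] continuous_mult, of g]
  by (simp add: o_def topspace_eq)

lemma continuous_conj: "continuous_map (prod_topology T T) T (\<lambda>(g, x). inv g \<otimes> x \<otimes> g)"
proof -
  have "continuous_map (prod_topology T T) T (\<lambda>p. inv (fst p))"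
    using continuous_map_compose[OF continuous_map_fst continuous_inv] by (simp add: o_def)
  from continuous_map_compose[OF continuous_map_pairedI[OF this continuous_map_snd] continuous_mult]
  have "continuous_map (prod_topology T T) T (\<lambda>p. inv (fst p) \<otimes> snd p)" by (simp add: o_def)
  from continuous_map_compose[OF continuous_map_pairedI[OF this continuous_map_fst] continuous_mult]
  show ?thesis by (simp add: o_def case_prod_unfold)
qed

lemma continuous_conj_right: "g \<in> carrier G \<Longrightarrow> continuous_map T T (\<lambda>x. inv g \<otimes> x \<otimes> g)"
  using continuous_map_compose[OF continuous_translate_left[of "inv g"] continuous_translate_right[of g]]
  by (simp add: o_def)

lemma openin_preimage: "continuous_map T T f \<Longrightarrow> openin T U \<Longrightarrow> openin T {x \<in> carrier G. f x \<in> U}"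
  using openin_continuous_map_preimage[of T T f U] by (simp add: topspace_eq)

lemma closedin_preimage: "continuous_map T T f \<Longrightarrow> closedin T C \<Longrightarrow> closedin T {x \<in> carrier G. f x \<in> C}"
  using closedin_continuous_map_preimage[of T T f C] by (simp add: topspace_eq)

lemma r_coset_preimage:
  assumes "K \<subseteq> carrier G" "g \<in> carrier G"
  shows "K #> g = {x \<in> carrier G. x \<otimes> inv g \<in> K}"
  using assms by (force simp: r_coset_def m_assoc)

lemma openin_r_coset: "openin T K \<Longrightarrow> g \<in> carrier G \<Longrightarrow> openin T (K #> g)"
  using openin_preimage[OF continuous_translate_right[of "inv g"]] r_coset_preimage[of K g]
    openin_subset[of T K] by (simp add: topspace_eq)

lemma closedin_r_coset: "closedin T K \<Longrightarrow> g \<in> carrier G \<Longrightarrow> closedin T (K #> g)"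
  using closedin_preimage[OF continuous_translate_right[of "inv g"]] r_coset_preimage[of K g]
    closedin_subset[of T K] by (simp add: topspace_eq)

text \<open>One neighbourhood of \<open>\<one>\<close> that works for all of the compact set
  \<open>K\<close> at once. Used for multiplication, to obtain an open stabiliser, and for
  conjugation, to obtain an open normal core.\<close>

lemma tube:
  assumes K: "compactin T K" and f: "continuous_map (prod_topology T T) T f" and U: "openin T U"
    and KU: "\<And>k. k \<in> K \<Longrightarrow> f (k, \<one>) \<in> U"
  shows "\<exists>B. openin T B \<and> \<one> \<in> B \<and> (\<forall>k\<in>K. \<forall>b\<in>B. f (k, b) \<in> U)"
proof -
  define P where "P A B \<longleftrightarrow> openin T B \<and> \<one> \<in> B \<and> (\<forall>a\<in>A. \<forall>b\<in>B. f (a, b) \<in> U)" for A B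
  define \<A> where "\<A> = {A. openin T A \<and> (\<exists>B. P A B)}"
  let ?S = "{p \<in> topspace (prod_topology T T). f p \<in> U}"
  have S: "openin (prod_topology T T) ?S" using openin_continuous_map_preimage[OF f U] .
  have Kc: "K \<subseteq> carrier G" using compactin_subset_topspace[OF K] by (simp add: topspace_eq)
  have "K \<subseteq> \<Union>\<A>"
  proof
    fix k assume k: "k \<in> K"
    then have "(k, \<one>) \<in> ?S" using KU[OF k] subsetD[OF Kc k] by (simp add: topspace_eq)
    from S[unfolded openin_prod_topology_alt, rule_format, OF this]
    obtain A B where AB: "openin T A" "openin T B" "k \<in> A" "\<one> \<in> B" "A \<times> B \<subseteq> ?S"
      by (elim exE conjE) (rule that)
    have "f (a, b) \<in> U" if "a \<in> A" "b \<in> B" for a b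
      using subsetD[OF AB(5), of "(a, b)"] that by simp
    then have "P A B" using AB(2,4) by (simp add: P_def)
    then have "A \<in> \<A>" using AB(1) by (auto simp: \<A>_def)
    then show "k \<in> \<Union>\<A>" using AB(3) by (rule UnionI)
  qed
  moreover have "openin T A" if "A \<in> \<A>" for A using that by (simp add: \<A>_def)
  ultimately obtain \<F> where F: "finite \<F>" "\<F> \<subseteq> \<A>" "K \<subseteq> \<Union>\<F>"
    using compactinD[OF K, of \<A>] by blast
  have "\<forall>A\<in>\<F>. \<exists>B. P A B" using F(2) by (auto simp: \<A>_def)
  then obtain B where B: "\<And>A. A \<in> \<F> \<Longrightarrow> P A (B A)" by metis
  \<comment> \<open>Intersecting with \<open>topspace T\<close> covers an empty subcover, whose bare
    intersection would be the whole type.\<close>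
  define C where "C = topspace T \<inter> \<Inter>(B ` \<F>)"
  have "openin T C"
  proof (cases "\<F> = {}")
    case False
    then have "openin T (\<Inter>(B ` \<F>))" using B F(1) by (intro openin_Inter) (auto simp: P_def)
    then show ?thesis by (simp add: C_def openin_Int)
  qed (simp add: C_def)
  moreover have "\<one> \<in> C" using B by (auto simp: C_def P_def topspace_eq)
  moreover have "f (k, b) \<in> U" if "k \<in> K" "b \<in> C" for k b
  proof -
    obtain A where "A \<in> \<F>" "k \<in> A" using F(3) \<open>k \<in> K\<close> by blast
    then show ?thesis using B[of A] that by (auto simp: P_def C_def)
  qed
  ultimately show ?thesis by blast
qed

lemma openin_subgroup:
  assumes H: "subgroup H G" and B: "openin T B" "\<one> \<in> B" "B \<subseteq> H"
  shows "openin T H"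
proof (subst openin_subopen, intro ballI)
  fix h assume h: "h \<in> H"
  have hc: "h \<in> carrier G" using h subgroup.subset[OF H] by auto
  let ?U = "{x \<in> carrier G. inv h \<otimes> x \<in> B}"
  have "openin T ?U" using hc by (intro openin_preimage continuous_translate_left B) auto
  moreover have "h \<in> ?U" using hc B by simp
  moreover have "?U \<subseteq> H"
  proof
    fix x assume x: "x \<in> ?U"
    then have "h \<otimes> (inv h \<otimes> x) \<in> H" using h B subgroup.m_closed[OF H] by blast
    then show "x \<in> H" using x hc by (simp add: m_assoc[symmetric])
  qed
  ultimately show "\<exists>U. openin T U \<and> h \<in> U \<and> U \<subseteq> H" by blast
qed

lemma closedin_open_subgroup:
  assumes H: "subgroup H G" and op: "openin T H"
  shows "closedin T H"
proof -
  have Hc: "H \<subseteq> carrier G" using subgroup.subset[OF H] .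
  have "carrier G - H = \<Union>((\<lambda>g. H #> g) ` (carrier G - H))"
  proof (intro equalityI subsetI)
    fix x assume x: "x \<in> carrier G - H"
    then show "x \<in> \<Union>((\<lambda>g. H #> g) ` (carrier G - H))" using rcos_self[OF _ H] by auto
  next
    fix x assume "x \<in> \<Union>((\<lambda>g. H #> g) ` (carrier G - H))"
    then obtain g h where g: "g \<in> carrier G" "g \<notin> H" "h \<in> H" "x = h \<otimes> g" by (auto simp: r_coset_def)
    have "g \<in> H" if "x \<in> H"
    proof -
      have "inv h \<otimes> (h \<otimes> g) \<in> H" using that g subgroup.m_closed[OF H] subgroup.m_inv_closed[OF H] by auto
      then show ?thesis using g Hc by (simp add: m_assoc[symmetric] subset_iff)
    qed
    then show "x \<in> carrier G - H" using g Hc by auto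
  qed
  moreover have "openin T (\<Union>((\<lambda>g. H #> g) ` (carrier G - H)))"
    using openin_r_coset[OF op] by (intro openin_Union) auto
  ultimately have "openin T (topspace T - H)" by (simp add: topspace_eq)
  then show ?thesis using Hc by (simp add: closedin_def topspace_eq)
qed

lemma closed_generate_subset: "subgroup K G \<Longrightarrow> closedin T K \<Longrightarrow> S \<subseteq> K \<Longrightarrow> closed_generate G T S \<subseteq> K"
  by (auto simp: closed_generate_def)

lemma subset_closed_generate: "S \<subseteq> closed_generate G T S"
  by (auto simp: closed_generate_def)

lemma closed_generate:
  assumes "S \<subseteq> carrier G"
  shows "subgroup (closed_generate G T S) G" "closedin T (closed_generate G T S)"
proof -
  let ?F = "{K. subgroup K G \<and> closedin T K \<and> S \<subseteq> K}"
  have c: "carrier G \<in> ?F" using assms subgroup_self closedin_topspace[of T] by (simp add: topspace_eq)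
  then show "subgroup (closed_generate G T S) G"
    unfolding closed_generate_def by (intro subgroups_Inter) auto
  show "closedin T (closed_generate G T S)"
    unfolding closed_generate_def using c by (intro closedin_Inter) auto
qed

text \<open>The elements whose conjugate by \<open>g\<close> lies in the generated subgroup form a
  closed subgroup containing \<open>S\<close>; minimality does the rest.\<close>

lemma closed_generate_normal:
  assumes S: "S \<subseteq> carrier G" and conj: "\<And>s g. s \<in> S \<Longrightarrow> g \<in> carrier G \<Longrightarrow> inv g \<otimes> s \<otimes> g \<in> S"
  shows "closed_generate G T S \<lhd> G"
proof -
  let ?C = "closed_generate G T S"
  have inv_conj: "inv g \<otimes> h \<otimes> g \<in> ?C" if h: "h \<in> ?C" and g: "g \<in> carrier G" for g h
  proof -
    let ?K = "{x \<in> carrier G. inv g \<otimes> x \<otimes> g \<in> ?C}"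
    have "subgroup ?K G"
    proof (rule subgroupI)
      show "?K \<noteq> {}"
        using g subgroup.one_closed[OF closed_generate(1)[OF S]] by (auto intro!: exI[of _ \<one>])
      show "inv a \<in> ?K" if "a \<in> ?K" for a
      proof -
        have a: "a \<in> carrier G" using that by simp
        then show ?thesis using that conj_inv[OF a g] subgroup.m_inv_closed[OF closed_generate(1)[OF S]]
          by (metis (no_types, lifting) inv_closed mem_Collect_eq)
      qed
      show "a \<otimes> b \<in> ?K" if "a \<in> ?K" "b \<in> ?K" for a b
      proof -
        have ab: "a \<in> carrier G" "b \<in> carrier G" using that by simp_all
        then show ?thesis using that conj_mult[OF ab g] subgroup.m_closed[OF closed_generate(1)[OF S]]
          by (metis (no_types, lifting) m_closed mem_Collect_eq)
      qed
    qed auto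
    moreover have "closedin T ?K"
      by (rule closedin_preimage[OF continuous_conj_right[OF g] closed_generate(2)[OF S]])
    moreover have "S \<subseteq> ?K" using S conj g subset_closed_generate by blast
    ultimately have "?C \<subseteq> ?K" by (rule closed_generate_subset)
    then show ?thesis using h by auto
  qed
  have "g \<otimes> h \<otimes> inv g \<in> ?C" if "h \<in> ?C" "g \<in> carrier G" for g h
    using inv_conj[OF that(1), of "inv g"] that by simp
  then show ?thesis using closed_generate(1)[OF S] by (simp add: normal_inv_iff)
qed

end

locale compact_group = topological_group +
  assumes compact_space: "compact_space T" and Hausdorff_space: "Hausdorff_space T"
begin

lemma closedin_set_mult:
  assumes "closedin T A" "closedin T B"
  shows "closedin T (A <#> B)"
proof -
  have "compactin (prod_topology T T) (A \<times> B)"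
    unfolding compactin_Times using assms closedin_compact_space[OF compact_space] by auto
  from image_compactin[OF this continuous_mult] have "compactin T ((\<lambda>(x, y). x \<otimes> y) ` (A \<times> B))" .
  moreover have "(\<lambda>(x, y). x \<otimes> y) ` (A \<times> B) = A <#> B" by (auto simp: set_mult_def)
  ultimately show ?thesis using compactin_imp_closedin[OF Hausdorff_space] by simp
qed

lemma finite_rcosets_open_subgroup:
  assumes H: "subgroup H G" and op: "openin T H"
  shows "finite (rcosets H)"
proof -
  have op': "openin T U" if "U \<in> rcosets H" for U
    using that openin_r_coset[OF op] by (auto simp: RCOSETS_def)
  have "compactin T (topspace T)" using compact_space by (simp add: compact_space_def)
  moreover have "topspace T \<subseteq> \<Union>(rcosets H)" using rcosets_part_G[OF H] by (simp add: topspace_eq)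
  ultimately obtain \<F> where F: "finite \<F>" "\<F> \<subseteq> rcosets H" "topspace T \<subseteq> \<Union>\<F>"
    using compactinD[of T "topspace T" "rcosets H"] op' by blast
  have "rcosets H \<subseteq> \<F>"
  proof
    fix C assume C: "C \<in> rcosets H"
    then obtain g where g: "g \<in> carrier G" "C = H #> g" by (auto simp: RCOSETS_def)
    then have "g \<in> C" using rcos_self[OF _ H] by simp
    moreover obtain D where D: "D \<in> \<F>" "g \<in> D" using F(3) g(1) unfolding topspace_eq by blast
    ultimately have "C = D"
      using pairwiseD[OF rcos_disjoint[OF H] C subsetD[OF F(2) D(1)]] by (auto simp: disjnt_def)
    then show "C \<in> \<F>" using D by simp
  qed
  then show ?thesis using F finite_subset by blast
qed

end

sublocale pro2_group \<subseteq> compact_group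
  by unfold_locales (fact compact, fact Hausdorff)

section \<open>Open normal subgroups as a neighbourhood basis of the identity\<close>

context pro2_group
begin

text \<open>In a compact Hausdorff space components are quasi-components, so clopen sets separate
  \<open>\<one>\<close> from every other point, and compactness gives a clopen \<open>W\<close> with
  \<open>\<one> \<in> W\<close> inside \<open>U\<close>. The stabiliser of \<open>W\<close> under
  right translation is an open subgroup contained in \<open>W\<close>. Its normal core is open
  because conjugation ranges over a compact group.\<close>

lemma open_normal_basis:
  assumes U: "openin T U" "\<one> \<in> U"
  shows "\<exists>N. N \<lhd> G \<and> openin T N \<and> N \<subseteq> U"
proof -
  define \<S> where "\<S> = {topspace T - S | S. closedin T S \<and> openin T S \<and> \<one> \<in> S}"
  have quasi: "quasi_component_of T \<one> = connected_component_of T \<one>"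
    using quasi_eq_connected_components_of[of T] compact Hausdorff
    unfolding quasi_eq_connected_components_of_pointwise_alt by blast
  have sep: "\<exists>S. closedin T S \<and> openin T S \<and> \<one> \<in> S \<and> y \<notin> S" if y: "y \<in> carrier G" "y \<noteq> \<one>" for y
  proof (rule ccontr)
    assume "\<not> ?thesis"
    then have "quasi_component_of T \<one> y" using y unfolding quasi_component_of by (auto simp: topspace_eq)
    then have "connected_component_of T \<one> y" using quasi by simp
    then obtain S where "connectedin T S" "\<one> \<in> S" "y \<in> S" unfolding connected_component_of_def by blast
    then show False using totally_disconnected y by blast
  qed
  have cU: "compactin T (topspace T - U)"
    by (rule closedin_compact_space[OF compact closedin_diff[OF closedin_topspace U(1)]])
  have "openin T S" if "S \<in> \<S>" for S using that by (auto simp: \<S>_def)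
  moreover have "topspace T - U \<subseteq> \<Union>\<S>"
  proof
    fix y assume y: "y \<in> topspace T - U"
    then have "y \<in> carrier G" "y \<noteq> \<one>" using U by (auto simp: topspace_eq)
    from sep[OF this] show "y \<in> \<Union>\<S>" using y unfolding \<S>_def by blast
  qed
  ultimately obtain \<F> where F: "finite \<F>" "\<F> \<subseteq> \<S>" "topspace T - U \<subseteq> \<Union>\<F>"
    using compactinD[OF cU, of \<S>] by blast
  define W where "W = topspace T - \<Union>\<F>"
  have W1: "\<one> \<in> W" using F(2) by (auto simp: W_def topspace_eq \<S>_def)
  have WU: "W \<subseteq> U" using F(3) by (auto simp: W_def)
  have "closedin T (\<Union>\<F>)" using F(1,2) by (intro closedin_Union) (auto simp: \<S>_def)
  then have Wo: "openin T W" unfolding W_def by (rule openin_diff[OF openin_topspace])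
  have "openin T (\<Union>\<F>)" using F(2) by (intro openin_Union) (auto simp: \<S>_def)
  then have Wc: "closedin T W" unfolding W_def by (rule closedin_diff[OF closedin_topspace])
  have WG: "W \<subseteq> carrier G" by (auto simp: W_def topspace_eq)
  define H where "H = {g \<in> carrier G. \<forall>w\<in>carrier G. w \<in> W \<longleftrightarrow> w \<otimes> g \<in> W}"
  have H: "subgroup H G"
  proof (rule subgroupI)
    have "\<one> \<in> H" by (simp add: H_def)
    then show "H \<noteq> {}" by blast
    show "inv a \<in> H" if "a \<in> H" for a
    proof -
      have a: "a \<in> carrier G" using that by (simp add: H_def)
      have "w \<in> W \<longleftrightarrow> w \<otimes> inv a \<in> W" if w: "w \<in> carrier G" for w
      proof -
        have "w \<otimes> inv a \<in> W \<longleftrightarrow> (w \<otimes> inv a) \<otimes> a \<in> W"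
          using \<open>a \<in> H\<close> w a unfolding H_def by blast
        then show ?thesis using w a by (simp add: m_assoc)
      qed
      then show ?thesis using a unfolding H_def by blast
    qed
    show "a \<otimes> b \<in> H" if "a \<in> H" "b \<in> H" for a b
    proof -
      have ab: "a \<in> carrier G" "b \<in> carrier G" using that by (simp_all add: H_def)
      have "w \<in> W \<longleftrightarrow> w \<otimes> (a \<otimes> b) \<in> W" if w: "w \<in> carrier G" for w
      proof -
        have "w \<in> W \<longleftrightarrow> w \<otimes> a \<in> W" using \<open>a \<in> H\<close> w unfolding H_def by blast
        also have "\<dots> \<longleftrightarrow> w \<otimes> a \<otimes> b \<in> W" using \<open>b \<in> H\<close> w ab unfolding H_def by blast
        finally show ?thesis using w ab by (simp add: m_assoc)
      qed
      then show ?thesis using ab unfolding H_def by blast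
    qed
  qed (auto simp: H_def)
  have HW: "H \<subseteq> W"
  proof
    fix h assume "h \<in> H"
    then have "\<one> \<in> W \<longleftrightarrow> \<one> \<otimes> h \<in> W" "h \<in> carrier G" unfolding H_def by blast+
    then show "h \<in> W" using W1 by simp
  qed
  have "\<exists>B. openin T B \<and> \<one> \<in> B \<and> (\<forall>w\<in>W. \<forall>b\<in>B. (case (w, b) of (x, y) \<Rightarrow> x \<otimes> y) \<in> W)"
    by (rule tube[OF closedin_compact_space[OF compact Wc] continuous_mult Wo]) (use WG in auto)
  then obtain B where B: "openin T B" "\<one> \<in> B" "\<And>w b. w \<in> W \<Longrightarrow> b \<in> B \<Longrightarrow> w \<otimes> b \<in> W"
    unfolding prod.case by blast
  define B' where "B' = B \<inter> {x \<in> carrier G. inv x \<in> B}"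
  have "openin T B'" unfolding B'_def by (intro openin_Int B openin_preimage continuous_inv)
  moreover have "\<one> \<in> B'" using B by (simp add: B'_def)
  moreover have "B' \<subseteq> H"
  proof
    fix b assume b: "b \<in> B'"
    then have bc: "b \<in> carrier G" by (simp add: B'_def)
    have "w \<in> W" if "w \<otimes> b \<in> W" "w \<in> carrier G" for w
      using B(3)[OF that(1), of "inv b"] b bc that(2) by (simp add: B'_def m_assoc)
    moreover have "w \<otimes> b \<in> W" if "w \<in> W" for w using B(3)[OF that] b by (simp add: B'_def)
    ultimately show "b \<in> H" using bc unfolding H_def by blast
  qed
  ultimately have Ho: "openin T H" by (rule openin_subgroup[OF H])
  define N where "N = {n \<in> carrier G. \<forall>g\<in>carrier G. inv g \<otimes> n \<otimes> g \<in> H}"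
  have N: "subgroup N G"
  proof (rule subgroupI)
    have "\<one> \<in> N" using subgroup.one_closed[OF H] by (simp add: N_def)
    then show "N \<noteq> {}" by blast
    show "inv a \<in> N" if "a \<in> N" for a
    proof -
      have a: "a \<in> carrier G" using that by (simp add: N_def)
      have "inv g \<otimes> inv a \<otimes> g \<in> H" if g: "g \<in> carrier G" for g
      proof -
        have "inv (inv g \<otimes> a \<otimes> g) \<in> H"
          using \<open>a \<in> N\<close> g by (intro subgroup.m_inv_closed[OF H]) (simp add: N_def)
        then show ?thesis using conj_inv[OF a g] by simp
      qed
      then show ?thesis using a by (simp add: N_def)
    qed
    show "a \<otimes> b \<in> N" if "a \<in> N" "b \<in> N" for a b
    proof -
      have ab: "a \<in> carrier G" "b \<in> carrier G" using that by (simp_all add: N_def)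
      have "inv g \<otimes> (a \<otimes> b) \<otimes> g \<in> H" if g: "g \<in> carrier G" for g
      proof -
        have "(inv g \<otimes> a \<otimes> g) \<otimes> (inv g \<otimes> b \<otimes> g) \<in> H"
        proof (rule subgroup.m_closed[OF H])
          show "inv g \<otimes> a \<otimes> g \<in> H" using \<open>a \<in> N\<close> g by (simp add: N_def)
          show "inv g \<otimes> b \<otimes> g \<in> H" using \<open>b \<in> N\<close> g by (simp add: N_def)
        qed
        then show ?thesis using conj_mult[OF ab g] by simp
      qed
      then show ?thesis using ab by (simp add: N_def)
    qed
  qed (auto simp: N_def)
  have "N \<lhd> G"
  proof -
    have "g \<otimes> n \<otimes> inv g \<in> N" if n: "n \<in> N" and g: "g \<in> carrier G" for g n
    proof -
      have nc: "n \<in> carrier G" using n by (simp add: N_def)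
      have "inv h \<otimes> (g \<otimes> n \<otimes> inv g) \<otimes> h \<in> H" if h: "h \<in> carrier G" for h
      proof -
        have "inv h \<otimes> (g \<otimes> n \<otimes> inv g) \<otimes> h = inv (inv g \<otimes> h) \<otimes> n \<otimes> (inv g \<otimes> h)"
          using nc g h by (simp add: inv_mult_group m_assoc)
        then show ?thesis using n g h by (simp add: N_def)
      qed
      then show ?thesis using nc g by (simp add: N_def)
    qed
    then show ?thesis using N by (simp add: normal_inv_iff)
  qed
  moreover have "openin T N"
  proof -
    have cG: "compactin T (carrier G)" using compact by (simp add: compact_space_def topspace_eq)
    have "\<exists>B. openin T B \<and> \<one> \<in> B \<and> (\<forall>g\<in>carrier G. \<forall>b\<in>B. (case (g, b) of (g, x) \<Rightarrow> inv g \<otimes> x \<otimes> g) \<in> H)"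
      by (rule tube[OF cG continuous_conj Ho]) (use subgroup.one_closed[OF H] in auto)
    then obtain B where B: "openin T B" "\<one> \<in> B" "\<And>g b. g \<in> carrier G \<Longrightarrow> b \<in> B \<Longrightarrow> inv g \<otimes> b \<otimes> g \<in> H"
      unfolding prod.case by blast
    then have "B \<subseteq> N" using openin_subset[OF B(1)] by (auto simp: N_def topspace_eq)
    then show ?thesis using openin_subgroup[OF N B(1,2)] by simp
  qed
  moreover have "N \<subseteq> U"
  proof
    fix n assume n: "n \<in> N"
    then have "inv \<one> \<otimes> n \<otimes> \<one> \<in> H" "n \<in> carrier G" unfolding N_def by blast+
    then show "n \<in> U" using HW WU by auto
  qed
  ultimately show ?thesis by blast
qed

end

section \<open>The Zassenhaus filtration of a compact group\<close>

context compact_group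
begin

definition closed_normal :: "'a set \<Rightarrow> bool"
  where "closed_normal A \<longleftrightarrow> A \<lhd> G \<and> closedin T A"

lemma closed_normal_subgroup: "closed_normal A \<Longrightarrow> subgroup A G"
  by (simp add: closed_normal_def normal_imp_subgroup)

lemma closed_normal_subset: "closed_normal A \<Longrightarrow> A \<subseteq> carrier G"
  using closed_normal_subgroup subgroup.subset by blast

lemma closed_normal_set_mult:
  assumes "closed_normal A" "closed_normal B"
  shows "closed_normal (A <#> B)"
  using assms normal_subgroup_set_mult_closed[of A B] closedin_set_mult by (simp add: closed_normal_def)

lemma closed_normal_singleton: "closed_normal {\<one>}"
  using one_is_normal closedin_Hausdorff_singleton[OF Hausdorff_space, of \<one>]
  by (simp add: closed_normal_def topspace_eq)

text \<open>The explicit product of the definition becomes the least subgroup containing all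
  factors. Normality makes the products subgroups, compactness keeps them closed.\<close>

lemma foldr_set_mult:
  assumes "\<And>i. i \<in> set is \<Longrightarrow> closed_normal (A i)"
  defines "P \<equiv> foldr (\<lambda>i P. A i <#> P) is {\<one>}"
  shows "closed_normal P \<and> (\<forall>i\<in>set is. A i \<subseteq> P) \<and>
    (\<forall>D. subgroup D G \<and> (\<forall>i\<in>set is. A i \<subseteq> D) \<longrightarrow> P \<subseteq> D)"
  using assms(1) unfolding P_def
proof (induction "is")
  case Nil
  show ?case using closed_normal_singleton subgroup.one_closed by auto
next
  case (Cons j js)
  let ?P = "foldr (\<lambda>i P. A i <#> P) js {\<one>}"
  have IH: "closed_normal ?P" "\<And>i. i \<in> set js \<Longrightarrow> A i \<subseteq> ?P"
    "\<And>D. subgroup D G \<Longrightarrow> (\<And>i. i \<in> set js \<Longrightarrow> A i \<subseteq> D) \<Longrightarrow> ?P \<subseteq> D"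
    using Cons by auto
  have j: "closed_normal (A j)" using Cons.prems by simp
  have 1: "A j \<subseteq> A j <#> ?P"
    by (rule subset_set_mult_left[OF closed_normal_subset[OF j] subgroup.one_closed[OF closed_normal_subgroup[OF IH(1)]]])
  have 2: "?P \<subseteq> A j <#> ?P"
    by (rule subset_set_mult_right[OF closed_normal_subset[OF IH(1)] subgroup.one_closed[OF closed_normal_subgroup[OF j]]])
  have 3: "A j <#> ?P \<subseteq> D" if "subgroup D G" "\<And>i. i \<in> set (j # js) \<Longrightarrow> A i \<subseteq> D" for D
    by (rule set_mult_subset_subgroup[OF that(1) that(2) IH(3)[OF that(1) that(2)]]) simp_all
  have 4: "A i \<subseteq> A j <#> ?P" if "i \<in> set (j # js)" for i
    using that 1 subset_trans[OF IH(2) 2] by (cases "i = j") simp_all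
  show ?case unfolding foldr.simps o_apply using closed_normal_set_mult[OF j IH(1)] 3 4 by blast
qed

lemma closed_normal_closed_squares:
  assumes "closed_normal H"
  shows "closed_normal (closed_squares G T H)"
proof -
  note H = closed_normal_subset[OF assms]
  let ?S = "{x \<otimes> x | x. x \<in> H}"
  have S: "?S \<subseteq> carrier G" using H by auto
  have conj: "inv g \<otimes> s \<otimes> g \<in> ?S" if s: "s \<in> ?S" and g: "g \<in> carrier G" for s g
  proof -
    obtain x where x: "x \<in> H" "s = x \<otimes> x" using s by auto
    then show ?thesis using conj_mult[of x x g] g H assms normal_conj[of H x g]
      by (auto simp: closed_normal_def)
  qed
  show ?thesis unfolding closed_squares_def closed_normal_def
    by (rule conjI[OF closed_generate_normal[OF S conj] closed_generate(2)[OF S]])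
qed

lemma closed_normal_closed_commutator:
  assumes H: "closed_normal H" and K: "closed_normal K"
  shows "closed_normal (closed_commutator G T H K)"
proof -
  let ?S = "{inv x \<otimes> inv y \<otimes> x \<otimes> y | x y. x \<in> H \<and> y \<in> K}"
  have S: "?S \<subseteq> carrier G" 
    using subsetD[OF closed_normal_subset[OF H]] subsetD[OF closed_normal_subset[OF K]] by auto
  have conj: "inv g \<otimes> s \<otimes> g \<in> ?S" if s: "s \<in> ?S" and g: "g \<in> carrier G" for s g
  proof -
    obtain x y where xy: "x \<in> H" "y \<in> K" "s = inv x \<otimes> inv y \<otimes> x \<otimes> y" using s by auto
    have c: "x \<in> carrier G" "y \<in> carrier G"
      using xy closed_normal_subset[OF H] closed_normal_subset[OF K] by auto
    define x' y' where "x' = inv g \<otimes> x \<otimes> g" and "y' = inv g \<otimes> y \<otimes> g"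
    have "x' \<in> H" "y' \<in> K"
      using H K xy g by (auto simp: x'_def y'_def closed_normal_def intro: normal_conj)
    moreover have "inv g \<otimes> s \<otimes> g = inv x' \<otimes> inv y' \<otimes> x' \<otimes> y'"
    proof -
      have "inv g \<otimes> s \<otimes> g = (inv g \<otimes> inv x \<otimes> g) \<otimes> (inv g \<otimes> inv y \<otimes> g) \<otimes> x' \<otimes> y'"
        using conj_mult[of "inv x \<otimes> inv y \<otimes> x" y g] conj_mult[of "inv x \<otimes> inv y" x g]
          conj_mult[of "inv x" "inv y" g] c g by (simp add: xy(3) x'_def y'_def)
      then show ?thesis using conj_inv[OF c(1) g] conj_inv[OF c(2) g] by (simp add: x'_def y'_def)
    qed
    ultimately show ?thesis by blast
  qed
  show ?thesis unfolding closed_commutator_def closed_normal_def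
    by (rule conjI[OF closed_generate_normal[OF S conj] closed_generate(2)[OF S]])
qed

lemma zassenhaus_le_one: "n \<le> 1 \<Longrightarrow> zassenhaus G T n = carrier G"
  by (subst zassenhaus.simps) simp

lemma zassenhaus_ge_two: "n \<ge> 2 \<Longrightarrow> zassenhaus G T n =
    closed_squares G T (zassenhaus G T ((n + 1) div 2)) <#>
    foldr (\<lambda>i P. closed_commutator G T (zassenhaus G T i) (zassenhaus G T (n - i)) <#> P) [1..<n] {\<one>}"
  by (subst zassenhaus.simps) simp

lemma closed_normal_zassenhaus: "closed_normal (zassenhaus G T n)"
proof (induction n rule: less_induct)
  case (less n)
  show ?case
  proof (cases "n \<le> 1")
    case True
    then show ?thesis using closedin_topspace[of T] normal_self
      by (simp add: zassenhaus_le_one closed_normal_def topspace_eq)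
  next
    case False
    have "closed_normal (closed_squares G T (zassenhaus G T ((n + 1) div 2)))"
      by (rule closed_normal_closed_squares[OF less]) (use False in auto)
    moreover have "closed_normal (foldr (\<lambda>i P. closed_commutator G T (zassenhaus G T i) (zassenhaus G T (n - i)) <#> P) [1..<n] {\<one>})"
      by (rule foldr_set_mult[THEN conjunct1], rule closed_normal_closed_commutator[OF less less]) auto
    ultimately show ?thesis using False closed_normal_set_mult by (simp add: zassenhaus_ge_two)
  qed
qed

text \<open>From here on, membership of squares and commutators together with minimality among
  closed subgroups takes the place of the recursive equation for \<open>n \<ge> 2\<close>.\<close>

lemma
  assumes n: "n \<ge> 2"
  shows zassenhaus_square: "x \<in> zassenhaus G T ((n + 1) div 2) \<Longrightarrow> x \<otimes> x \<in> zassenhaus G T n"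
    and zassenhaus_commutator: "\<lbrakk>i \<in> {1..<n}; x \<in> zassenhaus G T i; y \<in> zassenhaus G T (n - i)\<rbrakk>
      \<Longrightarrow> inv x \<otimes> inv y \<otimes> x \<otimes> y \<in> zassenhaus G T n"
    and zassenhaus_least: "\<lbrakk>subgroup D G; closedin T D;
      \<And>x. x \<in> zassenhaus G T ((n + 1) div 2) \<Longrightarrow> x \<otimes> x \<in> D;
      \<And>i x y. i \<in> {1..<n} \<Longrightarrow> x \<in> zassenhaus G T i \<Longrightarrow> y \<in> zassenhaus G T (n - i) \<Longrightarrow>
        inv x \<otimes> inv y \<otimes> x \<otimes> y \<in> D\<rbrakk> \<Longrightarrow> zassenhaus G T n \<subseteq> D"
proof -
  let ?Z = "zassenhaus G T"
  let ?A = "\<lambda>i. closed_commutator G T (?Z i) (?Z (n - i))"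
  let ?S = "closed_squares G T (?Z ((n + 1) div 2))"
  let ?P = "foldr (\<lambda>i P. ?A i <#> P) [1..<n] {\<one>}"
  have P: "closed_normal ?P" "\<And>i. i \<in> {1..<n} \<Longrightarrow> ?A i \<subseteq> ?P"
    "\<And>D. subgroup D G \<Longrightarrow> (\<And>i. i \<in> {1..<n} \<Longrightarrow> ?A i \<subseteq> D) \<Longrightarrow> ?P \<subseteq> D"
    using foldr_set_mult[of "[1..<n]" ?A, OF closed_normal_closed_commutator[OF closed_normal_zassenhaus closed_normal_zassenhaus]]
    unfolding set_upt by blast+
  have S: "closed_normal ?S" by (rule closed_normal_closed_squares[OF closed_normal_zassenhaus])
  note Z = zassenhaus_ge_two[OF n]
  have SZ: "?S \<subseteq> ?Z n" unfolding Z
    by (rule subset_set_mult_left[OF closed_normal_subset[OF S] subgroup.one_closed[OF closed_normal_subgroup[OF P(1)]]])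
  have PZ: "?P \<subseteq> ?Z n" unfolding Z
    by (rule subset_set_mult_right[OF closed_normal_subset[OF P(1)] subgroup.one_closed[OF closed_normal_subgroup[OF S]]])
  show "x \<otimes> x \<in> ?Z n" if "x \<in> ?Z ((n + 1) div 2)"
  proof (rule subsetD[OF SZ])
    show "x \<otimes> x \<in> ?S"
      unfolding closed_squares_def by (rule subsetD[OF subset_closed_generate]) (use that in blast)
  qed
  show "inv x \<otimes> inv y \<otimes> x \<otimes> y \<in> ?Z n" if "i \<in> {1..<n}" "x \<in> ?Z i" "y \<in> ?Z (n - i)"
  proof -
    have "inv x \<otimes> inv y \<otimes> x \<otimes> y \<in> ?A i"
      unfolding closed_commutator_def by (rule subsetD[OF subset_closed_generate]) (use that in blast)
    then show ?thesis by (rule subsetD[OF PZ subsetD[OF P(2)[OF that(1)]]])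
  qed
  show "?Z n \<subseteq> D" if D: "subgroup D G" "closedin T D"
    and sq: "\<And>x. x \<in> ?Z ((n + 1) div 2) \<Longrightarrow> x \<otimes> x \<in> D"
    and com: "\<And>i x y. i \<in> {1..<n} \<Longrightarrow> x \<in> ?Z i \<Longrightarrow> y \<in> ?Z (n - i) \<Longrightarrow> inv x \<otimes> inv y \<otimes> x \<otimes> y \<in> D"
    unfolding Z
  proof (rule set_mult_subset_subgroup[OF D(1)])
    show "?S \<subseteq> D" unfolding closed_squares_def
      by (rule closed_generate_subset[OF D]) (use sq in blast)
    show "?P \<subseteq> D"
    proof (rule P(3)[OF D(1)])
      show "?A i \<subseteq> D" if "i \<in> {1..<n}" for i
        unfolding closed_commutator_def
        by (rule closed_generate_subset[OF D]) (use com[OF that] in blast)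
    qed
  qed
qed

text \<open>By minimality it suffices to place the generators of the smaller term. In a commutator
  one index is lowered by 1 through the induction hypothesis: that of \<open>y\<close> if
  \<open>i = 1\<close>, otherwise that of \<open>x\<close>, so that both indices stay
  positive.\<close>

lemma zassenhaus_Suc_subset: "zassenhaus G T (Suc n) \<subseteq> zassenhaus G T n"
proof (induction n rule: less_induct)
  case (less n)
  let ?Z = "zassenhaus G T"
  show ?case
  proof (cases "n \<le> 1")
    case True
    then show ?thesis using closed_normal_subset[OF closed_normal_zassenhaus] by (simp add: zassenhaus_le_one)
  next
    case False
    then have n: "n \<ge> 2" by simp
    show ?thesis
    proof (rule zassenhaus_least)
      show "subgroup (?Z n) G" "closedin T (?Z n)"
        using closed_normal_zassenhaus[of n] closed_normal_subgroup by (auto simp: closed_normal_def)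
      show "Suc n \<ge> 2" using n by simp
      fix x assume x: "x \<in> ?Z ((Suc n + 1) div 2)"
      have "?Z ((Suc n + 1) div 2) \<subseteq> ?Z ((n + 1) div 2)"
      proof (cases "even n")
        case True
        then have "(Suc n + 1) div 2 = Suc ((n + 1) div 2)" by (auto elim!: evenE)
        moreover have "(n + 1) div 2 < n" using n by auto
        ultimately show ?thesis using less[of "(n + 1) div 2"] by simp
      next
        case False
        then have "(Suc n + 1) div 2 = (n + 1) div 2" by (auto elim!: oddE)
        then show ?thesis by simp
      qed
      then show "x \<otimes> x \<in> ?Z n" using zassenhaus_square[OF n] x by blast
    next
      fix i x y assume i: "i \<in> {1..<Suc n}" and x: "x \<in> ?Z i" and y: "y \<in> ?Z (Suc n - i)"
      show "inv x \<otimes> inv y \<otimes> x \<otimes> y \<in> ?Z n"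
      proof (cases "i = 1")
        case True
        have "y \<in> ?Z (n - 1)" using y True less[of "n - 1"] n by auto
        then show ?thesis using zassenhaus_commutator[OF n, of 1 x y] x True n by simp
      next
        case False
        have "i - 1 < n" "Suc (i - 1) = i" using i False by auto
        then have "x \<in> ?Z (i - 1)" using x less[of "i - 1"] by auto
        moreover have "n - (i - 1) = Suc n - i" using i False by auto
        moreover have "i - 1 \<in> {1..<n}" unfolding atLeastLessThan_iff using i False by (simp; linarith)
        ultimately show ?thesis using zassenhaus_commutator[OF n, of "i - 1" x y] y by simp
      qed
    qed
  qed
qed

lemma filtered_group_zassenhaus: "filtered_group G (zassenhaus G T)"
proof (rule filtered_group.intro[OF group_axioms filtered_group_axioms.intro])
  show "subgroup (zassenhaus G T n) G" for n
    using closed_normal_zassenhaus by (rule closed_normal_subgroup)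
  show "zassenhaus G T (Suc 0) = carrier G" by (simp add: zassenhaus_le_one)
  show "zassenhaus G T (Suc n) \<subseteq> zassenhaus G T n" for n by (rule zassenhaus_Suc_subset)
  show "inv x \<otimes> inv y \<otimes> x \<otimes> y \<in> zassenhaus G T (i + j)"
    if "i \<ge> 1" "j \<ge> 1" "x \<in> zassenhaus G T i" "y \<in> zassenhaus G T j" for i j x y
    using zassenhaus_commutator[of "i + j" i x y] that by simp
  show "x \<otimes> x \<in> zassenhaus G T (2 * i)" if "i \<ge> 1" "x \<in> zassenhaus G T i" for i x
    using zassenhaus_square[of "2 * i" x] that by simp
qed

end

section \<open>The universal property for finite 2-groups\<close>

lemma finite_pro2_group:
  assumes H: "group H" and ord: "order H = 2 ^ k"
  shows "pro2_group H (discrete_topology (carrier H))"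
proof -
  interpret H: group H by (rule H)
  have "order H > 0" using ord by simp
  then have fin: "finite (carrier H)" by (simp add: H.order_gt_0_iff_finite)
  let ?D = "discrete_topology (carrier H)"
  show ?thesis
  proof (intro pro2_group.intro topological_group.intro topological_group_axioms.intro pro2_group_axioms.intro)
    show "group H" by (rule H)
    show "topspace ?D = carrier H" by simp
    show "continuous_map (prod_topology ?D ?D) ?D (\<lambda>(x, y). x \<otimes>\<^bsub>H\<^esub> y)"
      by (auto simp: prod_topology_discrete_topology[symmetric])
    show "continuous_map ?D ?D (\<lambda>x. inv\<^bsub>H\<^esub> x)" by auto
    show "compact_space ?D" using fin by (simp add: compact_space_discrete_topology)
    show "Hausdorff_space ?D" by simp
    show "x = y" if "connectedin ?D S" "x \<in> S" "y \<in> S" for S x y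
      using that by (auto simp: connectedin_discrete_topology)
    show "\<exists>j. order (H Mod N) = 2 ^ j" if N: "N \<lhd> H" for N
    proof -
      have "order (H Mod N) * card N = 2 ^ k"
        using H.lagrange[OF normal_imp_subgroup[OF N]] ord by (simp add: order_def FactGroup_def)
      then have "order (H Mod N) dvd 2 ^ k" using dvd_triv_left[of "order (H Mod N)" "card N"] by simp
      then show ?thesis using divides_primepow_nat[OF two_is_prime_nat] by blast
    qed
  qed
qed

section \<open>The canonical involutions and the universal property for finite targets\<close>

locale C2_free_product =
  fixes d :: nat and G :: "('a, 'b) monoid_scheme" (structure) and T :: "'a topology"
    and \<phi> :: "nat \<Rightarrow> int \<Rightarrow> 'a"
  assumes free_product:
    "is_pro2_free_product TYPE(nat set) {0..d} (\<lambda>_. C2) (\<lambda>_. C2_top) G T \<phi>"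

sublocale C2_free_product \<subseteq> pro2_group G T
  using free_product by (simp add: is_pro2_free_product_def)

context C2_free_product
begin

lemma carrier_C2: "carrier C2 = {0, 1}"
  by (auto simp: carrier_integer_mod_group)

definition gen :: "nat \<Rightarrow> 'a"
  where "gen i = \<phi> i 1"

lemma \<phi>_hom: "i \<le> d \<Longrightarrow> \<phi> i \<in> hom C2 G"
  using free_product by (simp add: is_pro2_free_product_def continuous_hom_def)

lemma gen_closed: "i \<le> d \<Longrightarrow> gen i \<in> carrier G"
  using hom_in_carrier[OF \<phi>_hom, of i 1] by (simp add: gen_def carrier_C2)

lemma \<phi>_zero: "i \<le> d \<Longrightarrow> \<phi> i 0 = \<one>"
  using hom_one[OF \<phi>_hom group_integer_mod_group group_axioms] by simp

lemma gen_square: "i \<le> d \<Longrightarrow> gen i \<otimes> gen i = \<one>"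
  using hom_mult[OF \<phi>_hom, of i 1 1] \<phi>_zero by (simp add: gen_def carrier_C2)

text \<open>The universal property speaks of groups on the type \<open>nat set\<close>. A finite
  group on any type has a copy there, by numbering its elements and taking singletons, and maps are
  transported along this isomorphism.\<close>

lemma universal:
  fixes H :: "('c, 'e) monoid_scheme"
  assumes H: "group H" and ord: "order H = 2 ^ k"
    and h: "\<And>i. i \<le> d \<Longrightarrow> h i \<in> carrier H" "\<And>i. i \<le> d \<Longrightarrow> h i \<otimes>\<^bsub>H\<^esub> h i = \<one>\<^bsub>H\<^esub>"
  shows "\<exists>f. f \<in> continuous_hom G T H (discrete_topology (carrier H)) \<and> (\<forall>i\<le>d. f (gen i) = h i) \<and>
    (\<forall>g. g \<in> continuous_hom G T H (discrete_topology (carrier H)) \<and> (\<forall>i\<le>d. g (gen i) = h i) \<longrightarrow>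
      (\<forall>x\<in>carrier G. g x = f x))"
proof -
  interpret H: group H by (rule H)
  let ?D = "discrete_topology (carrier H)"
  have "order H > 0" using ord by simp
  then have fin: "finite (carrier H)" by (simp add: H.order_gt_0_iff_finite)
  obtain e0 :: "'c \<Rightarrow> nat" where e0: "inj_on e0 (carrier H)"
    using finite_imp_inj_to_nat_seg[OF fin] by auto
  define e where "e a = {e0 a}" for a
  have e: "inj_on e (carrier H)" using e0 by (simp add: inj_on_def e_def)
  define K where "K = image_group e H"
  let ?E = "discrete_topology (carrier K)"
  have iso: "e \<in> iso H K" unfolding K_def by (rule inj_imp_image_group_iso[OF e])
  have K: "group K" unfolding K_def by (rule H.inj_imp_image_group_is_group[OF e])
  interpret K: group K by (rule K)
  have ehom: "e \<in> hom H K" and bij: "bij_betw e (carrier H) (carrier K)"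
    using iso by (auto simp: iso_def)
  have "order K = 2 ^ k" using bij ord bij_betw_same_card by (fastforce simp: order_def)
  then have pK: "pro2_group K ?E" by (rule finite_pro2_group[OF K])
  define e' where "e' = inv_into (carrier H) e"
  have iso': "e' \<in> iso K H" unfolding e'_def by (rule H.iso_set_sym[OF iso])
  have e'hom: "e' \<in> hom K H" using iso' by (simp add: iso_def)
  have e'e: "e' (e a) = a" if "a \<in> carrier H" for a
    unfolding e'_def using e that by (rule inv_into_f_f)
  have ee': "e (e' b) = b" if "b \<in> carrier K" for b
    using that bij unfolding e'_def by (simp add: bij_betw_def f_inv_into_f)
  define \<psi> where "\<psi> i a = e (if a = 0 then \<one>\<^bsub>H\<^esub> else h i)" for i and a :: int
  have \<psi>: "\<psi> i \<in> continuous_hom C2 C2_top K ?E" if i: "i \<le> d" for i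
  proof -
    have "\<psi> i a \<in> carrier K" for a
      using hom_in_carrier[OF ehom] h(1)[OF i] by (simp add: \<psi>_def)
    moreover have "\<psi> i (a \<otimes>\<^bsub>C2\<^esub> b) = \<psi> i a \<otimes>\<^bsub>K\<^esub> \<psi> i b" if "a \<in> carrier C2" "b \<in> carrier C2" for a b
      using that hom_mult[OF ehom, symmetric] h[OF i] unfolding carrier_C2 by (auto simp: \<psi>_def)
    ultimately show ?thesis by (auto simp: continuous_hom_def hom_def)
  qed
  obtain f where f: "f \<in> continuous_hom G T K ?E"
      "\<And>i a. i \<le> d \<Longrightarrow> a \<in> carrier C2 \<Longrightarrow> f (\<phi> i a) = \<psi> i a"
    and uniq: "\<And>g x. g \<in> continuous_hom G T K ?E \<Longrightarrow>
      (\<And>i a. i \<le> d \<Longrightarrow> a \<in> carrier C2 \<Longrightarrow> g (\<phi> i a) = \<psi> i a) \<Longrightarrow> x \<in> carrier G \<Longrightarrow> g x = f x"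
  proof -
    have "pro2_group K ?E \<and> (\<forall>i\<in>{0..d}. \<psi> i \<in> continuous_hom C2 C2_top K ?E)"
      using pK \<psi> by simp
    from free_product[unfolded is_pro2_free_product_def, THEN conjunct2, THEN conjunct2, THEN conjunct2,
        rule_format, OF this]
    obtain f where f: "f \<in> continuous_hom G T K ?E"
      "\<forall>i\<in>{0..d}. \<forall>a\<in>carrier C2. f (\<phi> i a) = \<psi> i a"
      "\<forall>g. g \<in> continuous_hom G T K ?E \<and> (\<forall>i\<in>{0..d}. \<forall>a\<in>carrier C2. g (\<phi> i a) = \<psi> i a)
        \<longrightarrow> (\<forall>x\<in>carrier G. g x = f x)" by blast
    show ?thesis
    proof (rule that)
      show "f \<in> continuous_hom G T K ?E" by (rule f(1))
      show "f (\<phi> i a) = \<psi> i a" if "i \<le> d" "a \<in> carrier C2" for i a using f(2) that by simp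
      show "g x = f x" if "g \<in> continuous_hom G T K ?E"
        "\<And>i a. i \<le> d \<Longrightarrow> a \<in> carrier C2 \<Longrightarrow> g (\<phi> i a) = \<psi> i a" "x \<in> carrier G" for g x
        using f(3)[rule_format, OF conjI, of g x] that by simp
    qed
  qed
  have fh: "f \<in> hom G K" and fc: "continuous_map T ?E f" using f(1) by (auto simp: continuous_hom_def)
  have 1: "e' \<circ> f \<in> continuous_hom G T H ?D"
    unfolding continuous_hom_def mem_Collect_eq
  proof
    show "e' \<circ> f \<in> hom G H" using fh e'hom by (auto simp: hom_def Pi_iff)
    show "continuous_map T ?D (e' \<circ> f)"
      using hom_in_carrier[OF e'hom] by (intro continuous_map_compose[OF fc]) auto
  qed
  have 2: "(e' \<circ> f) (gen i) = h i" if "i \<le> d" for i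
    using f(2)[OF that, of 1] h(1)[OF that] e'e by (simp add: gen_def carrier_C2 \<psi>_def)
  have 3: "g x = (e' \<circ> f) x" if g: "g \<in> continuous_hom G T H ?D" "\<And>i. i \<le> d \<Longrightarrow> g (gen i) = h i"
    and x: "x \<in> carrier G" for g x
  proof -
    have gh: "g \<in> hom G H" and gc: "continuous_map T ?D g" using g(1) by (auto simp: continuous_hom_def)
    have "e \<circ> g \<in> continuous_hom G T K ?E"
      unfolding continuous_hom_def mem_Collect_eq
    proof
      show "e \<circ> g \<in> hom G K" using gh ehom by (auto simp: hom_def Pi_iff)
      show "continuous_map T ?E (e \<circ> g)"
        using hom_in_carrier[OF ehom] by (intro continuous_map_compose[OF gc]) auto
    qed
    moreover have "(e \<circ> g) (\<phi> i a) = \<psi> i a" if "i \<le> d" "a \<in> carrier C2" for i a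
      using that g(2)[OF that(1)] hom_one[OF gh group_axioms H] \<phi>_zero[OF that(1)]
      unfolding carrier_C2 by (auto simp: \<psi>_def gen_def)
    ultimately have "(e \<circ> g) x = f x" using uniq x by blast
    then have "e' (e (g x)) = e' (f x)" by simp
    then show ?thesis using e'e hom_in_carrier[OF gh x] by simp
  qed
  show ?thesis using 1 2 3 by blast
qed

section \<open>Topological generation\<close>

text \<open>A point \<open>g\<close> outside \<open>K\<close> is still separated from
  \<open>K\<close> modulo some open normal \<open>N\<close>. The universal property for the image of
  \<open>K\<close> in \<open>G Mod N\<close> gives a homomorphism into this image that agrees with
  the projection on the generators; uniqueness for \<open>G Mod N\<close> makes it the projection,
  so the coset of \<open>g\<close> meets \<open>K\<close>.\<close>

lemma closed_subgroup_eq_carrier: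
  assumes K: "subgroup K G" "closedin T K" and gen: "\<And>i. i \<le> d \<Longrightarrow> gen i \<in> K"
  shows "K = carrier G"
proof (rule ccontr)
  assume "K \<noteq> carrier G"
  then obtain g where g: "g \<in> carrier G" "g \<notin> K" using subgroup.subset[OF K(1)] by auto
  let ?U = "{u \<in> carrier G. g \<otimes> u \<in> topspace T - K}"
  have "openin T (topspace T - K)" using K(2) by (rule openin_diff[OF openin_topspace])
  then have "openin T ?U" by (rule openin_preimage[OF continuous_translate_left[OF g(1)]])
  moreover have "\<one> \<in> ?U" using g by (simp add: topspace_eq)
  ultimately obtain N where N: "N \<lhd> G" "openin T N" "N \<subseteq> ?U" using open_normal_basis by blast
  interpret N: normal N G by (rule N(1))
  let ?P = "G Mod N" and ?q = "\<lambda>g. N #> g"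
  have P: "group ?P" by (rule N.factorgroup_is_group)
  interpret P: group ?P by (rule P)
  obtain k where k: "order ?P = 2 ^ k" using open_normal_index[OF N(1,2)] by blast
  have q: "?q \<in> hom G ?P" by (rule N.r_coset_hom_Mod)
  have Q: "subgroup (?q ` K) ?P"
  proof -
    interpret group_hom G ?P ?q by unfold_locales (rule q)
    show ?thesis by (rule subgroup_img_is_subgroup[OF K(1)])
  qed
  let ?Q = "?P\<lparr>carrier := ?q ` K\<rparr>"
  have gQ: "group ?Q" by (rule P.subgroup_imp_group[OF Q])
  have "card (rcosets\<^bsub>?P\<^esub> (?q ` K)) * card (?q ` K) = 2 ^ k"
    unfolding k[symmetric] by (rule P.lagrange[OF Q])
  then have "order ?Q dvd 2 ^ k"
    using dvd_triv_right[of "card (?q ` K)" "card (rcosets\<^bsub>?P\<^esub> (?q ` K))"] by (simp add: order_def)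
  then obtain j where j: "order ?Q = 2 ^ j" using divides_primepow_nat[OF two_is_prime_nat] by blast
  have sq: "?q (gen i) \<otimes>\<^bsub>?P\<^esub> ?q (gen i) = \<one>\<^bsub>?P\<^esub>" if "i \<le> d" for i
    using hom_mult[OF q gen_closed[OF that] gen_closed[OF that]] gen_square[OF that]
      hom_one[OF q group_axioms P] by simp
  have "\<exists>f. f \<in> continuous_hom G T ?Q (discrete_topology (carrier ?Q)) \<and> (\<forall>i\<le>d. f (gen i) = ?q (gen i))"
    using universal[OF gQ j, of "\<lambda>i. ?q (gen i)"] gen sq by auto
  then obtain f where f: "f \<in> hom G ?Q" "continuous_map T (discrete_topology (?q ` K)) f"
    "\<And>i. i \<le> d \<Longrightarrow> f (gen i) = ?q (gen i)"
    by (auto simp: continuous_hom_def)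
  let ?D = "discrete_topology (carrier ?P)"
  have KP: "?q ` K \<subseteq> carrier ?P" using subgroup.subset[OF Q] .
  have "f x \<in> carrier ?P" if "x \<in> carrier G" for x
    using hom_in_carrier[OF f(1) that] KP by auto
  then have "f \<in> hom G ?P" using f(1) by (auto simp: hom_def)
  moreover have "continuous_map T ?D f"
    using continuous_map_compose[OF f(2), of ?D id] KP by (auto simp: Pi_iff)
  ultimately have fP: "f \<in> continuous_hom G T ?P ?D" by (simp add: continuous_hom_def)
  have qP: "?q \<in> continuous_hom G T ?P ?D"
    unfolding continuous_hom_def mem_Collect_eq
  proof
    show "continuous_map T ?D ?q"
      unfolding continuous_map_def
    proof (intro conjI allI impI)
      show "?q \<in> topspace T \<rightarrow> topspace ?D" using hom_in_carrier[OF q] by (auto simp: topspace_eq)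
      show "openin T {x \<in> topspace T. ?q x \<in> V}" for V
      proof (subst openin_subopen, intro ballI)
        fix x assume "x \<in> {x \<in> topspace T. ?q x \<in> V}"
        then have x: "x \<in> carrier G" "?q x \<in> V" by (auto simp: topspace_eq)
        have sub: "N #> x \<subseteq> {x \<in> topspace T. ?q x \<in> V}"
        proof
          fix y assume y: "y \<in> N #> x"
          have "N #> x = N #> y" by (rule repr_independence[OF y x(1) N.subgroup_axioms])
          moreover have "y \<in> carrier G" using subsetD[OF r_coset_subset_G[OF N.subset x(1)] y] .
          ultimately show "y \<in> {x \<in> topspace T. ?q x \<in> V}" using x(2) by (simp add: topspace_eq)
        qed
        show "\<exists>S. openin T S \<and> x \<in> S \<and> S \<subseteq> {x \<in> topspace T. ?q x \<in> V}"
          by (intro exI[of _ "N #> x"] conjI openin_r_coset[OF N(2) x(1)]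
              rcos_self[OF x(1) N.subgroup_axioms] sub)
      qed
    qed
  qed (rule q)
  have "f g = ?q g"
  proof -
    have "\<exists>f. f \<in> continuous_hom G T ?P ?D \<and> (\<forall>i\<le>d. f (gen i) = ?q (gen i)) \<and>
        (\<forall>h. h \<in> continuous_hom G T ?P ?D \<and> (\<forall>i\<le>d. h (gen i) = ?q (gen i)) \<longrightarrow>
          (\<forall>x\<in>carrier G. h x = f x))"
      by (rule universal[OF P k hom_in_carrier[OF q gen_closed] sq])
    then obtain f' where u: "\<forall>h. h \<in> continuous_hom G T ?P ?D \<and> (\<forall>i\<le>d. h (gen i) = ?q (gen i)) \<longrightarrow>
        (\<forall>x\<in>carrier G. h x = f' x)"
      by (elim exE conjE) (rule that)
    have "f g = f' g" using u[rule_format, OF conjI[OF fP] g(1)] f(3) by simp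
    moreover have "?q g = f' g" using u[rule_format, OF conjI[OF qP] g(1)] by simp
    ultimately show ?thesis by simp
  qed
  moreover have "f g \<in> ?q ` K" using hom_in_carrier[OF f(1) g(1)] by simp
  ultimately obtain k where k: "k \<in> K" "N #> g = N #> k" by auto
  have kc: "k \<in> carrier G" using k subgroup.subset[OF K(1)] by auto
  have "k \<in> N #> g" using rcos_self[OF kc N.subgroup_axioms] k by simp
  then obtain n where n: "n \<in> N" "k = n \<otimes> g" by (auto simp: r_coset_def)
  have nc: "n \<in> carrier G" using n N.subset by auto
  \<comment> \<open>\<open>N\<close> was chosen to avoid \<open>K\<close> in products
    \<open>g \<otimes> u\<close> with \<open>u\<close> on the right, so \<open>n\<close> is moved
    there by conjugation.\<close>
  have "inv g \<otimes> n \<otimes> g \<in> N" using normal_conj[OF N(1) n(1) g(1)] .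
  then have "g \<otimes> (inv g \<otimes> n \<otimes> g) \<notin> K" using N(3) by auto
  moreover have "g \<otimes> (inv g \<otimes> n \<otimes> g) = k" using n nc g by (simp add: m_assoc[symmetric])
  ultimately show False using k by simp
qed

end

section \<open>Openness of the Zassenhaus filtration\<close>

context C2_free_product
begin

text \<open>Schreier's argument, with the closed subgroup generated by the Schreier generators.\<close>

lemma open_subgroup_finitely_generated:
  assumes M: "subgroup M G" "openin T M"
  shows "\<exists>Y. finite Y \<and> Y \<subseteq> M \<and> closed_generate G T Y = M"
proof -
  have Mc: "M \<subseteq> carrier G" using subgroup.subset[OF M(1)] .
  have "\<forall>C\<in>rcosets M. \<exists>g\<in>carrier G. C = M #> g" by (auto simp: RCOSETS_def)
  then obtain r where r: "\<And>C. C \<in> rcosets M \<Longrightarrow> r C \<in> carrier G" "\<And>C. C \<in> rcosets M \<Longrightarrow> C = M #> r C"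
    by metis
  define R where "R = insert \<one> (r ` (rcosets M))"
  \<comment> \<open>With \<open>\<one>\<close> in \<open>R\<close> and in \<open>S\<close>, a
    representative \<open>t\<close> that lies in \<open>M\<close> belongs to \<open>Y\<close>, as
    \<open>t \<otimes> \<one> \<otimes> inv \<one>\<close>.\<close>
  define S where "S = insert \<one> (gen ` {0..d})"
  define Y where "Y = (\<lambda>(t, s, t'). t \<otimes> s \<otimes> inv t') ` (R \<times> S \<times> R) \<inter> M"
  have R: "finite R" "R \<subseteq> carrier G" "\<one> \<in> R"
    using finite_rcosets_open_subgroup[OF M] r(1) by (auto simp: R_def)
  have S: "finite S" "S \<subseteq> carrier G" using gen_closed by (auto simp: S_def)
  have Y: "finite Y" "Y \<subseteq> M" using R S by (auto simp: Y_def)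
  have Yc: "Y \<subseteq> carrier G" using Y(2) Mc by (rule subset_trans)
  define K where "K = closed_generate G T Y"
  have K: "subgroup K G" "closedin T K" unfolding K_def by (rule closed_generate[OF Yc])+
  have Kc: "K \<subseteq> carrier G" using subgroup.subset[OF K(1)] .
  have YK: "Y \<subseteq> K" unfolding K_def by (rule subset_closed_generate)
  have KM: "K \<subseteq> M" unfolding K_def
    by (rule closed_generate_subset[OF M(1) closedin_open_subgroup[OF M] Y(2)])
  have repr: "\<exists>t\<in>R. g \<otimes> inv t \<in> M" if g: "g \<in> carrier G" for g
  proof -
    have C: "M #> g \<in> rcosets M" using g by (auto simp: RCOSETS_def)
    have "g \<in> M #> r (M #> g)" using rcos_self[OF g M(1)] r(2)[OF C] by simp
    then have "g \<otimes> inv (r (M #> g)) \<in> M" using r_coset_preimage[OF Mc r(1)[OF C]] by simp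
    moreover have "r (M #> g) \<in> R" using C by (simp add: R_def)
    ultimately show ?thesis by blast
  qed
  \<comment> \<open>A finite union of closed cosets, hence closed. Once it is stable under right
    multiplication by \<open>G\<close> it is everything, and each element of \<open>M\<close>
    differs from some \<open>t\<close> in \<open>R\<close> by an element of
    \<open>K\<close>.\<close>
  define Q where "Q = (\<Union>t\<in>R. K #> t)"
  have Q_iff: "g \<in> Q \<longleftrightarrow> g \<in> carrier G \<and> (\<exists>t\<in>R. g \<otimes> inv t \<in> K)" for g
  proof -
    have "K #> t = {x \<in> carrier G. x \<otimes> inv t \<in> K}" if "t \<in> R" for t
      using r_coset_preimage[OF Kc] that R(2) by blast
    then show ?thesis unfolding Q_def by auto
  qed
  have Qcl: "closedin T Q" unfolding Q_def
    using R by (intro closedin_Union) (auto intro: closedin_r_coset[OF K(2)])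
  have Q_gen: "q \<otimes> gen i \<in> Q" if q: "q \<in> Q" and i: "i \<le> d" for q i
  proof -
    from q obtain t where t: "q \<in> carrier G" "t \<in> R" "q \<otimes> inv t \<in> K" unfolding Q_iff by blast
    have tc: "t \<in> carrier G" using t(2) R(2) by blast
    obtain t' where t': "t' \<in> R" "t \<otimes> gen i \<otimes> inv t' \<in> M"
      using repr[of "t \<otimes> gen i"] tc gen_closed[OF i] by blast
    have t'c: "t' \<in> carrier G" using t'(1) R(2) by blast
    have "gen i \<in> S" using i by (simp add: S_def)
    then have "t \<otimes> gen i \<otimes> inv t' \<in> Y" unfolding Y_def
      using t' t(2) by (intro IntI image_eqI[of _ _ "(t, gen i, t')"]) simp_all
    then have "(q \<otimes> inv t) \<otimes> (t \<otimes> gen i \<otimes> inv t') \<in> K"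
      using YK subgroup.m_closed[OF K(1) t(3)] by blast
    moreover have "(q \<otimes> inv t) \<otimes> (t \<otimes> gen i \<otimes> inv t') = q \<otimes> (inv t \<otimes> t) \<otimes> gen i \<otimes> inv t'"
      using t(1) tc t'c gen_closed[OF i] by (simp only: m_assoc m_closed inv_closed)
    ultimately have "(q \<otimes> gen i) \<otimes> inv t' \<in> K" using t(1) tc by simp
    then show ?thesis unfolding Q_iff using t(1) t'(1) gen_closed[OF i] by blast
  qed
  have Qc: "Q \<subseteq> carrier G" using Q_iff by blast
  have Q1: "\<one> \<in> Q" unfolding Q_iff using R(3) subgroup.one_closed[OF K(1)] by (intro conjI bexI[of _ \<one>]) simp_all
  \<comment> \<open>An intersection of preimages of \<open>Q\<close>, so closedness is visible. The
    condition on \<open>inv g\<close> makes \<open>H\<close> a subgroup and costs nothing for the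
    generators, which are involutions.\<close>
  define H where "H = (\<Inter>q\<in>Q. {g \<in> carrier G. q \<otimes> g \<in> Q} \<inter> {g \<in> carrier G. q \<otimes> inv g \<in> Q})"
  have H_iff: "g \<in> H \<longleftrightarrow> g \<in> carrier G \<and> (\<forall>q\<in>Q. q \<otimes> g \<in> Q \<and> q \<otimes> inv g \<in> Q)" for g
    unfolding H_def using Q1 by blast
  have "H = carrier G"
  proof (rule closed_subgroup_eq_carrier)
    show "subgroup H G"
    proof (rule subgroupI)
      show "H \<subseteq> carrier G" using H_iff by blast
      have "\<one> \<in> H" unfolding H_iff using Qc by (simp add: subset_iff)
      then show "H \<noteq> {}" by blast
      show "inv a \<in> H" if "a \<in> H" for a using that unfolding H_iff by simp
      show "a \<otimes> b \<in> H" if "a \<in> H" "b \<in> H" for a b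
      proof -
        have ab: "a \<in> carrier G" "b \<in> carrier G" using that H_iff by blast+
        have "q \<otimes> (a \<otimes> b) \<in> Q \<and> q \<otimes> inv (a \<otimes> b) \<in> Q" if q: "q \<in> Q" for q
        proof -
          have qc: "q \<in> carrier G" using q Qc by blast
          have "q \<otimes> a \<in> Q" "q \<otimes> inv b \<in> Q" using q \<open>a \<in> H\<close> \<open>b \<in> H\<close> unfolding H_iff by blast+
          then have "(q \<otimes> a) \<otimes> b \<in> Q" "(q \<otimes> inv b) \<otimes> inv a \<in> Q"
            using \<open>a \<in> H\<close> \<open>b \<in> H\<close> unfolding H_iff by blast+
          then show ?thesis using ab qc by (simp add: m_assoc inv_mult_group)
        qed
        then show ?thesis unfolding H_iff using ab by simp
      qed
    qed
    show "closedin T H" unfolding H_def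
    proof (rule closedin_INT)
      show "Q \<noteq> {}" using Q1 by blast
      fix q assume "q \<in> Q"
      then have qc: "q \<in> carrier G" using Qc by blast
      have "continuous_map T T (\<lambda>g. q \<otimes> inv g)"
        using continuous_map_compose[OF continuous_inv continuous_translate_left[OF qc]] by (simp add: o_def)
      then show "closedin T ({g \<in> carrier G. q \<otimes> g \<in> Q} \<inter> {g \<in> carrier G. q \<otimes> inv g \<in> Q})"
        by (intro closedin_Int closedin_preimage[OF _ Qcl] continuous_translate_left qc)
    qed
    show "gen i \<in> H" if "i \<le> d" for i
    proof -
      have "inv (gen i) = gen i"
        using inv_equality[OF gen_square[OF that] gen_closed[OF that] gen_closed[OF that]] .
      then show ?thesis unfolding H_iff using gen_closed[OF that] Q_gen that by simp
    qed
  qed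
  have "M \<subseteq> K"
  proof
    fix m assume m: "m \<in> M"
    then have mc: "m \<in> carrier G" using Mc by blast
    have "\<one> \<otimes> m \<in> Q" using H_iff[of m] \<open>H = carrier G\<close> mc Q1 by blast
    then have "m \<in> Q" using mc by simp
    then obtain t where t: "t \<in> R" "m \<otimes> inv t \<in> K" unfolding Q_iff by blast
    have tc: "t \<in> carrier G" using t(1) R(2) by blast
    have "inv (m \<otimes> inv t) \<otimes> m \<in> M"
      using subsetD[OF KM t(2)] m subgroup.m_closed[OF M(1)] subgroup.m_inv_closed[OF M(1)] by blast
    moreover have "inv (m \<otimes> inv t) \<otimes> m = t \<otimes> (inv m \<otimes> m)"
      using mc tc by (simp add: inv_mult_group m_assoc)
    ultimately have tM: "t \<in> M" using mc tc by simp
    have "t \<in> Y" unfolding Y_def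
      using t(1) tM tc R(3) by (intro IntI image_eqI[of _ _ "(t, \<one>, \<one>)"]) (simp_all add: S_def)
    then have "(m \<otimes> inv t) \<otimes> t \<in> K" using YK subgroup.m_closed[OF K(1) t(2)] by blast
    then show "m \<in> K" using mc tc by (simp add: m_assoc)
  qed
  then show ?thesis using KM Y unfolding K_def by blast
qed

sublocale Zass: filtered_group G "zassenhaus G T"
  by (rule filtered_group_zassenhaus)

text \<open>Finitely many elements generate the open term topologically. Adjoining them to the next
  term one by one keeps the subgroup closed and at most doubles the number of cosets, so the index
  is finite; removing the finitely many other cosets, all closed, leaves an open set.\<close>

lemma zassenhaus_Suc_open:
  assumes n: "n \<ge> 1" and op: "openin T (zassenhaus G T n)"
  shows "finite (Zass.cosets_in (zassenhaus G T (Suc n)) (zassenhaus G T n))"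
    and "openin T (zassenhaus G T (Suc n))"
proof -
  let ?M = "zassenhaus G T n" and ?L = "zassenhaus G T (Suc n)"
  have M: "subgroup ?M G" and L: "subgroup ?L G" "closedin T ?L" "?L \<subseteq> carrier G"
    using closed_normal_subgroup[OF closed_normal_zassenhaus] closed_normal_subset[OF closed_normal_zassenhaus]
      closed_normal_zassenhaus[of "Suc n"] by (simp_all add: closed_normal_def)
  obtain Y where Y: "finite Y" "Y \<subseteq> ?M" "closed_generate G T Y = ?M"
    using open_subgroup_finitely_generated[OF M op] by blast
  have "\<exists>K. subgroup K G \<and> closedin T K \<and> ?L \<subseteq> K \<and> K \<subseteq> ?M \<and> X \<subseteq> K \<and> finite (Zass.cosets_in ?L K)"
    if "finite X" "X \<subseteq> ?M" for X
    using that
  proof (induction X rule: finite_induct)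
    case empty
    have "Zass.cosets_in ?L ?L = {?L}"
      using coset_join2[OF Zass.Z_carrier L(1)] subgroup.one_closed[OF L(1)] by force
    then have "finite (Zass.cosets_in ?L ?L)" by simp
    then show ?case using L zassenhaus_Suc_subset by blast
  next
    case (insert y X)
    then obtain K where K: "subgroup K G" "closedin T K" "?L \<subseteq> K" "K \<subseteq> ?M" "X \<subseteq> K"
      "finite (Zass.cosets_in ?L K)" by blast
    show ?case
    proof (cases "y \<in> K")
      case True
      then show ?thesis using K by blast
    next
      case False
      define K' where "K' = K \<union> (\<lambda>l. y \<otimes> l) ` K"
      have yM: "y \<in> ?M" and yc: "y \<in> carrier G" using insert.prems Zass.Z_carrier by auto
      have Kc: "K \<subseteq> carrier G" using subgroup.subset[OF K(1)] .
      have st: "Zass.step n K y K'" unfolding Zass.step_def using n K yM False by (simp add: K'_def)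
      have "(\<lambda>l. y \<otimes> l) ` K = {x \<in> carrier G. inv y \<otimes> x \<in> K}"
      proof (intro equalityI subsetI)
        fix x assume "x \<in> (\<lambda>l. y \<otimes> l) ` K"
        then obtain l where l: "l \<in> K" "x = y \<otimes> l" by blast
        have "l \<in> carrier G" using l(1) Kc by blast
        then show "x \<in> {x \<in> carrier G. inv y \<otimes> x \<in> K}" using l yc by (simp add: m_assoc[symmetric])
      next
        fix x assume x: "x \<in> {x \<in> carrier G. inv y \<otimes> x \<in> K}"
        then have "x = y \<otimes> (inv y \<otimes> x)" using yc by (simp add: m_assoc[symmetric])
        then show "x \<in> (\<lambda>l. y \<otimes> l) ` K" using x by blast
      qed
      then have "closedin T K'" unfolding K'_def
        using closedin_preimage[OF continuous_translate_left[OF inv_closed[OF yc]] K(2)]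
        by (simp add: closedin_Un[OF K(2)])
      moreover have "subgroup K' G" by (rule Zass.step_subgroup[OF st])
      moreover have "finite (Zass.cosets_in ?L K')"
        by (rule Zass.card_cosets_step[OF st Zass.Z_normal K(3) K(6)]) simp
      moreover have "K \<subseteq> K'" by (simp add: K'_def)
      moreover have "K' \<subseteq> ?M" unfolding K'_def using K(4) subgroup.m_closed[OF M yM] by blast
      moreover have "y \<otimes> \<one> \<in> K'" unfolding K'_def using subgroup.one_closed[OF K(1)] by blast
      then have "y \<in> K'" using yc by simp
      ultimately show ?thesis using K(3,5) by blast
    qed
  qed
  from this[OF Y(1,2)] obtain K where K: "subgroup K G" "closedin T K" "K \<subseteq> ?M" "Y \<subseteq> K"
    "finite (Zass.cosets_in ?L K)" by blast
  have "K = ?M" using closed_generate_subset[OF K(1,2,4)] K(3) unfolding Y(3) by blast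
  then show fin: "finite (Zass.cosets_in ?L ?M)" using K(5) by simp
  let ?U = "\<Union>(Zass.cosets_in ?L ?M - {?L})"
  have "closedin T ?U"
  proof (rule closedin_Union)
    show "finite (Zass.cosets_in ?L ?M - {?L})" using fin by simp
    show "closedin T C" if "C \<in> Zass.cosets_in ?L ?M - {?L}" for C
      using that closedin_r_coset[OF L(2)] Zass.Z_carrier by blast
  qed
  then have "openin T (?M - ?U)" using op by (rule openin_diff[rotated])
  moreover have "?M - ?U = ?L"
  proof (intro equalityI subsetI)
    fix x assume x: "x \<in> ?M - ?U"
    then have xc: "x \<in> carrier G" using Zass.Z_carrier by blast
    have xx: "x \<in> ?L #> x" using rcos_self[OF xc L(1)] .
    have "?L #> x = ?L"
    proof (rule ccontr)
      assume "?L #> x \<noteq> ?L"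
      then have "?L #> x \<in> Zass.cosets_in ?L ?M - {?L}" using x by blast
      then show False using xx x by blast
    qed
    then show "x \<in> ?L" using xx by simp
  next
    fix x assume x: "x \<in> ?L"
    have xM: "x \<in> ?M" using subsetD[OF zassenhaus_Suc_subset x] .
    have "x \<notin> C" if C: "C \<in> Zass.cosets_in ?L ?M - {?L}" for C
    proof
      assume xC: "x \<in> C"
      obtain g where g: "g \<in> ?M" "C = ?L #> g" using C by blast
      have "?L #> g = ?L #> x"
        using repr_independence[OF _ Zass.Z_carrier[OF g(1)] L(1)] xC g(2) by blast
      then show False using C g coset_join2[OF Zass.Z_carrier[OF x] L(1) x] by simp
    qed
    then show "x \<in> ?M - ?U" using xM by blast
  qed
  ultimately show "openin T ?L" by simp
qed

lemma zassenhaus_open: "openin T (zassenhaus G T n)"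
proof (induction n)
  case 0
  show ?case using openin_topspace[of T] by (simp add: zassenhaus_le_one topspace_eq)
next
  case (Suc n)
  then show ?case
  proof (cases "n = 0")
    case True
    then show ?thesis using openin_topspace[of T] by (simp add: zassenhaus_le_one topspace_eq)
  next
    case False
    then show ?thesis using zassenhaus_Suc_open(2)[OF _ Suc] by simp
  qed
qed

section \<open>The representation in the algebra of reduced words\<close>

text \<open>\<open>(1 + X_i)^2 = 1\<close> in characteristic 2, because a word with two equal
  neighbours is zero.\<close>

lemma ex_word_representation:
  assumes N: "N \<ge> 1"
  shows "\<exists>\<rho>. \<rho> \<in> continuous_hom G T (unit_group d N) (discrete_topology (carrier (unit_group d N))) \<and>
    (\<forall>i\<le>d. \<rho> (gen i) = 1 + letter N i)"
proof -
  have l: "letter N i = word_op N [i]" for i by (simp add: word_op_def)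
  have "1 + letter N i \<in> carrier (unit_group d N)" if "i \<le> d" for i
    using word_op_in_aug[of "[i]" d 1 N] that unfolding l by (simp add: unit_group_def)
  moreover have "(1 + letter N i) \<otimes>\<^bsub>unit_group d N\<^esub> (1 + letter N i) = \<one>\<^bsub>unit_group d N\<^esub>" for i
  proof -
    have "letter N i * letter N i = 0"
      unfolding l word_op_append by (rule word_op_eq_0) simp_all
    moreover have "(1 + letter N i) * (1 + letter N i)
        = 1 + (letter N i + letter N i) + letter N i * letter N i"
      by (simp add: distrib_left distrib_right add.assoc)
    ultimately show ?thesis by (simp add: unit_group_def endo_add_self)
  qed
  ultimately show ?thesis
    using universal[OF group_unit_group[OF N] order_unit_group, of "\<lambda>i. 1 + letter N i"] by blast
qed

text \<open>The \<open>g\<close> with \<open>\<rho> g - 1\<close> in \<open>aug d N k\<close> form a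
  subgroup, closed since the target of \<open>\<rho>\<close> is discrete. By minimality of the
  filtration only squares and commutators have to be checked, and for these the degrees of the
  factors add.\<close>

lemma zassenhaus_aug:
  assumes N: "N \<ge> 1"
    and \<rho>: "\<rho> \<in> continuous_hom G T (unit_group d N) (discrete_topology (carrier (unit_group d N)))"
    and k: "k \<ge> 1" "z \<in> zassenhaus G T k"
  shows "\<rho> z - 1 \<in> aug d N k"
  using k
proof (induction k arbitrary: z rule: less_induct)
  case (less k)
  let ?U = "unit_group d N"
  interpret U: group ?U by (rule group_unit_group[OF N])
  have hom: "\<rho> \<in> hom G ?U" and cont: "continuous_map T (discrete_topology (carrier ?U)) \<rho>"
    using \<rho> by (auto simp: continuous_hom_def)
  have mult: "\<rho> (g \<otimes> h) = \<rho> g * \<rho> h" if "g \<in> carrier G" "h \<in> carrier G" for g h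
    using hom_mult[OF hom that] by (simp add: unit_group_def)
  have one: "\<rho> \<one> = 1" using hom_one[OF hom group_axioms U.group_axioms] by (simp add: unit_group_def)
  have mult_inv: "\<rho> (inv g) * \<rho> g = 1" "\<rho> g * \<rho> (inv g) = 1" if "g \<in> carrier G" for g
    using mult[of "inv g" g] mult[of g "inv g"] that one by simp_all
  have aug1: "\<rho> g - 1 \<in> aug d N 1" if "g \<in> carrier G" for g
    using hom_in_carrier[OF hom that] by (auto simp: unit_group_def)
  have minus: "a - b = a + b" for a b :: "nat list endo"
    by (metis add_diff_cancel_right' add.assoc add_0_right endo_add_self)
  have inv_mult_aug: "\<rho> g * a \<in> aug d N j" if "g \<in> carrier G" "a \<in> aug d N j" for g a j
  proof -
    have "(\<rho> g - 1) * a \<in> aug d N j"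
      using aug_mult[OF aug1[OF that(1)] that(2)] aug_antimono[of j "1 + j" d N] by auto
    from aug_add[OF this that(2)] show ?thesis by (simp add: left_diff_distrib)
  qed
  show ?case
  proof (cases "k = 1")
    case True
    then show ?thesis using aug1 less.prems Zass.Z_carrier by blast
  next
    case False
    then have k2: "k \<ge> 2" using less.prems by simp
    let ?D = "{g \<in> carrier G. \<rho> g - 1 \<in> aug d N k}"
    have "zassenhaus G T k \<subseteq> ?D"
    proof (rule zassenhaus_least[OF k2])
      show "subgroup ?D G"
      proof (rule subgroupI)
        have "\<one> \<in> ?D" by (simp add: one zero_in_aug)
        then show "?D \<noteq> {}" by blast
        show "inv a \<in> ?D" if "a \<in> ?D" for a
        proof -
          have a: "a \<in> carrier G" "\<rho> a - 1 \<in> aug d N k" using that by simp_all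
          have "\<rho> (inv a) * (\<rho> a - 1) = 1 - \<rho> (inv a)"
            by (simp add: right_diff_distrib mult_inv(1)[OF a(1)])
          also have "\<dots> = \<rho> (inv a) - 1" by (simp only: minus add.commute)
          finally have "\<rho> (inv a) * (\<rho> a - 1) = \<rho> (inv a) - 1" .
          then show ?thesis using inv_mult_aug[OF inv_closed[OF a(1)] a(2)] a(1) by simp
        qed
        show "a \<otimes> b \<in> ?D" if "a \<in> ?D" "b \<in> ?D" for a b
        proof -
          have ab: "a \<in> carrier G" "b \<in> carrier G" "\<rho> a - 1 \<in> aug d N k" "\<rho> b - 1 \<in> aug d N k"
            using that by simp_all
          have eq: "\<rho> (a \<otimes> b) - 1 = \<rho> a * (\<rho> b - 1) + (\<rho> a - 1)"
            using mult[OF ab(1,2)] by (simp add: right_diff_distrib)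
          have "\<rho> (a \<otimes> b) - 1 \<in> aug d N k"
            unfolding eq by (rule aug_add[OF inv_mult_aug[OF ab(1,4)] ab(3)])
          then show ?thesis using ab(1,2) by simp
        qed
      qed auto
      have "closedin T {x \<in> topspace T. \<rho> x \<in> {u \<in> carrier ?U. u - 1 \<in> aug d N k}}"
        by (rule closedin_continuous_map_preimage[OF cont]) auto
      moreover have "{x \<in> topspace T. \<rho> x \<in> {u \<in> carrier ?U. u - 1 \<in> aug d N k}} = ?D"
        using hom_in_carrier[OF hom] by (auto simp: topspace_eq)
      ultimately show "closedin T ?D" by simp
    next
      fix x assume x: "x \<in> zassenhaus G T ((k + 1) div 2)"
      have xc: "x \<in> carrier G" using Zass.Z_carrier[OF x] .
      let ?j = "(k + 1) div 2"
      have "?j < k" "?j \<ge> 1" using k2 by auto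
      then have a: "\<rho> x - 1 \<in> aug d N ?j" using less.IH x by blast
      have "\<rho> (x \<otimes> x) - 1 = (\<rho> x - 1) * (\<rho> x - 1) + ((\<rho> x - 1) + (\<rho> x - 1))"
        by (simp add: mult[OF xc xc] left_diff_distrib right_diff_distrib)
      also have "\<dots> = (\<rho> x - 1) * (\<rho> x - 1)" by (simp only: endo_add_self add_0_right)
      also have "\<dots> \<in> aug d N (?j + ?j)" by (rule aug_mult[OF a a]) (use k2 in auto)
      also have "\<dots> \<subseteq> aug d N k" by (rule aug_antimono) linarith
      finally show "x \<otimes> x \<in> ?D" using xc by simp
    next
      fix i x y assume i: "i \<in> {1..<k}" and x: "x \<in> zassenhaus G T i" and y: "y \<in> zassenhaus G T (k - i)"
      have xc: "x \<in> carrier G" and yc: "y \<in> carrier G" using Zass.Z_carrier x y by auto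
      let ?a = "\<rho> x - 1" and ?b = "\<rho> y - 1" and ?c = "inv x \<otimes> inv y \<otimes> x \<otimes> y"
      have a: "?a \<in> aug d N i" using less.IH[of i x] i x by simp
      have b: "?b \<in> aug d N (k - i)" 
      proof (rule less.IH[OF _ _ y])
        show "k - i < k" "1 \<le> k - i" using i by auto
      qed
      have "?a * ?b \<in> aug d N k" "?b * ?a \<in> aug d N k"
        using aug_mult[OF a b] aug_mult[OF b a] i by simp_all
      then have ab: "?a * ?b - ?b * ?a \<in> aug d N k"
        unfolding minus[of "?a * ?b" "?b * ?a"] by (rule aug_add)
      \<comment> \<open>The units cancel in \<open>a b - b a\<close>, which equals
        \<open>\<rho> x * \<rho> y - \<rho> y * \<rho> x\<close>; the unit in front turns this into
        the commutator minus 1.\<close>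
      have "\<rho> (inv x \<otimes> inv y) * (?a * ?b - ?b * ?a) = \<rho> (inv x \<otimes> inv y) * (\<rho> x * \<rho> y) - \<rho> (inv x \<otimes> inv y) * (\<rho> y * \<rho> x)"
        by (simp add: left_diff_distrib right_diff_distrib)
      also have "\<rho> (inv x \<otimes> inv y) * (\<rho> x * \<rho> y) = \<rho> ?c"
        using xc yc by (simp add: mult[symmetric] m_assoc)
      also have "\<rho> (inv x \<otimes> inv y) * (\<rho> y * \<rho> x) = \<rho> ((inv x \<otimes> inv y) \<otimes> (y \<otimes> x))"
        using xc yc by (simp only: mult m_closed inv_closed)
      also have "(inv x \<otimes> inv y) \<otimes> (y \<otimes> x) = inv x \<otimes> (inv y \<otimes> y) \<otimes> x"
        using xc yc by (simp only: m_assoc m_closed inv_closed)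
      also have "\<dots> = \<one>" using xc yc by simp
      finally have "\<rho> ?c - 1 = \<rho> (inv x \<otimes> inv y) * (?a * ?b - ?b * ?a)" by (simp add: one)
      then show "?c \<in> ?D" using inv_mult_aug[OF _ ab, of "inv x \<otimes> inv y"] xc yc by simp
    qed
    then show ?thesis using less.prems by blast
  qed
qed

section \<open>From the word count to the dimensions\<close>

lemma zassenhaus_dim_signed_divisor_sum:
  assumes M: "M \<ge> 1"
  shows "(\<Sum>n | n dvd M. real (n * zassenhaus_dim G T n) * (-1) ^ (M div n - 1)) = real d ^ M - (-1) ^ M"
proof -
  \<comment> \<open>The divisors of \<open>M\<close> are at most \<open>M\<close>, so the layers
    below this level are enough.\<close>
  define N where "N = Suc M"
  have N: "N \<ge> 1" "M < N" by (simp_all add: N_def)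
  have fin: "finite (Zass.cosets_in (zassenhaus G T (Suc i)) (zassenhaus G T i))" if "i \<ge> 1" for i
    by (rule zassenhaus_Suc_open(1)[OF that zassenhaus_open])
  obtain ns where ns: "Zass.chain N (carrier G) ns" "set ns \<subseteq> {1..<N}"
    "\<And>i. i \<in> {1..<N} \<Longrightarrow> card (Zass.cosets_in (zassenhaus G T (Suc i)) (zassenhaus G T i)) = 2 ^ count_list ns i"
    using Zass.ex_chain[of N] fin N(1) by blast
  have dim: "zassenhaus_dim G T n = count_list ns n" if "n \<in> {1..<N}" for n
    using Zass.Z_quotient_dim[OF _ fin, of n] ns(3)[OF that] that by (simp add: zassenhaus_dim_def)
  obtain \<rho> where \<rho>: "\<rho> \<in> continuous_hom G T (unit_group d N) (discrete_topology (carrier (unit_group d N)))"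
    "\<And>i. i \<le> d \<Longrightarrow> \<rho> (gen i) = 1 + letter N i"
    using ex_word_representation[OF N(1)] by blast
  have \<rho>_mult: "\<rho> (g \<otimes> h) = \<rho> g * \<rho> h" if "g \<in> carrier G" "h \<in> carrier G" for g h
    using \<rho>(1) that by (auto simp: continuous_hom_def hom_def unit_group_def)
  have count: "card (words d 0 K) + num_ge ns K = 2 ^ length ns" if K: "K \<le> N" for K
  proof (rule Zass.word_count[OF N(1) K ns(1) gen_closed gen_square])
    fix H assume H: "subgroup H G" "zassenhaus G T N \<subseteq> H" "\<And>i. i \<le> d \<Longrightarrow> gen i \<in> H"
    \<comment> \<open>A subgroup above an open term of the filtration is open and hence closed, so
      topological generation becomes generation modulo that term.\<close>
    have "openin T H"
      by (rule openin_subgroup[OF H(1) zassenhaus_open _ H(2)])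
        (rule subgroup.one_closed[OF Zass.Z_subgroup])
    then show "H = carrier G"
      using closed_subgroup_eq_carrier[OF H(1) closedin_open_subgroup[OF H(1)] H(3)] by blast
  next
    show "\<rho> z - 1 \<in> aug d N k" if "k \<ge> 1" "z \<in> zassenhaus G T k" for k z
      by (rule zassenhaus_aug[OF N(1) \<rho>(1) that])
  qed (simp_all add: \<rho>_mult \<rho>(2))
  from signed_divisor_sums[OF ns(2) count[unfolded card_words] M N(2)]
  have "(\<Sum>n | n dvd M. real (n * count_list ns n) * (-1) ^ (M div n - 1)) = real d ^ M - (-1) ^ M" .
  moreover have "zassenhaus_dim G T n = count_list ns n" if "n \<in> {n. n dvd M}" for n
  proof -
    have "n \<le> M" "n > 0" using that M dvd_imp_le[of n M] dvd_pos_nat[of M n] by auto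
    then show ?thesis by (intro dim) (simp add: N_def)
  qed
  ultimately show ?thesis by simp
qed

end

theorem proposition4p4:
  fixes d n k m :: nat
    and G :: "('a, 'b) monoid_scheme" and T :: "'a topology"
    and \<phi> :: "nat \<Rightarrow> int \<Rightarrow> 'a"
  assumes "is_pro2_free_product TYPE(nat set) {0..d} (\<lambda>_. C2) (\<lambda>_. C2_top) G T \<phi>"
    and "m \<ge> 1" and "coprime m 2" and "n = 2 ^ k * m"
  shows "real (zassenhaus_dim G T n) = (\<Sum>j=0..k. w d (2 ^ j * m))"
proof -
  interpret C2_free_product d G T \<phi> by unfold_locales (rule assms(1))
  have "odd m" using assms(3) by simp
  then show ?thesis
    unfolding assms(4) by (intro w_sum_of_signed_divisor_sums zassenhaus_dim_signed_divisor_sum)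
qed

end
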